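(* Assume $\rho<1$. Let $a(w)=\sum_{|\gamma|\le m}c_\gamma w^\gamma$ be a real-valued elliptic Shubin polynomial on $\mathbb R^{2d}$ of degree $m\ge 2$ ($m\in\mathbb Z_+$), with principal part $a'(w)=\sum_{|\gamma|=m}c_\gamma w^\gamma$, and assume there is $B_1\ge1$ such that $a(w)>0$ for all $w\in Q^c_{B_1}$. Let $s>1/(1-\rho)$ be such that $M_p\subset p!^s$ in the Beurling case and $M_p\prec p!^s$ in the Roumieu case. Let $(\widehat M_n)_{n\in\mathbb N}$ be positive numbers with $\widehat M_0=1$ for which there is $C_0\ge1$ with $$C_0^{n-k}\frac{\widehat M_n}{(nm)!^s}\ge\frac{\widehat M_k}{(km)!^s}\quad\text{for all } n,k\in\mathbb N,\ n\ge k,$$ and let $P(\lambda)=\sum_{n=0}^\infty \lambda^n/\widehat M_n$, $\lambda\in\mathbb R$. Then: (i) the functions $w\mapsto P(|a(w)|)$ and $w\mapsto P(|a'(w)|)$, $\mathbb R^{2d}\to[0,\infty)$, are continuous and of ultrapolynomial growth of class $*$; (ii) the series $\sum_{n=0}^\infty a^{(\# n)}(w)/\widehat M_n$, $\sum_{n=0}^\infty (a(w))^n/\widehat M_n$ and $\sum_{n=0}^\infty (a'(w))^n/\widehat M_n$ converge absolutely in $\Gamma^{*,\infty}_{A_p,1}(\mathbb R^{2d})$; (iii) there exist $C>1$ and $B>0$ such that for all $w\in Q^c_B$ and $\gamma\in\mathbb N^{2d}$, $$\Big|\sum_{n=0}^\infty\frac{D^\gamma_w a^{(\# n)}(w)}{\widehat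 M_n}\Big|\le\frac{C^{|\gamma|+1}P(a(w))}{\langle w\rangle^{\rho|\gamma|}},\qquad |D^\gamma_w P(a(w))|\le \frac{C^{|\gamma|+1}P(a(w))}{\langle w\rangle^{\rho|\gamma|}},$$ $$\Big|D^\gamma_w\Big(P(a(w))-\sum_{n=0}^\infty\frac{a^{(\# n)}(w)}{\widehat M_n}\Big)\Big|\le\frac{C^{|\gamma|+1}P(a(w))}{\langle w\rangle^{\rho(|\gamma|+2)}};$$ in particular the symbols $\sum_{n=0}^\infty a^{(\# n)}/\widehat M_n$ and $P\circ a=\sum_{n=0}^\infty a^n/\widehat M_n$ are $\Gamma^{*,\infty}_{A_p,\rho}$-hypoelliptic; (iv) there exist $C>1$ and $B>0$ such that for all $w\in Q^c_B$ and $\gamma\in\mathbb N^{2d}$, $$|D^\gamma_w P(a'(w))|\le\frac{C^{|\gamma|+1}P(a'(w))}{\langle w\rangle^{\rho|\gamma|}},\qquad \Big|D^\gamma_w\Big(P(a'(w))-\sum_{n=0}^\infty\frac{a^{(\# n)}(w)}{\widehat M_n}\Big)\Big|\le\frac{C^{|\gamma|+1}P(a'(w))}{\langle w\rangle^{\rho(|\gamma|+1)}};$$ in particular $P\circ a'=\sum_{n=0}^\infty (a')^n/\widehat M_n$ is $\Gamma^{*,\infty}_{A_p,\rho}$-hypoelliptic.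
   Context: Weight sequences: for a sequence $(N_p)_{p\in\mathbb N}$ of positive numbers with $N_0=1$ consider the conditions (M.1) $N_p^2\le N_{p-1}N_{p+1}$, $p\ge1$; (M.2) there are $c_0,H\ge1$ with $N_p\le c_0H^p\min_{0\le q\le p}N_qN_{p-q}$; (M.3) there is $c_0>0$ with $\sum_{q>p}N_{q-1}/N_q\le c_0pN_p/N_{p+1}$; (M.3)' $\sum_{p\ge1}N_{p-1}/N_p<\infty$; (M.4) $(N_p/p!)^2\le (N_{p-1}/(p-1)!)(N_{p+1}/(p+1)!)$, $p\ge1$. Write $N_\alpha=N_{|\alpha|}$ for multi-indices, and $N(t)=\sup_{p\in\mathbb N}\ln_+(t^p/N_p)$, $t>0$, for the associated function. $N_p\subset L_p$ means $N_p\le CL^pL_p$ for some $C,L>0$ and all $p$; $N_p\prec L_p$ means that for every $L>0$ there is $C>0$ with this inequality. Standing assumptions: $A_p,M_p$ are weight sequences with $A_0=A_1=M_0=M_1=1$, $M_p$ satisfies (M.1),(M.2),(M.3), $A_p$ satisfies (M.1),(M.2),(M.3)',(M.4), $A_p\subset M_p$; $\rho_0=\inf\{r>0: A_p\subset M_p^r\}$ and $\rho$ is fixed with $\rho_0\le\rho\le1$ if the infimum is attained, $\rho_0<\rho\le1$ otherwise. The symbol $*$ denotes either the Beurling case $(M_p)$ or the Roumieu case $\{M_p\}$; in "A (resp. B)" formulations, A is the Beurling and B the Roumieu version. $\langle w\rangle=(1+|w|^2)^{1/2}$, $D^\alpha=i^{-|\alpha|}\partial^\alpha$. A measurable function $g$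 has ultrapolynomial growth of class $(M_p)$ (resp. $\{M_p\}$) if $\sup_w|g(w)|e^{-M(h|w|)}<\infty$ for some $h>0$ (resp. for every $h>0$). Symbol classes: for $0<r\le1$ and $h,m>0$, $\Gamma^{M_p,\infty}_{A_p,r}(\mathbb R^{2d};h,m)$ is the Banach space of $a\in C^\infty(\mathbb R^{2d})$ with finite norm $\sup_{\alpha,\beta\in\mathbb N^d}\sup_{(x,\xi)}|D^\alpha_\xi D^\beta_xa(x,\xi)|\langle(x,\xi)\rangle^{r(|\alpha|+|\beta|)}e^{-M(m|\xi|)-M(m|x|)}/(h^{|\alpha|+|\beta|}A_\alpha A_\beta)$; $\Gamma^{(M_p),\infty}_{A_p,r}(\mathbb R^{2d})=\varinjlim_{m\to\infty}\varprojlim_{h\to0}\Gamma^{M_p,\infty}_{A_p,r}(\mathbb R^{2d};h,m)$ and $\Gamma^{\{M_p\},\infty}_{A_p,r}(\mathbb R^{2d})=\varinjlim_{h\to\infty}\varprojlim_{m\to0}\Gamma^{M_p,\infty}_{A_p,r}(\mathbb R^{2d};h,m)$ (locally convex limits). For $t\ge0$, $Q_t=\{(x,\xi)\in\mathbb R^{2d}:\langle x\rangle<t,\langle\xi\rangle<t\}$, $Q_t^c=\mathbb R^{2d}\setminus Q_t$. A symbol $a\in\Gamma^{*,\infty}_{A_p,\rho}(\mathbb R^{2d})$ is $\Gamma^{*,\infty}_{A_p,\rho}$-hypoelliptic if there is $B>0$ such that: there are $c,m>0$ (resp. for every $m>0$ there is $c>0$) with $|a(x,\xi)|\ge ce^{-M(m|x|)-M(m|\xi|)}$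 on $Q_B^c$; and for every $h>0$ there is $C>0$ (resp. there are $h,C>0$) with $|D^\alpha_\xi D^\beta_xa(x,\xi)|\le Ch^{|\alpha|+|\beta|}A_\alpha A_\beta|a(x,\xi)|\langle(x,\xi)\rangle^{-\rho(|\alpha|+|\beta|)}$ for all $\alpha,\beta\in\mathbb N^d$, $(x,\xi)\in Q_B^c$. A polynomial $a(w)=\sum_{|\gamma|\le m}c_\gamma w^\gamma$ of degree $m$ on $\mathbb R^{2d}$ is an elliptic Shubin polynomial if its principal part $a'(w)=\sum_{|\gamma|=m}c_\gamma w^\gamma$ does not vanish for $w\neq0$. Sharp product: for formal sums $\sum_ja_j,\sum_jb_j$ of smooth functions, $\sum_ja_j\#\sum_jb_j=\sum_jc_j$ with $c_j(x,\xi)=\sum_{s+k+l=j}\sum_{|\alpha+\beta|=l}\frac{(-1)^{|\beta|}}{\alpha!\beta!2^l}\partial^\alpha_\xi D^\beta_xa_s(x,\xi)\,\partial^\beta_\xi D^\alpha_xb_k(x,\xi)$; a single symbol $a$ is identified with the formal sum $a+0+0+\cdots$. This product is associative; $a^{\#1}=a$ and $a^{\#n}=a^{\#(n-1)}\#a$, and $(\cdot)_k$ denotes the $k$-th term of a formal sum. For a polynomial $a$, $a^{(\#n)}:=\sum_{k\ge0}(a^{\#n})_k$ (a finite sum, hence a polynomial) for $n\ge1$, and $a^{(\#0)}:=1$. *)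

theory Defs
  imports "HOL-Analysis.Analysis"
begin

definition M1 :: "(nat \<Rightarrow> real) \<Rightarrow> bool" where
  "M1 N \<longleftrightarrow> (\<forall>p\<ge>1. (N p)^2 \<le> N (p-1) * N (p+1))"

definition M2 :: "(nat \<Rightarrow> real) \<Rightarrow> bool" where
  "M2 N \<longleftrightarrow> (\<exists>c0 H. c0 \<ge> 1 \<and> H \<ge> 1 \<and>
      (\<forall>p. \<forall>q\<le>p. N p \<le> c0 * H^p * (N q * N (p-q))))"

definition M3 :: "(nat \<Rightarrow> real) \<Rightarrow> bool" where
  "M3 N \<longleftrightarrow> (\<exists>c0>0. \<forall>p\<ge>1.
      summable (\<lambda>q. N (q + p) / N (q + p + 1)) \<and>
      (\<Sum>q. N (q + p) / N (q + p + 1)) \<le> c0 * real p * N p / N (p+1))"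

definition M3' :: "(nat \<Rightarrow> real) \<Rightarrow> bool" where
  "M3' N \<longleftrightarrow> summable (\<lambda>p. N p / N (p+1))"

definition M4 :: "(nat \<Rightarrow> real) \<Rightarrow> bool" where
  "M4 N \<longleftrightarrow> (\<forall>p\<ge>1. (N p / fact p)^2 \<le> (N (p-1) / fact (p-1)) * (N (p+1) / fact (p+1)))"

definition weight_seq :: "(nat \<Rightarrow> real) \<Rightarrow> bool" where
  "weight_seq N \<longleftrightarrow> (\<forall>p. N p > 0) \<and> N 0 = 1"

definition assocf :: "(nat \<Rightarrow> real) \<Rightarrow> real \<Rightarrow> real" where
  "assocf N t = (SUP p. max 0 (ln (t^p / N p)))"

definition wsubset :: "(nat \<Rightarrow> real) \<Rightarrow> (nat \<Rightarrow> real) \<Rightarrow> bool" where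
  "wsubset N L \<longleftrightarrow> (\<exists>C>0. \<exists>L0>0. \<forall>p. N p \<le> C * L0^p * L p)"

definition wprec :: "(nat \<Rightarrow> real) \<Rightarrow> (nat \<Rightarrow> real) \<Rightarrow> bool" where
  "wprec N L \<longleftrightarrow> (\<forall>L0>0. \<exists>C>0. \<forall>p. N p \<le> C * L0^p * L p)"

definition rho0 :: "(nat \<Rightarrow> real) \<Rightarrow> (nat \<Rightarrow> real) \<Rightarrow> real" where
  "rho0 A M = Inf {r. r > 0 \<and> wsubset A (\<lambda>p. M p powr r)}"

definition rho_admissible :: "(nat \<Rightarrow> real) \<Rightarrow> (nat \<Rightarrow> real) \<Rightarrow> real \<Rightarrow> bool" where
  "rho_admissible A M \<rho> \<longleftrightarrow>
     (if rho0 A M \<in> {r. r > 0 \<and> wsubset A (\<lambda>p. M p powr r)}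
      then rho0 A M \<le> \<rho> \<and> \<rho> \<le> 1 else rho0 A M < \<rho> \<and> \<rho> \<le> 1)"

type_synonym 'd phase = "(real^'d) \<times> (real^'d)"

text \<open>coordinates of R^{2d}: Inl j = x_j, Inr j = xi_j\<close>
definition coord :: "'d::finite phase \<Rightarrow> 'd + 'd \<Rightarrow> real" where
  "coord w i = (case i of Inl j \<Rightarrow> fst w $ j | Inr j \<Rightarrow> snd w $ j)"

definition cvec :: "'d + 'd \<Rightarrow> 'd::finite phase" where
  "cvec i = (case i of Inl j \<Rightarrow> (axis j 1, 0) | Inr j \<Rightarrow> (0, axis j 1))"

definition jbr :: "'a::real_normed_vector \<Rightarrow> real" where
  "jbr w = sqrt (1 + (norm w)^2)"

definition mlen :: "('i::finite \<Rightarrow> nat) \<Rightarrow> nat" where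
  "mlen \<alpha> = (\<Sum>i\<in>UNIV. \<alpha> i)"

definition mfact :: "('i::finite \<Rightarrow> nat) \<Rightarrow> real" where
  "mfact \<alpha> = (\<Prod>i\<in>UNIV. fact (\<alpha> i))"

definition pd :: "'d + 'd \<Rightarrow> ('d::finite phase \<Rightarrow> complex) \<Rightarrow> ('d phase \<Rightarrow> complex)" where
  "pd i f = (\<lambda>w. vector_derivative (\<lambda>t::real. f (w + t *\<^sub>R cvec i)) (at 0))"

definition iter_pd :: "('d + 'd) list \<Rightarrow> ('d::finite phase \<Rightarrow> complex) \<Rightarrow> ('d phase \<Rightarrow> complex)" where
  "iter_pd is f = foldr pd is f"

definition smooth :: "('d::finite phase \<Rightarrow> complex) \<Rightarrow> bool" where
  "smooth f \<longleftrightarrow> (\<forall>is w. iter_pd is f differentiable (at w))"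

text \<open>partial derivative of multi-order gamma (order irrelevant for smooth f)\<close>
definition dpow :: "('d + 'd \<Rightarrow> nat) \<Rightarrow> ('d::finite phase \<Rightarrow> complex) \<Rightarrow> ('d phase \<Rightarrow> complex)" where
  "dpow \<gamma> f = iter_pd (SOME is. \<forall>i. count_list is i = \<gamma> i) f"

definition Dw :: "('d + 'd \<Rightarrow> nat) \<Rightarrow> ('d::finite phase \<Rightarrow> complex) \<Rightarrow> ('d phase \<Rightarrow> complex)" where
  "Dw \<gamma> f = (\<lambda>w. (- \<i>) ^ mlen \<gamma> * dpow \<gamma> f w)"

definition dmix :: "('d \<Rightarrow> nat) \<Rightarrow> ('d \<Rightarrow> nat) \<Rightarrow> ('d::finite phase \<Rightarrow> complex) \<Rightarrow> ('d phase \<Rightarrow> complex)" where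
  "dmix \<alpha> \<beta> f = dpow (\<lambda>i. case i of Inl j \<Rightarrow> \<beta> j | Inr j \<Rightarrow> \<alpha> j) f"

definition DD :: "('d \<Rightarrow> nat) \<Rightarrow> ('d \<Rightarrow> nat) \<Rightarrow> ('d::finite phase \<Rightarrow> complex) \<Rightarrow> ('d phase \<Rightarrow> complex)" where
  "DD \<alpha> \<beta> f = (\<lambda>w. (- \<i>) ^ (mlen \<alpha> + mlen \<beta>) * dmix \<alpha> \<beta> f w)"

definition gvals :: "(nat \<Rightarrow> real) \<Rightarrow> (nat \<Rightarrow> real) \<Rightarrow> real \<Rightarrow> real \<Rightarrow> real
     \<Rightarrow> ('d::finite phase \<Rightarrow> complex) \<Rightarrow> real set" where
  "gvals A M r h m f = {cmod (DD \<alpha> \<beta> f (x, \<xi>)) * jbr (x, \<xi>) powr (r * real (mlen \<alpha> + mlen \<beta>))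
        * exp (- assocf M (m * norm \<xi>) - assocf M (m * norm x))
        / (h ^ (mlen \<alpha> + mlen \<beta>) * A (mlen \<alpha>) * A (mlen \<beta>)) | \<alpha> \<beta> x \<xi>. True}"

definition inGstep :: "(nat \<Rightarrow> real) \<Rightarrow> (nat \<Rightarrow> real) \<Rightarrow> real \<Rightarrow> real \<Rightarrow> real
     \<Rightarrow> ('d::finite phase \<Rightarrow> complex) \<Rightarrow> bool" where
  "inGstep A M r h m f \<longleftrightarrow> smooth f \<and> bdd_above (gvals A M r h m f)"

definition gnorm :: "(nat \<Rightarrow> real) \<Rightarrow> (nat \<Rightarrow> real) \<Rightarrow> real \<Rightarrow> real \<Rightarrow> real
     \<Rightarrow> ('d::finite phase \<Rightarrow> complex) \<Rightarrow> real" where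
  "gnorm A M r h m f = Sup (gvals A M r h m f)"

text \<open>beur = True: Beurling case (M_p); beur = False: Roumieu case {M_p}\<close>
definition Gamma :: "bool \<Rightarrow> (nat \<Rightarrow> real) \<Rightarrow> (nat \<Rightarrow> real) \<Rightarrow> real
     \<Rightarrow> ('d::finite phase \<Rightarrow> complex) set" where
  "Gamma beur A M r = {f. if beur then (\<exists>m>0. \<forall>h>0. inGstep A M r h m f)
                               else (\<exists>h>0. \<forall>m>0. inGstep A M r h m f)}"

definition seminorm_on :: "('a \<Rightarrow> complex) set \<Rightarrow> (('a \<Rightarrow> complex) \<Rightarrow> real) \<Rightarrow> bool" where
  "seminorm_on S p \<longleftrightarrow> (\<forall>f\<in>S. p f \<ge> 0) \<and>
     (\<forall>f\<in>S. \<forall>g\<in>S. p (\<lambda>w. f w + g w) \<le> p f + p g) \<and>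
     (\<forall>f\<in>S. \<forall>c. p (\<lambda>w. c * f w) = cmod c * p f)"

text \<open>continuous seminorms for the locally convex inductive limit topology:
  a seminorm is continuous iff its restriction to every step (a Frechet space) is continuous\<close>
definition cont_seminorm :: "bool \<Rightarrow> (nat \<Rightarrow> real) \<Rightarrow> (nat \<Rightarrow> real) \<Rightarrow> real
     \<Rightarrow> (('d::finite phase \<Rightarrow> complex) \<Rightarrow> real) \<Rightarrow> bool" where
  "cont_seminorm beur A M r p \<longleftrightarrow> seminorm_on (Gamma beur A M r) p \<and>
     (if beur then (\<forall>m>0. \<exists>h>0. \<exists>C. \<forall>f. (\<forall>h'>0. inGstep A M r h' m f) \<longrightarrow> p f \<le> C * gnorm A M r h m f)
      else (\<forall>h>0. \<exists>m>0. \<exists>C. \<forall>f. (\<forall>m'>0. inGstep A M r h m' f) \<longrightarrow> p f \<le> C * gnorm A M r h m f))"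

definition abs_conv_Gamma :: "bool \<Rightarrow> (nat \<Rightarrow> real) \<Rightarrow> (nat \<Rightarrow> real) \<Rightarrow> real
     \<Rightarrow> (nat \<Rightarrow> 'd::finite phase \<Rightarrow> complex) \<Rightarrow> bool" where
  "abs_conv_Gamma beur A M r F \<longleftrightarrow> (\<forall>n. F n \<in> Gamma beur A M r) \<and>
     (\<forall>p. cont_seminorm beur A M r p \<longrightarrow> summable (\<lambda>n. p (F n)))"

definition ultrapoly_growth :: "bool \<Rightarrow> (nat \<Rightarrow> real) \<Rightarrow> ('d::finite phase \<Rightarrow> real) \<Rightarrow> bool" where
  "ultrapoly_growth beur M g \<longleftrightarrow> g \<in> borel_measurable borel \<and>
     (if beur then (\<exists>h>0. \<exists>C. \<forall>w. \<bar>g w\<bar> \<le> C * exp (assocf M (h * norm w)))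
      else (\<forall>h>0. \<exists>C. \<forall>w. \<bar>g w\<bar> \<le> C * exp (assocf M (h * norm w))))"

definition Qset :: "real \<Rightarrow> 'd::finite phase set" where
  "Qset t = {(x, \<xi>). jbr x < t \<and> jbr \<xi> < t}"

definition hypoelliptic :: "bool \<Rightarrow> (nat \<Rightarrow> real) \<Rightarrow> (nat \<Rightarrow> real) \<Rightarrow> real
     \<Rightarrow> ('d::finite phase \<Rightarrow> complex) \<Rightarrow> bool" where
  "hypoelliptic beur A M \<rho> a \<longleftrightarrow> a \<in> Gamma beur A M \<rho> \<and>
     (\<exists>B>0.
       (if beur then
          (\<exists>c>0. \<exists>m>0. \<forall>x \<xi>. (x, \<xi>) \<notin> Qset B \<longrightarrow>
              cmod (a (x, \<xi>)) \<ge> c * exp (- assocf M (m * norm x) - assocf M (m * norm \<xi>)))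
          \<and> (\<forall>h>0. \<exists>C. \<forall>\<alpha> \<beta> w. w \<notin> Qset B \<longrightarrow>
              cmod (DD \<alpha> \<beta> a w) \<le> C * h ^ (mlen \<alpha> + mlen \<beta>) * A (mlen \<alpha>) * A (mlen \<beta>)
                 * cmod (a w) * jbr w powr (- \<rho> * real (mlen \<alpha> + mlen \<beta>)))
        else
          (\<forall>m>0. \<exists>c>0. \<forall>x \<xi>. (x, \<xi>) \<notin> Qset B \<longrightarrow>
              cmod (a (x, \<xi>)) \<ge> c * exp (- assocf M (m * norm x) - assocf M (m * norm \<xi>)))
          \<and> (\<exists>h>0. \<exists>C. \<forall>\<alpha> \<beta> w. w \<notin> Qset B \<longrightarrow>
              cmod (DD \<alpha> \<beta> a w) \<le> C * h ^ (mlen \<alpha> + mlen \<beta>) * A (mlen \<alpha>) * A (mlen \<beta>)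
                 * cmod (a w) * jbr w powr (- \<rho> * real (mlen \<alpha> + mlen \<beta>)))))"

definition monom :: "('d + 'd \<Rightarrow> nat) \<Rightarrow> 'd::finite phase \<Rightarrow> real" where
  "monom \<gamma> w = (\<Prod>i\<in>UNIV. coord w i ^ \<gamma> i)"

definition polyval :: "nat \<Rightarrow> (('d + 'd \<Rightarrow> nat) \<Rightarrow> real) \<Rightarrow> 'd::finite phase \<Rightarrow> real" where
  "polyval m c w = (\<Sum>\<gamma>\<in>{\<gamma>. mlen \<gamma> \<le> m}. c \<gamma> * monom \<gamma> w)"

definition principal :: "nat \<Rightarrow> (('d + 'd \<Rightarrow> nat) \<Rightarrow> real) \<Rightarrow> 'd::finite phase \<Rightarrow> real" where
  "principal m c w = (\<Sum>\<gamma>\<in>{\<gamma>. mlen \<gamma> = m}. c \<gamma> * monom \<gamma> w)"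

definition elliptic_shubin :: "nat \<Rightarrow> (('d::finite + 'd \<Rightarrow> nat) \<Rightarrow> real) \<Rightarrow> bool" where
  "elliptic_shubin m c \<longleftrightarrow> (\<forall>w::'d phase. w \<noteq> 0 \<longrightarrow> principal m c w \<noteq> 0)"

definition sharp :: "(nat \<Rightarrow> 'd::finite phase \<Rightarrow> complex) \<Rightarrow> (nat \<Rightarrow> 'd phase \<Rightarrow> complex)
     \<Rightarrow> nat \<Rightarrow> 'd phase \<Rightarrow> complex" where
  "sharp a b j w = (\<Sum>(s, k, l)\<in>{(s, k, l). s + k + l = j}.
     \<Sum>(\<alpha>, \<beta>)\<in>{(\<alpha>::'d \<Rightarrow> nat, \<beta>::'d \<Rightarrow> nat). mlen \<alpha> + mlen \<beta> = l}.
       complex_of_real ((-1) ^ mlen \<beta> / (mfact \<alpha> * mfact \<beta> * 2 ^ l))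
       * ((- \<i>) ^ mlen \<beta> * dmix \<alpha> \<beta> (a s) w)
       * ((- \<i>) ^ mlen \<alpha> * dmix \<beta> \<alpha> (b k) w))"

definition single :: "('d::finite phase \<Rightarrow> complex) \<Rightarrow> nat \<Rightarrow> 'd phase \<Rightarrow> complex" where
  "single f = (\<lambda>k. if k = 0 then f else (\<lambda>_. 0))"

text \<open>a^{#n} for n >= 1 (the value at n = 0 is irrelevant)\<close>
fun spow :: "('d::finite phase \<Rightarrow> complex) \<Rightarrow> nat \<Rightarrow> nat \<Rightarrow> 'd phase \<Rightarrow> complex" where
  "spow a 0 = single (\<lambda>_. 1)"
| "spow a (Suc 0) = single a"
| "spow a (Suc (Suc n)) = sharp (spow a (Suc n)) (single a)"

text \<open>a^{(#n)}: sum of all terms of the formal sum a^{#n} (finitely many nonzero for polynomials)\<close>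
definition spoly :: "('d::finite phase \<Rightarrow> complex) \<Rightarrow> nat \<Rightarrow> 'd phase \<Rightarrow> complex" where
  "spoly a n = (if n = 0 then (\<lambda>_. 1) else (\<lambda>w. \<Sum>k. spow a n k w))"

end

theory Submission
  imports Defs
begin

text \<open>All estimates rest on comparing the Taylor series of a symbol at \<open>w\<close> with that of
  \<open>B (1 + c (z\<^sub>1 + \<dots> + z\<^sub>2\<^sub>d))\<^sup>p\<close>. This relation is stable under products, and under differentiation it
  costs \<open>c p\<close>; so the \<open>j\<close>-th term of \<open>a\<^sup>#\<^sup>n\<close> is majorized with exponent \<open>nm - 2j\<close> and
  an extra factor \<open>(nm choose j) (\<tau> c\<^sup>2 nm) ^ j\<close>. Taking \<open>B = K \<langle>w\<rangle> ^ m\<close> and \<open>c = 1 / \<langle>w\<rangle>\<close> gives the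
  global bounds behind absolute convergence. Taking \<open>B = a w\<close>
  and \<open>c\<close> of order \<open>1 / \<langle>w\<rangle>\<close>, which ellipticity allows far out, gives bounds relative to \<open>P (a w)\<close>:
  the growth of \<open>Mh\<close> concentrates the series for \<open>P (a w)\<close> on \<open>nm\<close> up to order \<open>\<langle>w\<rangle> powr (1 - \<rho>)\<close>,
  because \<open>s (1 - \<rho>) \<ge> 1\<close>, so that each derivative costs \<open>c nm\<close>, of order \<open>\<langle>w\<rangle> powr - \<rho>\<close>, and each
  step in \<open>j\<close> gains the square of that. Far out, the error terms are therefore small
  compared with \<open>P (a w)\<close>, which gives hypoellipticity.\<close>

section \<open>Iterated partial derivatives and majorants\<close>

text \<open>The \<open>k\<close>-th derivative of the \<open>n\<close>-th term carries the falling
  factorial \<open>ff (n * m) k\<close>, unbounded in \<open>n\<close>; and in estimates relative to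
  \<open>P (a w)\<close> no constant may be raised to the power \<open>n\<close>. So
  \<open>B = a w\<close> has to be exact at order 0, with all constants moved into \<open>c\<close>,
  and \<open>N = n * m\<close> is replaced by a fixed cutoff \<open>J = j * m\<close> at the price
  of \<open>fact N / (fact J * J ^ (N - J))\<close>. Since \<open>s \<ge> 1\<close>, the growth of
  \<open>Mh\<close> pays for one such ratio, and the size of \<open>J\<close> leaves a geometric
  factor for the rest. In the global bounds, constants to the power \<open>n\<close> are harmless,
  because \<open>fact (n * m) powr s\<close> absorbs them. A derivative of order \<open>k\<close>
  costs \<open>fact k\<close> there, which (M.3)' and (M.4) bound by \<open>h ^ k\<close> times the
  weights for every \<open>h\<close>. Hence the Beurling and the Roumieu case share all derivative
  estimates and differ only in the scale inside the associated function.\<close>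

lemma iter_pd_simps [simp]:
  "iter_pd [] f = f" "iter_pd (i # is) f = pd i (iter_pd is f)"
  "iter_pd (is @ js) f = iter_pd is (iter_pd js f)"
  by (simp_all add: iter_pd_def)

lemma pd_eq:
  assumes "(f has_derivative f') (at w)"
  shows "pd i f w = f' (cvec i)"
proof -
  have "((\<lambda>t::real. w + t *\<^sub>R cvec i) has_derivative (\<lambda>t. t *\<^sub>R cvec i)) (at 0)"
    by (auto intro!: derivative_eq_intros)
  then have "((\<lambda>t::real. f (w + t *\<^sub>R cvec i)) has_derivative (\<lambda>t. f' (t *\<^sub>R cvec i))) (at 0)"
    by (rule has_derivative_compose) (use assms in simp)
  then have "((\<lambda>t::real. f (w + t *\<^sub>R cvec i)) has_vector_derivative f' (cvec i)) (at 0)"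
    using linear_scale[OF has_derivative_linear[OF assms]]
    by (simp add: has_vector_derivative_def)
  then show ?thesis
    unfolding pd_def by (rule vector_derivative_at)
qed

lemma pd_frechet: "f differentiable (at w) \<Longrightarrow> pd i f w = frechet_derivative f (at w) (cvec i)"
  by (rule pd_eq) (simp add: frechet_derivative_works)

lemma smooth_pd: "smooth f \<Longrightarrow> smooth (pd i f)"
  unfolding smooth_def by (metis iter_pd_simps)

lemma smooth_iter_pd: "smooth f \<Longrightarrow> smooth (iter_pd is f)"
  by (induction "is") (auto intro: smooth_pd)

lemma smooth_differentiable: "smooth f \<Longrightarrow> f differentiable (at w)"
  unfolding smooth_def by (metis iter_pd_simps(1))

text \<open>The tool for closure properties of \<open>smooth\<close>: naming a class closed under
  \<open>pd\<close> replaces Leibniz expansions of every order.\<close>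

lemma smooth_coinduct:
  assumes "f \<in> S" "\<And>f w. f \<in> S \<Longrightarrow> f differentiable (at w)" "\<And>f i. f \<in> S \<Longrightarrow> pd i f \<in> S"
  shows "smooth f"
proof -
  have "iter_pd is f \<in> S" for "is"
    by (induction "is") (simp_all add: assms)
  with assms(2) show ?thesis
    unfolding smooth_def by blast
qed

lemma pd_const [simp]: "pd i (\<lambda>_. z) = (\<lambda>_. 0)"
  by (rule ext) (rule pd_eq, auto)

lemma iter_pd_const: "is \<noteq> [] \<Longrightarrow> iter_pd is (\<lambda>_. z) = (\<lambda>_. 0)"
  by (induction "is") (auto, metis iter_pd_simps(1) pd_const)

lemma iter_pd_zero [simp]: "iter_pd is (\<lambda>_. 0) = (\<lambda>_. 0)"
  by (cases "is = []") (auto simp: iter_pd_const)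

lemma smooth_const [intro, simp]: "smooth (\<lambda>_. z)"
  by (rule smooth_coinduct[where S = "range (\<lambda>z _. z)"]) auto

lemma smooth_has_derivative: "smooth f \<Longrightarrow> (f has_derivative frechet_derivative f (at w)) (at w)"
  using smooth_differentiable frechet_derivative_works by blast

lemma pd_add:
  assumes "smooth f" "smooth g"
  shows "pd i (\<lambda>w. f w + g w) = (\<lambda>w. pd i f w + pd i g w)"
  using pd_eq[OF has_derivative_add[OF smooth_has_derivative smooth_has_derivative]] assms
  by (auto simp: fun_eq_iff pd_eq[OF smooth_has_derivative])

lemma pd_mult:
  assumes "smooth f" "smooth g"
  shows "pd i (\<lambda>w. f w * g w) = (\<lambda>w. pd i f w * g w + f w * pd i g w)"
proof
  fix w
  show "pd i (\<lambda>w. f w * g w) w = pd i f w * g w + f w * pd i g w"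
    using pd_eq[OF has_derivative_mult[OF smooth_has_derivative smooth_has_derivative], OF assms]
      assms by (simp add: pd_eq[OF smooth_has_derivative])
qed

lemma smooth_add [intro]:
  assumes "smooth f" "smooth g"
  shows "smooth (\<lambda>w. f w + g w)"
proof (rule smooth_coinduct)
  let ?S = "{\<lambda>w. f w + g w |f g. smooth f \<and> smooth g}"
  show "(\<lambda>w. f w + g w) \<in> ?S"
    using assms by blast
  show "f differentiable (at w)" if f: "f \<in> ?S" for f w
    using that by (auto intro: differentiable_add smooth_differentiable)
  show "pd i f \<in> ?S" if "f \<in> ?S" for f i
    using that by (auto simp: pd_add) (metis smooth_pd)
qed

lemma iter_pd_add:
  assumes "smooth f" "smooth g"
  shows "iter_pd is (\<lambda>w. f w + g w) = (\<lambda>w. iter_pd is f w + iter_pd is g w)"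
  by (induction "is") (use assms in \<open>simp_all add: pd_add smooth_iter_pd\<close>)

lemma smooth_mult [intro]:
  fixes f g :: "'d::finite phase \<Rightarrow> complex"
  assumes "smooth f" "smooth g"
  shows "smooth (\<lambda>w. f w * g w)"
proof (rule smooth_coinduct)
  \<comment> \<open>Products are not closed under \<open>pd\<close>, but finite sums of products
    are: each pair in the list becomes the two pairs \<open>(pd i f, g)\<close> and
    \<open>(f, pd i g)\<close>.\<close>
  let ?S = "{\<lambda>w. \<Sum>(f, g)\<leftarrow>xs. f w * g w |xs.
    \<forall>(f :: 'd phase \<Rightarrow> complex, g)\<in>set xs. smooth f \<and> smooth g}"
  show "(\<lambda>w. f w * g w) \<in> ?S"
    using assms by (auto intro!: exI[where x="[(f, g)]"])
  have *: "(\<lambda>w. \<Sum>(f, g)\<leftarrow>xs. f w * g w) differentiable (at w) \<and>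
      pd i (\<lambda>w. \<Sum>(f, g)\<leftarrow>xs. f w * g w) =
      (\<lambda>w. \<Sum>(f, g)\<leftarrow>concat (map (\<lambda>(f, g). [(pd i f, g), (f, pd i g)]) xs). f w * g w)"
    if "\<forall>(f, g)\<in>set xs. smooth f \<and> smooth g" for xs :: "(('d phase \<Rightarrow> complex) \<times> ('d phase \<Rightarrow> complex)) list" and w i
    using that
  proof (induction xs arbitrary: w)
    case (Cons x xs)
    obtain f g where x: "x = (f, g)" by force
    have fg: "smooth f" "smooth g" using Cons.prems x by auto
    have d: "(\<lambda>w. f w * g w) differentiable (at w)" for w
      by (intro differentiable_mult smooth_differentiable fg)
    note IH = Cons.IH
    have d': "(\<lambda>w. \<Sum>(f, g)\<leftarrow>xs. f w * g w) differentiable (at w)" for w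
      using IH Cons.prems by auto
    have "pd i (\<lambda>w. f w * g w + (\<Sum>(f, g)\<leftarrow>xs. f w * g w)) w =
        pd i (\<lambda>w. f w * g w) w + pd i (\<lambda>w. \<Sum>(f, g)\<leftarrow>xs. f w * g w) w" for w
      using pd_eq[OF has_derivative_add[OF d[unfolded frechet_derivative_works] d'[unfolded frechet_derivative_works]]]
      by (simp add: pd_frechet d d')
    moreover have "pd i (\<lambda>w. \<Sum>(f, g)\<leftarrow>xs. f w * g w) =
      (\<lambda>w. \<Sum>(f, g)\<leftarrow>concat (map (\<lambda>(f, g). [(pd i f, g), (f, pd i g)]) xs). f w * g w)"
      using IH Cons.prems by auto
    ultimately show ?case
      using d d' fg by (auto simp: x pd_mult intro!: differentiable_add)
  qed simp
  show "f differentiable (at w)" if f: "f \<in> ?S" for f w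
  proof -
    obtain xs where xs: "f = (\<lambda>w. \<Sum>(f, g)\<leftarrow>xs. f w * g w)" "\<forall>(f, g)\<in>set xs. smooth f \<and> smooth g"
      using f by auto
    show ?thesis
      unfolding xs(1) using *[OF xs(2)] by blast
  qed
  show "pd i f \<in> ?S" if f: "f \<in> ?S" for f i
  proof -
    obtain xs where xs: "f = (\<lambda>w. \<Sum>(f, g)\<leftarrow>xs. f w * g w)" "\<forall>(f, g)\<in>set xs. smooth f \<and> smooth g"
      using f by auto
    show ?thesis
      unfolding xs(1) using *[OF xs(2)] xs(2)
      by (auto intro!: exI[where x="concat (map (\<lambda>(f, g). [(pd i f, g), (f, pd i g)]) xs)"] smooth_pd)
  qed
qed

lemma smooth_cmult [intro]: "smooth f \<Longrightarrow> smooth (\<lambda>w. z * f w)"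
  by (rule smooth_mult) auto

lemma iter_pd_cmult:
  assumes "smooth f"
  shows "iter_pd is (\<lambda>w. z * f w) = (\<lambda>w. z * iter_pd is f w)"
  by (induction "is") (use assms in \<open>simp_all add: pd_mult smooth_iter_pd\<close>)

lemma smooth_sum [intro]: "(\<And>x. x \<in> I \<Longrightarrow> smooth (f x)) \<Longrightarrow> smooth (\<lambda>w. \<Sum>x\<in>I. f x w)"
  by (induction I rule: infinite_finite_induct) auto

lemma iter_pd_sum:
  assumes "\<And>x. x \<in> I \<Longrightarrow> smooth (f x)"
  shows "iter_pd is (\<lambda>w. \<Sum>x\<in>I. f x w) = (\<lambda>w. \<Sum>x\<in>I. iter_pd is (f x) w)"
  using assms by (induction I rule: infinite_finite_induct) (auto simp: iter_pd_add smooth_sum)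

lemma smooth_power [intro]: "smooth f \<Longrightarrow> smooth (\<lambda>w. f w ^ n)"
  by (induction n) auto

lemma smooth_prod [intro]: "(\<And>x. x \<in> I \<Longrightarrow> smooth (f x)) \<Longrightarrow> smooth (\<lambda>w. \<Prod>x\<in>I. f x w)"
  by (induction I rule: infinite_finite_induct) auto

text \<open>The falling factorial, that is, the \<open>k\<close>-th derivative of
  \<open>(1 + z) ^ p\<close> at 0. It vanishes for \<open>k > p\<close>, which later compensates for
  truncated subtraction in exponents.\<close>

fun ff :: "nat \<Rightarrow> nat \<Rightarrow> real" where
  "ff p 0 = 1"
| "ff p (Suc k) = real p * ff (p - 1) k"

lemma ff_nonneg [simp]: "ff p k \<ge> 0"
  by (induction k arbitrary: p) auto

lemma ff_binomial: "ff p k = fact k * real (p choose k)"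
proof (induction k arbitrary: p)
  case (Suc k)
  show ?case
  proof (cases p)
    case (Suc q)
    have "real (Suc k) * real (Suc q choose Suc k) = real (Suc q) * real (q choose k)"
      using Suc_times_binomial[of k q] by (metis of_nat_mult)
    then show ?thesis
      unfolding ff.simps Suc diff_Suc_1 Suc.IH fact_Suc of_nat_mult by (metis mult.assoc mult.commute)
  qed simp
qed simp

lemma ff_add: "ff p (l + k) = ff p l * ff (p - l) k"
  by (induction l arbitrary: p) auto

lemma ff_eq_0_iff: "ff p k = 0 \<longleftrightarrow> p < k"
  by (simp add: ff_binomial)

lemma ff_mono: "p \<le> q \<Longrightarrow> ff p k \<le> ff q k"
  by (simp add: ff_binomial binomial_right_mono)

lemma ff_le_power: "ff p k \<le> real p ^ k"
proof (induction k arbitrary: p)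
  case (Suc k)
  have "ff (p - 1) k \<le> real p ^ k"
    using Suc[of "p - 1"] by (rule order_trans) (auto intro: power_mono)
  then show ?case by (simp add: mult_left_mono)
qed simp

text \<open>The form for the global bounds: \<open>fact k\<close> is what the symbol classes
  tolerate, and \<open>2 ^ p\<close> is absorbed by the growth of \<open>Mh\<close>.\<close>

lemma ff_le_fact: "ff p k \<le> fact k * 2 ^ p"
proof -
  have "p choose k \<le> 2 ^ p"
    by (metis binomial_eq_0 binomial_le_pow2 linorder_not_le zero_le)
  then have "real (p choose k) \<le> 2 ^ p"
    by (metis of_nat_le_iff of_nat_numeral of_nat_power)
  then show ?thesis by (simp add: ff_binomial)
qed

text \<open>Says that, coefficient by coefficient, the Taylor series of \<open>f\<close> at \<open>w\<close> is majorized by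
  that of \<open>B * (1 + c * (z\<^sub>1 + \<dots> + z\<^sub>2\<^sub>d)) ^ p\<close> at the origin.\<close>
definition maj :: "'d::finite phase \<Rightarrow> real \<Rightarrow> nat \<Rightarrow> real \<Rightarrow> ('d phase \<Rightarrow> complex) \<Rightarrow> bool" where
  "maj w c p B f \<longleftrightarrow> (\<forall>is. cmod (iter_pd is f w) \<le> B * c ^ length is * ff p (length is))"

lemma majD: "maj w c p B f \<Longrightarrow> cmod (iter_pd is f w) \<le> B * c ^ length is * ff p (length is)"
  by (simp add: maj_def)

lemma maj_nonneg: "maj w c p B f \<Longrightarrow> B \<ge> 0"
  using majD[of w c p B f "[]"] order_trans[OF norm_ge_zero] by simp

lemma maj_mono:
  assumes "maj w c p B f" "0 \<le> c" "c \<le> c'" "p \<le> p'" "B \<le> B'"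
  shows "maj w c' p' B' f"
  unfolding maj_def
proof
  fix "is" :: "('a + 'a) list"
  have B: "B \<ge> 0" by (rule maj_nonneg) fact
  have "cmod (iter_pd is f w) \<le> B * c ^ length is * ff p (length is)"
    by (rule majD) fact
  also have "\<dots> \<le> B' * c' ^ length is * ff p' (length is)"
    using assms B by (intro mult_mono power_mono ff_mono) auto
  finally show "cmod (iter_pd is f w) \<le> B' * c' ^ length is * ff p' (length is)" .
qed

lemma maj_const: "c \<ge> 0 \<Longrightarrow> maj w c 0 (cmod z) (\<lambda>_. z)"
  unfolding maj_def
proof
  fix "is" :: "('a + 'a) list" assume "c \<ge> 0"
  then show "cmod (iter_pd is (\<lambda>_. z) w) \<le> cmod z * c ^ length is * ff 0 (length is)"
    by (cases "is = []") (simp_all add: iter_pd_const)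
qed

lemma maj_zero: "c \<ge> 0 \<Longrightarrow> B \<ge> 0 \<Longrightarrow> maj w c p B (\<lambda>_. 0)"
  by (simp add: maj_def)

lemma maj_add:
  "smooth f \<Longrightarrow> smooth g \<Longrightarrow> maj w c p B f \<Longrightarrow> maj w c p B' g \<Longrightarrow> maj w c p (B + B') (\<lambda>w. f w + g w)"
  unfolding maj_def by (auto simp: iter_pd_add algebra_simps intro: norm_triangle_mono)

lemma maj_cmult: "smooth f \<Longrightarrow> maj w c p B f \<Longrightarrow> maj w c p (cmod z * B) (\<lambda>w. z * f w)"
  unfolding maj_def by (auto simp: iter_pd_cmult norm_mult mult.assoc intro: mult_left_mono)

lemma maj_sum:
  assumes "c \<ge> 0" "\<And>x. x \<in> I \<Longrightarrow> smooth (f x)" "\<And>x. x \<in> I \<Longrightarrow> maj w c p (B x) (f x)"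
  shows "maj w c p (\<Sum>x\<in>I. B x) (\<lambda>w. \<Sum>x\<in>I. f x w)"
  using assms by (induction I rule: infinite_finite_induct) (auto intro!: maj_zero maj_add smooth_sum)

lemma maj_iter_pd:
  "maj w c p B f \<Longrightarrow> maj w c (p - length js) (B * c ^ length js * ff p (length js)) (iter_pd js f)"
  unfolding maj_def
proof
  fix "is" :: "('a + 'a) list"
  assume "\<forall>is. cmod (iter_pd is f w) \<le> B * c ^ length is * ff p (length is)"
  then have "cmod (iter_pd (is @ js) f w) \<le> B * c ^ length (is @ js) * ff p (length (is @ js))" by blast
  then show "cmod (iter_pd is (iter_pd js f) w)
      \<le> B * c ^ length js * ff p (length js) * c ^ length is * ff (p - length js) (length is)"
    by (simp add: power_add mult_ac add.commute[of "length is"] ff_add)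
qed

lemma maj_mult:
  assumes "smooth f" "smooth g" "maj w c p B f" "maj w c q D g" "c \<ge> 0"
  shows "maj w c (p + q) (B * D) (\<lambda>w. f w * g w)"
  unfolding maj_def
proof
  fix "is"
  show "cmod (iter_pd is (\<lambda>w. f w * g w) w) \<le> B * D * c ^ length is * ff (p + q) (length is)"
    using assms
  \<comment> \<open>The last entry of the list is the innermost derivative. It acts on the product
    itself and yields two products, to which the induction hypothesis applies with
    \<open>p - 1\<close> or \<open>q - 1\<close>.\<close>
  proof (induction "is" arbitrary: f g p q B D rule: rev_induct)
    case Nil
    then show ?case
      using majD[of w c p B f "[]"] majD[of w c q D g "[]"] maj_nonneg[of w c p B f]
      by (auto simp: norm_mult intro: mult_mono)
  next
    case (snoc i "is")
    let ?n = "length is"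
    have B: "B \<ge> 0" "D \<ge> 0" using snoc.prems maj_nonneg by blast+
    have pf: "maj w c (p - 1) (B * c * p) (pd i f)" and pg: "maj w c (q - 1) (D * c * q) (pd i g)"
      using maj_iter_pd[of w c p B f "[i]"] maj_iter_pd[of w c q D g "[i]"] snoc.prems by simp_all
    have "iter_pd (is @ [i]) (\<lambda>w. f w * g w) w
        = iter_pd is (\<lambda>w. pd i f w * g w) w + iter_pd is (\<lambda>w. f w * pd i g w) w"
      using snoc.prems by (simp add: pd_mult iter_pd_add smooth_mult smooth_pd)
    then have "cmod (iter_pd (is @ [i]) (\<lambda>w. f w * g w) w)
        \<le> cmod (iter_pd is (\<lambda>w. pd i f w * g w) w) + cmod (iter_pd is (\<lambda>w. f w * pd i g w) w)"
      by (simp add: norm_triangle_ineq)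
    also have "\<dots> \<le> (B * c * p) * D * c ^ ?n * ff (p - 1 + q) ?n
        + B * (D * c * q) * c ^ ?n * ff (p + (q - 1)) ?n"
      using snoc.prems pf pg by (intro add_mono snoc.IH smooth_pd) auto
    also have "\<dots> = B * D * c ^ length (is @ [i]) * (p * ff (p - 1 + q) ?n + q * ff (p + (q - 1)) ?n)"
      by (simp add: algebra_simps)
    \<comment> \<open>Both summands carry \<open>ff (p + q - 1) ?n\<close>, and \<open>p + q\<close>
      times this is the next falling factorial. If \<open>p\<close> or \<open>q\<close> is 0,
      truncation spoils the argument, but the factor in front is then 0.\<close>
    also have "p * ff (p - 1 + q) ?n + q * ff (p + (q - 1)) ?n = ff (p + q) (length (is @ [i]))"
      by (cases p; cases q) (simp_all add: algebra_simps)
    finally show ?case .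
  qed
qed

lemma maj_power:
  assumes "smooth f" "maj w c p B f" "c \<ge> 0"
  shows "maj w c (n * p) (B ^ n) (\<lambda>w. f w ^ n)"
proof (induction n)
  case 0
  show ?case using maj_const[OF assms(3), of w 1] by simp
next
  case (Suc n)
  with assms show ?case
    by (auto intro!: maj_mult)
qed

lemma maj_prod:
  assumes "c \<ge> 0" "\<And>x. x \<in> I \<Longrightarrow> smooth (f x)" "\<And>x. x \<in> I \<Longrightarrow> maj w c (p x) (B x) (f x)"
  shows "maj w c (\<Sum>x\<in>I. p x) (\<Prod>x\<in>I. B x) (\<lambda>w. \<Prod>x\<in>I. f x w)"
  using assms
proof (induction I rule: infinite_finite_induct)
  case (insert x F)
  then show ?case by (auto intro!: maj_mult)
qed (use maj_const[OF assms(1), of w 1] in simp_all)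

section \<open>Polynomial symbols and sharp powers\<close>

lemma jbr_ge_1 [simp]: "jbr w \<ge> 1"
  by (simp add: jbr_def)

lemma jbr_pos [simp]: "jbr w > 0"
  using jbr_ge_1[of w] by linarith

lemma jbr_nonneg [simp]: "jbr w \<ge> 0"
  using jbr_ge_1[of w] by linarith

lemma jbr_nonzero [simp]: "jbr w \<noteq> 0"
  using jbr_pos[of w] by linarith

lemma norm_le_jbr: "norm w \<le> jbr w"
  by (simp add: jbr_def real_le_rsqrt)

lemma jbr_le: "jbr w \<le> 1 + norm w"
  unfolding jbr_def by (rule real_le_lsqrt) (simp_all add: power2_sum)

lemma abs_coord_le: "\<bar>coord w i\<bar> \<le> norm w"
proof (cases i)
  case (Inl j)
  then have "\<bar>coord w i\<bar> \<le> norm (fst w)" by (simp add: coord_def component_le_norm_cart)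
  also have "\<dots> \<le> norm w" by (metis norm_fst_le prod.collapse)
  finally show ?thesis .
next
  case (Inr j)
  then have "\<bar>coord w i\<bar> \<le> norm (snd w)" by (simp add: coord_def component_le_norm_cart)
  also have "\<dots> \<le> norm w" by (metis norm_snd_le prod.collapse)
  finally show ?thesis .
qed

lemma bounded_linear_coord: "bounded_linear (\<lambda>w. coord w i)"
proof (rule bounded_linear_intro[where K = 1])
  show "norm (coord w i) \<le> norm w * 1" for w using abs_coord_le[of w i] by simp
qed (auto simp: coord_def split: sum.split)

lemma has_derivative_coord:
  "((\<lambda>w. complex_of_real (coord w i)) has_derivative (\<lambda>h. complex_of_real (coord h i))) (at w)"
  by (rule bounded_linear_imp_has_derivative)
    (rule bounded_linear_compose[OF bounded_linear_of_real bounded_linear_coord])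

lemma pd_coord: "pd j (\<lambda>w. complex_of_real (coord w i)) = (\<lambda>_. if i = j then 1 else 0)"
  by (rule ext, subst pd_eq[OF has_derivative_coord])
    (auto simp: coord_def cvec_def axis_def split: sum.split)

lemma smooth_coord [intro]: "smooth (\<lambda>w. complex_of_real (coord w i))"
proof (rule smooth_coinduct)
  let ?S = "insert (\<lambda>w. complex_of_real (coord w i)) (range (\<lambda>z _. z))"
  show "f differentiable (at w)" if "f \<in> ?S" for f w
    using that differentiableI[OF has_derivative_coord[of i w]] by auto
  show "pd j f \<in> ?S" if "f \<in> ?S" for f j
    using that by (auto simp: pd_coord)
qed simp

text \<open>The origin of the scale \<open>1 / jbr w\<close>: a coordinate has size at most
  \<open>jbr w\<close>, and its derivative is at most 1, which is
  \<open>jbr w * (1 / jbr w)\<close>.\<close>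

lemma maj_coord: "maj w (1 / jbr w) 1 (jbr w) (\<lambda>w. complex_of_real (coord w i))"
  unfolding maj_def
proof
  fix "is" :: "('a + 'a) list"
  show "cmod (iter_pd is (\<lambda>w. complex_of_real (coord w i)) w)
      \<le> jbr w * (1 / jbr w) ^ length is * ff 1 (length is)"
  proof (cases "is" rule: rev_cases)
    case Nil
    then show ?thesis
      using order_trans[OF abs_coord_le norm_le_jbr] by simp
  next
    case (snoc js j)
    then show ?thesis
      by (cases "js = []") (simp_all add: pd_coord iter_pd_const)
  qed
qed

lemma finite_mlen_le [simp]: "finite {\<gamma> :: 'i::finite \<Rightarrow> nat. mlen \<gamma> \<le> m}"
proof (rule finite_subset)
  show "{\<gamma> :: 'i \<Rightarrow> nat. mlen \<gamma> \<le> m} \<subseteq> UNIV \<rightarrow>\<^sub>E {..m}"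
  proof
    fix \<gamma> :: "'i \<Rightarrow> nat" assume "\<gamma> \<in> {\<gamma>. mlen \<gamma> \<le> m}"
    then have "\<gamma> i \<le> m" for i
      using member_le_sum[of i UNIV \<gamma>] by (simp add: mlen_def)
    then show "\<gamma> \<in> UNIV \<rightarrow>\<^sub>E {..m}" by auto
  qed
qed (simp add: finite_PiE)

lemma poly_smooth:
  "smooth (\<lambda>w. complex_of_real (\<Sum>\<gamma>\<in>G. c \<gamma> * monom \<gamma> w))"
  unfolding monom_def of_real_sum of_real_mult of_real_prod of_real_power
  by (intro smooth_sum smooth_cmult smooth_prod smooth_power smooth_coord)

lemma poly_maj:
  assumes "\<And>\<gamma>. \<gamma> \<in> G \<Longrightarrow> mlen \<gamma> \<le> p"
  shows "maj w (1 / jbr w) p ((\<Sum>\<gamma>\<in>G. \<bar>c \<gamma>\<bar>) * jbr w ^ p)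
    (\<lambda>w. complex_of_real (\<Sum>\<gamma>\<in>G. c \<gamma> * monom \<gamma> w))"
proof -
  have *: "maj w (1 / jbr w) p (cmod (complex_of_real (c \<gamma>)) * jbr w ^ p)
      (\<lambda>w. complex_of_real (c \<gamma>) * (\<Prod>i\<in>UNIV. complex_of_real (coord w i) ^ \<gamma> i))"
    if "\<gamma> \<in> G" for \<gamma>
  proof (rule maj_cmult)
    have 1: "maj w (1 / jbr w) (\<Sum>i\<in>UNIV. \<gamma> i * 1) (\<Prod>i\<in>UNIV. jbr w ^ \<gamma> i)
        (\<lambda>w. \<Prod>i\<in>UNIV. complex_of_real (coord w i) ^ \<gamma> i)"
      by (intro maj_prod maj_power smooth_power smooth_coord maj_coord) auto
    have 2: "(\<Prod>i\<in>UNIV. jbr w ^ \<gamma> i) \<le> jbr w ^ p"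
      using assms[OF that] by (simp add: mlen_def power_increasing flip: power_sum)
    show "maj w (1 / jbr w) p (jbr w ^ p) (\<lambda>w. \<Prod>i\<in>UNIV. complex_of_real (coord w i) ^ \<gamma> i)"
      by (rule maj_mono[OF 1 _ _ _ 2]) (use assms[OF that] in \<open>simp_all add: mlen_def\<close>)
  qed (intro smooth_prod smooth_power smooth_coord)
  show ?thesis
    unfolding monom_def of_real_sum of_real_mult of_real_prod of_real_power sum_distrib_right
    by (rule maj_sum) (use * in \<open>auto intro!: smooth_cmult smooth_prod smooth_power smooth_coord\<close>)
qed

section \<open>Multi-indices and lists of directions\<close>

lemma ex_count_list:
  fixes \<gamma> :: "'i::finite \<Rightarrow> nat"
  shows "\<exists>is. \<forall>i. count_list is i = \<gamma> i"
proof -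
  obtain xs :: "'i list" where xs: "set xs = UNIV" "distinct xs"
    using finite_distinct_list[OF finite] by blast
  have "count_list (concat (map (\<lambda>i. replicate (\<gamma> i) i) ys)) i = (if i \<in> set ys then \<gamma> i else 0)"
    if "distinct ys" for ys i
  proof -
    have "count_list (replicate n j) i = (if i = j then n else 0)" for n and j :: 'i
      by (induction n) auto
    then show ?thesis using that by (induction ys) auto
  qed
  then show ?thesis using xs by (metis UNIV_I)
qed

text \<open>\<open>dpow\<close> orders the derivatives by \<open>SOME\<close>. The list obtained
  here is the same for all \<open>f\<close>, and its length is all that majorants see.\<close>

lemma dpow_iter_pd:
  obtains "is" where "length is = mlen \<gamma>" "\<And>f. dpow \<gamma> f = iter_pd is f"
proof
  let ?L = "SOME is. \<forall>i. count_list is i = \<gamma> i"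
  have L: "\<forall>i. count_list ?L i = \<gamma> i"
    by (rule someI_ex) (rule ex_count_list)
  have "length ?L = (\<Sum>i\<in>set ?L. count_list ?L i)"
    by (simp add: sum_count_set)
  also have "\<dots> = (\<Sum>i\<in>UNIV. count_list ?L i)"
    by (rule sum.mono_neutral_left) (auto simp: count_list_0_iff)
  finally show "length ?L = mlen \<gamma>" using L by (simp add: mlen_def)
  show "dpow \<gamma> f = iter_pd ?L f" for f by (simp add: dpow_def)
qed

lemma mlen_case_sum: "mlen (\<lambda>i. case i of Inl j \<Rightarrow> \<beta> j | Inr j \<Rightarrow> \<alpha> j) = mlen \<alpha> + mlen \<beta>"
proof -
  have "mlen (\<lambda>i. case i of Inl j \<Rightarrow> \<beta> j | Inr j \<Rightarrow> \<alpha> j)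
      = (\<Sum>i\<in>UNIV <+> UNIV. case i of Inl j \<Rightarrow> \<beta> j | Inr j \<Rightarrow> \<alpha> j)"
    by (simp add: mlen_def)
  also have "\<dots> = mlen \<alpha> + mlen \<beta>"
    by (subst sum.Plus) (simp_all add: mlen_def)
  finally show ?thesis .
qed

lemma dmix_iter_pd:
  obtains "is" where "length is = mlen \<alpha> + mlen \<beta>" "\<And>f. dmix \<alpha> \<beta> f = iter_pd is f"
  using dpow_iter_pd[of "\<lambda>i. case i of Inl j \<Rightarrow> \<beta> j | Inr j \<Rightarrow> \<alpha> j"]
  by (metis dmix_def mlen_case_sum)

lemma smooth_dmix: "smooth f \<Longrightarrow> smooth (dmix \<alpha> \<beta> f)"
  by (metis dmix_iter_pd smooth_iter_pd)

lemma maj_dmix: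
  assumes "maj w c p B f" "mlen \<alpha> + mlen \<beta> = l"
  shows "maj w c (p - l) (B * c ^ l * ff p l) (dmix \<alpha> \<beta> f)"
  using maj_iter_pd[OF assms(1)] assms(2) by (metis dmix_iter_pd)

section \<open>Majorants for the sharp product\<close>

definition midx :: "nat \<Rightarrow> (('d::finite \<Rightarrow> nat) \<times> ('d \<Rightarrow> nat)) set" where
  "midx l = {(\<alpha>, \<beta>). mlen \<alpha> + mlen \<beta> = l}"

lemma finite_midx [simp]: "finite (midx l)"
  by (rule finite_subset[of _ "{\<alpha>. mlen \<alpha> \<le> l} \<times> {\<beta>. mlen \<beta> \<le> l}"]) (auto simp: midx_def)

definition sharp_term where
  "sharp_term l \<alpha> \<beta> f g w =
     complex_of_real ((-1) ^ mlen \<beta> / (mfact \<alpha> * mfact \<beta> * 2 ^ l))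
       * ((- \<i>) ^ mlen \<beta> * dmix \<alpha> \<beta> f w) * ((- \<i>) ^ mlen \<alpha> * dmix \<beta> \<alpha> g w)"

lemma sharp_single:
  "sharp b (single a) j = (\<lambda>w. \<Sum>l\<le>j. \<Sum>(\<alpha>, \<beta>)\<in>midx l. sharp_term l \<alpha> \<beta> (b (j - l)) a w)"
proof
  fix w
  let ?g = "\<lambda>(s, k, l). \<Sum>(\<alpha>, \<beta>)\<in>midx l. sharp_term l \<alpha> \<beta> (b s) (single a k) w"
  have fin: "finite {(s, k, l). s + k + l = j}"
    by (rule finite_subset[of _ "{..j} \<times> {..j} \<times> {..j}"]) auto
  have dz: "dmix \<beta> \<alpha> (\<lambda>_. 0) = (\<lambda>_. 0)" for \<alpha> \<beta> :: "'a \<Rightarrow> nat"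
    by (rule dmix_iter_pd[of \<beta> \<alpha>]) simp
  have "sharp b (single a) j w = sum ?g {(s, k, l). s + k + l = j}"
    unfolding sharp_def midx_def sharp_term_def by simp
  \<comment> \<open>The right factor has no terms of positive index, so only \<open>k = 0\<close>
    survives, with \<open>s = j - l\<close>.\<close>
  also have "\<dots> = sum ?g ((\<lambda>l. (j - l, 0, l)) ` {..j})"
    by (rule sum.mono_neutral_right[OF fin])
      (auto simp: image_iff single_def dz sharp_term_def intro!: sum.neutral)
  also have "\<dots> = (\<Sum>l\<le>j. ?g (j - l, 0, l))"
    by (subst sum.reindex) (auto intro: inj_onI)
  finally show "sharp b (single a) j w = (\<Sum>l\<le>j. \<Sum>(\<alpha>, \<beta>)\<in>midx l. sharp_term l \<alpha> \<beta> (b (j - l)) a w)"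
    by (simp add: single_def)
qed

lemma smooth_sharp_term:
  assumes "smooth f" "smooth g"
  shows "smooth (sharp_term l \<alpha> \<beta> f g)"
  unfolding sharp_term_def
  by (intro smooth_mult smooth_const smooth_dmix assms)

lemma smooth_spow:
  assumes "smooth a"
  shows "smooth (spow a n j)"
  using assms
proof (induction a n arbitrary: j rule: spow.induct)
  case (3 a n)
  then show ?case
    by (auto simp: sharp_single case_prod_unfold intro!: smooth_sum smooth_sharp_term)
qed (auto simp: single_def)

lemma mfact_pos: "mfact \<alpha> > 0"
  by (simp add: mfact_def prod_pos)

lemma maj_sharp_term:
  assumes f: "smooth f" "maj w c p B f" and g: "smooth g" "maj w c q D g" and "c \<ge> 0"
    and l: "mlen \<alpha> + mlen \<beta> = l"
  shows "maj w c (p - l + (q - l))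
    (1 / (mfact \<alpha> * mfact \<beta> * 2 ^ l) * ((B * c ^ l * ff p l) * (D * c ^ l * ff q l)))
    (sharp_term l \<alpha> \<beta> f g)"
proof -
  have "maj w c (p - l + (q - l))
      (cmod (complex_of_real ((-1) ^ mlen \<beta> / (mfact \<alpha> * mfact \<beta> * 2 ^ l)) * (- \<i>) ^ mlen \<beta> * (- \<i>) ^ mlen \<alpha>)
        * ((B * c ^ l * ff p l) * (D * c ^ l * ff q l)))
      (\<lambda>w. complex_of_real ((-1) ^ mlen \<beta> / (mfact \<alpha> * mfact \<beta> * 2 ^ l)) * (- \<i>) ^ mlen \<beta> * (- \<i>) ^ mlen \<alpha>
        * (dmix \<alpha> \<beta> f w * dmix \<beta> \<alpha> g w))"
    using f g l \<open>c \<ge> 0\<close>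
    by (intro maj_cmult maj_mult smooth_mult smooth_dmix maj_dmix) auto
  moreover have "cmod (complex_of_real ((-1) ^ mlen \<beta> / (mfact \<alpha> * mfact \<beta> * 2 ^ l)) * (- \<i>) ^ mlen \<beta> * (- \<i>) ^ mlen \<alpha>)
      = 1 / (mfact \<alpha> * mfact \<beta> * 2 ^ l)"
    using mfact_pos[of \<alpha>] mfact_pos[of \<beta>] by (simp add: norm_mult norm_power norm_divide)
  moreover have "sharp_term l \<alpha> \<beta> f g = (\<lambda>w. complex_of_real ((-1) ^ mlen \<beta> / (mfact \<alpha> * mfact \<beta> * 2 ^ l)) * (- \<i>) ^ mlen \<beta> * (- \<i>) ^ mlen \<alpha>
        * (dmix \<alpha> \<beta> f w * dmix \<beta> \<alpha> g w))"
    by (simp add: fun_eq_iff sharp_term_def)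
  ultimately show ?thesis by simp
qed

text \<open>By the multinomial theorem in \<open>2 * d\<close> variables this is
  \<open>d ^ l / fact l\<close>. The \<open>itself\<close> argument transmits the dimension
  \<open>d\<close>.\<close>

definition sharp_weight :: "'d::finite itself \<Rightarrow> nat \<Rightarrow> real" where
  "sharp_weight _ l = (\<Sum>(\<alpha> :: 'd \<Rightarrow> nat, \<beta> :: 'd \<Rightarrow> nat)\<in>midx l. 1 / (mfact \<alpha> * mfact \<beta> * 2 ^ l))"

lemma sharp_weight_nonneg: "sharp_weight T l \<ge> 0"
  unfolding sharp_weight_def using less_imp_le[OF mfact_pos]
  by (auto intro!: sum_nonneg mult_nonneg_nonneg)

lemma midx_0: "midx 0 = {(\<lambda>_. 0, \<lambda>_. 0)}"
  by (auto simp: midx_def mlen_def)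

lemma sharp_weight_0: "sharp_weight T 0 = 1"
  by (simp add: sharp_weight_def midx_0 mfact_def)

text \<open>Any base whose \<open>l\<close>-th power dominates
  \<open>sharp_weight T l * fact l\<close> for \<open>l \<le> m\<close> would serve. The sum
  dominates each of its terms, and the added 1 keeps its powers at least as large for
  \<open>l \<ge> 1\<close>.\<close>

definition sharp_const :: "'d::finite itself \<Rightarrow> nat \<Rightarrow> real" where
  "sharp_const T m = 1 + (\<Sum>l\<le>m. sharp_weight T l * fact l)"

lemma sharp_const_ge_1: "sharp_const T m \<ge> 1"
  by (auto simp: sharp_const_def sharp_weight_nonneg intro!: sum_nonneg)

lemma sharp_weight_ff_le: "sharp_weight T l * ff m l \<le> sharp_const T m ^ l * (m choose l)"
proof (cases "l \<le> m")
  case True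
  have "sharp_weight T l * fact l \<le> sharp_const T m ^ l"
  proof (cases "l = 0")
    case False
    have "sharp_weight T l * fact l \<le> sharp_const T m"
      unfolding sharp_const_def
      using member_le_sum[of l "{..m}" "\<lambda>l. sharp_weight T l * fact l"] True
      by (simp add: sharp_weight_nonneg add_increasing)
    also have "\<dots> \<le> sharp_const T m ^ l"
      using False sharp_const_ge_1[of T m] by (simp add: self_le_power)
    finally show ?thesis .
  qed (simp add: sharp_weight_0)
  then have "sharp_weight T l * fact l * (m choose l) \<le> sharp_const T m ^ l * (m choose l)"
    by (intro mult_right_mono) auto
  then show ?thesis by (simp add: ff_binomial mult.assoc)
next
  case False
  then have "ff m l = 0" by (simp add: ff_eq_0_iff)
  then show ?thesis using sharp_const_ge_1[of T m] by simp
qed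

text \<open>The combinatorial size of the \<open>j\<close>-th term of a sharp power, with
  \<open>N = n * m\<close>. The guard records that later terms vanish and keeps the exponent
  \<open>N - 2 * j\<close> free of truncation.\<close>

definition spow_coef :: "nat \<Rightarrow> nat \<Rightarrow> real" where
  "spow_coef N j = (if 2 * j \<le> N then real (N choose j) * real N ^ j else 0)"

lemma spow_coef_nonneg [simp]: "spow_coef N j \<ge> 0"
  by (simp add: spow_coef_def)

lemma maj_zero_coef: "maj w c p 0 f \<Longrightarrow> c \<ge> 0 \<Longrightarrow> B \<ge> 0 \<Longrightarrow> maj w c q B f"
  by (auto simp: maj_def)

text \<open>The recursion for one more sharp factor: \<open>ff m l\<close> supplies
  \<open>m choose l\<close>, the falling factorial of the left factor supplies \<open>N ^ l\<close>,
  and Vandermonde's identity adds up the binomials.\<close>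

lemma spow_coef_Suc:
  "(\<Sum>l\<le>j. sharp_weight T l * (spow_coef N (j - l) * sharp_const T m ^ (j - l) * ff (N - 2 * (j - l)) l * ff m l))
    \<le> sharp_const T m ^ j * spow_coef (N + m) j"
proof (cases "2 * j \<le> N + m")
  case True
  let ?t = "sharp_const T m"
  have t: "?t \<ge> 0" using sharp_const_ge_1[of T m] by linarith
  have "sharp_weight T l * (spow_coef N (j - l) * ?t ^ (j - l) * ff (N - 2 * (j - l)) l * ff m l)
      \<le> ?t ^ j * (real N ^ j * ((N choose (j - l)) * (m choose l)))" if l: "l \<le> j" for l
  proof -
    have c: "spow_coef N (j - l) \<le> real (N choose (j - l)) * real N ^ (j - l)"
      by (simp add: spow_coef_def)
    have f: "ff (N - 2 * (j - l)) l \<le> real N ^ l"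
      using ff_mono[of "N - 2 * (j - l)" N l] ff_le_power[of N l] by linarith
    have "sharp_weight T l * (spow_coef N (j - l) * ?t ^ (j - l) * ff (N - 2 * (j - l)) l * ff m l)
        = (sharp_weight T l * ff m l) * (?t ^ (j - l) * (spow_coef N (j - l) * ff (N - 2 * (j - l)) l))"
      by (simp add: mult_ac)
    also have "\<dots> \<le> (?t ^ l * (m choose l)) * (?t ^ (j - l) * ((real (N choose (j - l)) * real N ^ (j - l)) * real N ^ l))"
      using c f t by (intro mult_mono sharp_weight_ff_le mult_nonneg_nonneg) auto
    also have "\<dots> = (?t ^ l * ?t ^ (j - l)) * ((real N ^ (j - l) * real N ^ l) * ((N choose (j - l)) * (m choose l)))"
      by (simp add: mult_ac)
    also have "\<dots> = ?t ^ j * (real N ^ j * ((N choose (j - l)) * (m choose l)))"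
      using l by (simp flip: power_add)
    finally show ?thesis .
  qed
  then have "(\<Sum>l\<le>j. sharp_weight T l * (spow_coef N (j - l) * ?t ^ (j - l) * ff (N - 2 * (j - l)) l * ff m l))
      \<le> (\<Sum>l\<le>j. ?t ^ j * (real N ^ j * ((N choose (j - l)) * (m choose l))))"
    by (intro sum_mono) auto
  also have "\<dots> = ?t ^ j * (real N ^ j * ((m + N) choose j))"
    by (simp add: vandermonde[of m N j, symmetric] sum_distrib_left mult_ac)
  also have "\<dots> \<le> ?t ^ j * spow_coef (N + m) j"
    using True t by (auto simp: spow_coef_def add.commute mult.commute intro!: mult_left_mono power_mono)
  finally show ?thesis .
next
  case False
  \<comment> \<open>If all three factors were nonzero, then \<open>2 * (j - l) + l \<le> N\<close>
    and \<open>l \<le> m\<close>, whence \<open>2 * j \<le> N + m\<close>.\<close>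
  have "spow_coef N (j - l) * ff (N - 2 * (j - l)) l * ff m l = 0" if "l \<le> j" for l
    using False that by (auto simp: spow_coef_def ff_eq_0_iff)
  then have "(\<Sum>l\<le>j. sharp_weight T l * (spow_coef N (j - l) * sharp_const T m ^ (j - l) * ff (N - 2 * (j - l)) l * ff m l)) = 0"
    by (intro sum.neutral) auto
  with False show ?thesis by (simp add: spow_coef_def)
qed

lemma maj_spow:
  fixes a :: "'d::finite phase \<Rightarrow> complex"
  assumes a: "smooth a" "maj w c m b a" and c: "c \<ge> 0"
  shows "maj w c (Suc n * m - 2 * j)
    (b ^ Suc n * (c\<^sup>2 * sharp_const TYPE('d) m) ^ j * spow_coef (Suc n * m) j) (spow a (Suc n) j)"
proof (induction n arbitrary: j)
  case 0
  show ?case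
    using a maj_nonneg[OF a(2)] c sharp_const_ge_1[of "TYPE('d)" m]
    by (cases "j = 0") (auto simp: single_def spow_coef_def intro!: maj_zero mult_nonneg_nonneg zero_le_power)
next
  case (Suc n)
  let ?t = "sharp_const TYPE('d) m" and ?N = "Suc n * m"
  let ?B = "\<lambda>j. b ^ Suc n * (c\<^sup>2 * ?t) ^ j * spow_coef ?N j"
  let ?p = "\<lambda>l. ?N - 2 * (j - l)"
  let ?D = "\<lambda>l. (?B (j - l) * c ^ l * ff (?p l) l) * (b * c ^ l * ff m l)"
  have b: "b \<ge> 0" by (rule maj_nonneg) fact
  have t: "?t \<ge> 0" using sharp_const_ge_1[of "TYPE('d)" m] by linarith
  have B0: "?B j \<ge> 0" for j using b c t by simp
  have D0: "?D l \<ge> 0" for l using b c B0 by simp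
  have *: "maj w c (Suc (Suc n) * m - 2 * j) (1 / (mfact \<alpha> * mfact \<beta> * 2 ^ l) * ?D l)
      (sharp_term l \<alpha> \<beta> (spow a (Suc n) (j - l)) a)" if "l \<le> j" "(\<alpha>, \<beta>) \<in> midx l" for l \<alpha> \<beta>
  proof -
    have m: "maj w c (?p l - l + (m - l)) (1 / (mfact \<alpha> * mfact \<beta> * 2 ^ l) * ?D l)
      (sharp_term l \<alpha> \<beta> (spow a (Suc n) (j - l)) a)"
      using that by (intro maj_sharp_term smooth_spow a c Suc.IH) (auto simp: midx_def)
    show ?thesis
    \<comment> \<open>Without truncation the exponents add up exactly. Otherwise \<open>?D l\<close>
      has a zero factor, and a majorant with coefficient 0 holds with every exponent.\<close>
    proof (cases "l \<le> ?p l \<and> l \<le> m \<and> 2 * (j - l) \<le> ?N")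
      case True
      then have "?p l - l + (m - l) = Suc (Suc n) * m - 2 * j"
        using that by auto
      with m show ?thesis by metis
    next
      case False
      then have "?D l = 0"
        by (auto simp: ff_eq_0_iff spow_coef_def simp del: mult_Suc)
      then have "1 / (mfact \<alpha> * mfact \<beta> * 2 ^ l) * ?D l = 0" by simp
      with m c show ?thesis by (metis maj_zero_coef order_refl)
    qed
  qed
  have maj: "maj w c (Suc (Suc n) * m - 2 * j)
      (\<Sum>l\<le>j. \<Sum>x\<in>midx l. 1 / (mfact (fst x :: 'd \<Rightarrow> nat) * mfact (snd x :: 'd \<Rightarrow> nat) * 2 ^ l) * ?D l)
      (\<lambda>w. \<Sum>l\<le>j. \<Sum>x\<in>midx l. sharp_term l (fst x) (snd x) (spow a (Suc n) (j - l)) a w)"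
    using * by (intro maj_sum c smooth_sum smooth_sharp_term smooth_spow a) auto
  have "(\<Sum>l\<le>j. \<Sum>x\<in>midx l. 1 / (mfact (fst x :: 'd \<Rightarrow> nat) * mfact (snd x :: 'd \<Rightarrow> nat) * 2 ^ l) * ?D l)
      = (\<Sum>l\<le>j. sharp_weight TYPE('d) l * ?D l)"
    by (simp add: sharp_weight_def case_prod_unfold sum_distrib_right)
  also have "\<dots> = b ^ Suc (Suc n) * (c\<^sup>2) ^ j *
      (\<Sum>l\<le>j. sharp_weight TYPE('d) l * (spow_coef ?N (j - l) * ?t ^ (j - l) * ff (?p l) l * ff m l))"
    unfolding sum_distrib_left
  proof (rule sum.cong)
    fix l assume "l \<in> {..j}"
    then have "(c\<^sup>2) ^ j = (c\<^sup>2) ^ (j - l) * (c ^ l * c ^ l)"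
      by (simp add: power2_eq_square power_mult_distrib flip: power_add)
    then show "sharp_weight TYPE('d) l * ?D l = b ^ Suc (Suc n) * (c\<^sup>2) ^ j *
       (sharp_weight TYPE('d) l * (spow_coef ?N (j - l) * ?t ^ (j - l) * ff (?p l) l * ff m l))"
      by (simp add: power_mult_distrib mult_ac del: mult_Suc)
  qed simp
  also have "\<dots> \<le> b ^ Suc (Suc n) * (c\<^sup>2) ^ j * (?t ^ j * spow_coef (?N + m) j)"
    using b by (intro mult_left_mono spow_coef_Suc) auto
  also have "\<dots> = b ^ Suc (Suc n) * (c\<^sup>2 * ?t) ^ j * spow_coef (Suc (Suc n) * m) j"
    by (simp add: power_mult_distrib add.commute mult_ac)
  finally have "maj w c (Suc (Suc n) * m - 2 * j)
      (b ^ Suc (Suc n) * (c\<^sup>2 * ?t) ^ j * spow_coef (Suc (Suc n) * m) j)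
      (\<lambda>w. \<Sum>l\<le>j. \<Sum>x\<in>midx l. sharp_term l (fst x) (snd x) (spow a (Suc n) (j - l)) a w)"
    by (rule maj_mono[OF maj c order_refl order_refl])
  then show ?case
    by (simp only: spow.simps sharp_single case_prod_unfold)
qed

lemma spow_0: "spow a n 0 = (\<lambda>w. a w ^ n)"
proof (induction a n rule: spow.induct)
  case (3 a n)
  have "dmix (\<lambda>_. 0) (\<lambda>_. 0) f = f" for f :: "'a phase \<Rightarrow> complex"
    by (rule dmix_iter_pd[of "\<lambda>_. 0" "\<lambda>_. 0"]) (simp add: mlen_def)
  then show ?case
    by (simp add: sharp_single 3 midx_0 sharp_term_def mfact_def mlen_def mult.commute)
qed (simp_all add: single_def)

lemma spoly_sum:
  fixes a :: "'d::finite phase \<Rightarrow> complex"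
  assumes "smooth a" "\<And>w. \<exists>c\<ge>0. \<exists>b. maj w c m b a"
  shows "spoly a n = (\<lambda>w. a w ^ n + (\<Sum>j=1..n * m. spow a n j w))"
proof (cases n)
  case 0
  then show ?thesis by (simp add: spoly_def)
next
  case (Suc n')
  have z: "spow a n j w = 0" if j: "j > n * m" for j w
  proof -
    obtain c b where "c \<ge> 0" "maj w c m b a" using assms(2) by blast
    from majD[OF maj_spow[OF assms(1) this(2,1), of n' j], of "[]"] j show ?thesis
      by (simp add: Suc spow_coef_def del: mult_Suc)
  qed
  have "(\<Sum>k. spow a n k w) = (\<Sum>k\<le>n * m. spow a n k w)" for w
    by (rule suminf_finite) (auto simp: z)
  also have "\<dots> w = a w ^ n + (\<Sum>j=1..n * m. spow a n j w)" for w
    by (simp add: sum.atMost_shift spow_0 sum.atLeast1_atMost_eq)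
  finally show ?thesis using Suc by (simp add: spoly_def)
qed

section \<open>Falling factorials against the weight sequence\<close>

lemma fact_mult_power_le: "fact p * real p ^ d \<le> fact (p + d)"
proof (induction d)
  case (Suc d)
  have "fact p * real p ^ Suc d = (fact p * real p ^ d) * real p" by simp
  also have "\<dots> \<le> fact (p + d) * real (p + Suc d)"
    using Suc by (intro mult_mono) auto
  finally show ?case by (simp add: mult.commute)
qed simp

lemma fact_le_mult_power: "fact (p + d) \<le> fact p * real (p + d) ^ d"
proof (induction d)
  case (Suc d)
  have "fact (p + Suc d) = fact (p + d) * real (p + Suc d)" by (simp add: mult.commute)
  also have "\<dots> \<le> (fact p * real (p + d) ^ d) * real (p + Suc d)"
    using Suc by (intro mult_right_mono) auto
  also have "\<dots> \<le> (fact p * real (p + Suc d) ^ d) * real (p + Suc d)"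
    by (intro mult_right_mono mult_left_mono power_mono) auto
  finally show ?case by (simp add: mult_ac)
qed simp

text \<open>For \<open>N > J\<close> this is the product of \<open>i / J\<close> over
  \<open>J < i \<le> N\<close>: the price for using the base \<open>J\<close> in a bound of
  \<open>ff N k\<close>, uniformly in \<open>k\<close>.\<close>

definition fact_ratio :: "nat \<Rightarrow> nat \<Rightarrow> real" where
  "fact_ratio J N = (if N \<le> J then 1 else fact N / (fact J * real J ^ (N - J)))"

lemma fact_ratio_nonneg [simp]: "fact_ratio J N \<ge> 0"
  by (simp add: fact_ratio_def)

text \<open>As a function of \<open>q\<close>, \<open>fact q / J ^ q\<close> is smallest at
  \<open>q = J\<close>. Comparing its values at \<open>N - k\<close> and \<open>J\<close> bounds
  \<open>fact (N - k)\<close> from below, and \<open>ff N k = fact N / fact (N - k)\<close> for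
  \<open>k \<le> N\<close>.\<close>

lemma ff_le_fact_ratio:
  assumes "J \<ge> 1"
  shows "ff N k \<le> real J ^ k * fact_ratio J N"
proof (cases "N \<le> J")
  case True
  then have "ff N k \<le> real J ^ k"
    using ff_le_power[of N k] power_mono[of "real N" "real J" k] by simp
  with True show ?thesis by (simp add: fact_ratio_def)
next
  case False
  show ?thesis
  proof (cases "k \<le> N")
    case k: True
    have "fact J * real J ^ (N - J) \<le> real J ^ k * fact (N - k)"
    proof (cases "J \<le> N - k")
      case True
      have "fact J * real J ^ (N - J) = real J ^ k * (fact J * real J ^ (N - k - J))"
        using True k by (simp flip: power_add)
      also have "\<dots> \<le> real J ^ k * fact (N - k)"
        using fact_mult_power_le[of J "N - k - J"] le_add_diff_inverse[OF True]
        by (intro mult_left_mono) (simp_all del: diff_diff_left)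
      finally show ?thesis .
    next
      case F: False
      have "fact J \<le> fact (N - k) * real J ^ (J - (N - k))"
        using fact_le_mult_power[of "N - k" "J - (N - k)"] F by simp
      then have "fact J * real J ^ (N - J) \<le> fact (N - k) * real J ^ (J - (N - k)) * real J ^ (N - J)"
        by (intro mult_right_mono) auto
      also have "\<dots> = fact (N - k) * real J ^ (J - (N - k) + (N - J))"
        by (simp add: power_add)
      also have "J - (N - k) + (N - J) = k" using F False k by linarith
      finally show ?thesis by (simp add: mult.commute)
    qed
    then have "fact J * real J ^ (N - J) * ff N k \<le> real J ^ k * (fact (N - k) * ff N k)"
      unfolding mult.assoc[of "real J ^ k", symmetric] by (intro mult_right_mono) auto
    also have "fact (N - k) * ff N k = (fact N :: real)"
      using arg_cong[OF binomial_fact_lemma[OF k], of real] by (simp add: ff_binomial mult_ac)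
    finally show ?thesis
      using False assms by (simp add: fact_ratio_def field_simps)
  next
    case False
    then show ?thesis by (simp add: ff_eq_0_iff[THEN iffD2])
  qed
qed

text \<open>The exponential pays for powers of \<open>N / J\<close> and of
  \<open>1 + \<theta>\<close> in the two error estimates below. It is in turn absorbed by the factor
  \<open>exp (2 * m)\<close> in the condition on the cutoff.\<close>

definition tail_weight :: "nat \<Rightarrow> nat \<Rightarrow> real" where
  "tail_weight J N = exp (2 * real (N - J)) * fact_ratio J N"

lemma tail_weight_nonneg [simp]: "tail_weight J N \<ge> 0"
  by (simp add: tail_weight_def)

lemma ff_le_tail_weight:
  assumes "J \<ge> 1"
  shows "ff N k \<le> real J ^ k * tail_weight J N"
proof -
  have "fact_ratio J N \<le> tail_weight J N"
    using mult_right_mono[of 1 "exp (2 * real (N - J))" "fact_ratio J N"] by (simp add: tail_weight_def)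
  then show ?thesis
    using ff_le_fact_ratio[OF assms] by (meson mult_left_mono of_nat_0_le_iff order_trans zero_le_power)
qed

lemma of_nat_le_diff:
  assumes "J \<ge> 1"
  shows "real N \<le> real J * (1 + real (N - J))"
proof -
  have "N \<le> J * (1 + (N - J))"
    using assms mult_le_mono1[of 1 J "N - J"] by (simp add: algebra_simps)
  then show ?thesis by (metis of_nat_1 of_nat_add of_nat_le_iff of_nat_mult)
qed

lemma power_div_fact_le_exp:
  assumes "x \<ge> 0"
  shows "x ^ n / fact n \<le> exp (x :: real)"
proof -
  have "(\<Sum>i\<in>{n}. x ^ i /\<^sub>R fact i) \<le> (\<Sum>i. x ^ i /\<^sub>R fact i)"
    using assms by (intro sum_le_suminf summable_exp_generic) auto
  then show ?thesis by (simp add: exp_def divide_inverse mult.commute)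
qed

lemma spow_coef_le_tail_weight:
  assumes J: "J \<ge> 1"
  shows "spow_coef N i * ff (N - 2 * i) k \<le> exp 1 * real J ^ (2 * i) * real J ^ k * tail_weight J N"
proof -
  let ?D = "real (N - J)"
  have "spow_coef N i \<le> ff N i * (real N ^ i / fact i)"
    by (simp add: spow_coef_def ff_binomial)
  \<comment> \<open>Raising \<open>N - 2 * i\<close> to \<open>N - i\<close> lets the two falling
    factorials join into \<open>ff N (i + k)\<close>, so that \<open>fact_ratio\<close> enters only
    once. The bound \<open>r powr s \<le> r\<close> in \<open>suminf_tail_weight\<close> cancels
    just one such factor.\<close>
  moreover have "ff (N - 2 * i) k \<le> ff (N - i) k"
    by (rule ff_mono) simp
  ultimately have "spow_coef N i * ff (N - 2 * i) k \<le> (ff N i * (real N ^ i / fact i)) * ff (N - i) k"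
    by (intro mult_mono) auto
  also have "\<dots> = ff N (i + k) * (real N ^ i / fact i)"
    by (simp add: ff_add)
  also have "\<dots> \<le> (real J ^ (i + k) * fact_ratio J N) * (real J ^ i * exp (1 + 2 * ?D))"
  proof (intro mult_mono ff_le_fact_ratio J)
    have "real N ^ i / fact i \<le> (real J * (1 + ?D)) ^ i / fact i"
      using of_nat_le_diff[OF J, of N] by (intro divide_right_mono power_mono) auto
    also have "\<dots> = real J ^ i * ((1 + ?D) ^ i / fact i)"
      by (simp add: power_mult_distrib)
    also have "\<dots> \<le> real J ^ i * exp (1 + ?D)"
      by (intro mult_left_mono power_div_fact_le_exp) auto
    also have "\<dots> \<le> real J ^ i * exp (1 + 2 * ?D)"
      by (intro mult_left_mono) auto
    finally show "real N ^ i / fact i \<le> real J ^ i * exp (1 + 2 * ?D)" .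
  qed auto
  also have "\<dots> = exp 1 * real J ^ (2 * i) * real J ^ k * tail_weight J N"
    by (simp add: tail_weight_def exp_add power_add mult_ac power2_eq_square power_mult power_mult_distrib)
  finally show ?thesis .
qed

lemma sum_power_le:
  assumes "0 \<le> x" "x \<le> 1 / 2"
  shows "(\<Sum>i=1..n. x ^ i) \<le> 2 * (x :: real)"
proof -
  have "(\<Sum>i<n. x ^ i) \<le> (\<Sum>i. x ^ i)"
    using assms by (intro sum_le_suminf summable_geometric) auto
  also have "\<dots> = 1 / (1 - x)"
    using assms by (intro suminf_geometric) auto
  also have "\<dots> \<le> 2"
    using assms by (auto simp: field_simps)
  finally have "x * (\<Sum>i<n. x ^ i) \<le> x * 2"
    using assms(1) by (rule mult_left_mono)
  moreover have "(\<Sum>i=1..n. x ^ i) = x * (\<Sum>i<n. x ^ i)"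
    by (simp add: sum_distrib_left sum.atLeast1_atMost_eq)
  ultimately show ?thesis by simp
qed

text \<open>In the application \<open>\<eta>\<close> is \<open>c\<^sup>2\<close> times
  \<open>sharp_const\<close>. The \<open>i\<close>-th correction brings \<open>J ^ (2 * i)\<close>,
  so the sum is geometric and of the order of its first term.\<close>

lemma sum_spow_coef_le:
  assumes J: "J \<ge> 1" and e: "0 \<le> \<eta>" "\<eta> * (real J)\<^sup>2 \<le> 1 / 2"
  shows "(\<Sum>i=1..n. \<eta> ^ i * (spow_coef N i * ff (N - 2 * i) k))
    \<le> 2 * exp 1 * (\<eta> * (real J)\<^sup>2) * real J ^ k * tail_weight J N"
proof -
  have "(\<Sum>i=1..n. \<eta> ^ i * (spow_coef N i * ff (N - 2 * i) k))
      \<le> (\<Sum>i=1..n. \<eta> ^ i * (exp 1 * real J ^ (2 * i) * real J ^ k * tail_weight J N))"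
    by (intro sum_mono mult_left_mono spow_coef_le_tail_weight J) (use e in auto)
  also have "\<dots> = exp 1 * real J ^ k * tail_weight J N * (\<Sum>i=1..n. (\<eta> * (real J)\<^sup>2) ^ i)"
    unfolding sum_distrib_left
    by (intro sum.cong refl) (simp only: power_mult[of _ 2] power_mult_distrib, simp only: mult_ac)
  also have "\<dots> \<le> exp 1 * real J ^ k * tail_weight J N * (2 * (\<eta> * (real J)\<^sup>2))"
    using e by (intro mult_left_mono sum_power_le) auto
  finally show ?thesis by (simp add: mult_ac)
qed

lemma power_one_plus_le:
  assumes "\<theta> \<ge> 0"
  shows "(1 + \<theta>) ^ n - 1 \<le> real n * \<theta> * (1 + \<theta>) ^ n"
proof (induction n)
  case (Suc n)
  have "(1 + \<theta>) ^ Suc n - 1 = (1 + \<theta>) * ((1 + \<theta>) ^ n - 1) + \<theta> * 1"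
    by (simp add: algebra_simps)
  also have "\<dots> \<le> (1 + \<theta>) * (real n * \<theta> * (1 + \<theta>) ^ n) + \<theta> * (1 + \<theta>) ^ Suc n"
    using Suc assms one_le_power[of "1 + \<theta>" "Suc n"] by (intro add_mono mult_left_mono) auto
  also have "\<dots> = real (Suc n) * \<theta> * (1 + \<theta>) ^ Suc n"
    by (simp add: algebra_simps)
  finally show ?case .
qed simp

text \<open>For comparing the powers of two symbols with relative error \<open>\<theta>\<close>:
  \<open>(1 + \<theta>) ^ n - 1\<close> is at most \<open>n * \<theta> * (1 + \<theta>) ^ n\<close>,
  where \<open>n\<close> costs \<open>J\<close> times an exponential in \<open>N - J\<close>. What
  remains is the gain \<open>\<theta> * J\<close>.\<close>

lemma perturb_le_tail_weight:
  assumes J: "J \<ge> 1" and t: "0 \<le> \<theta>" "\<theta> \<le> 1" "\<theta> * real J \<le> 1" and n: "n \<le> N"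
  shows "((1 + \<theta>) ^ n - 1) * ff N k \<le> exp 1 * (\<theta> * real J) * real J ^ k * tail_weight J N"
proof -
  let ?D = "real (N - J)"
  have D: "1 + ?D \<le> exp ?D" by (rule exp_ge_add_one_self)
  have nJ: "real n \<le> real J * (1 + ?D)"
    using of_nat_le_diff[OF J, of N] n by (meson of_nat_mono order_trans)
  have "(1 + \<theta>) ^ n \<le> exp \<theta> ^ n"
    using t by (intro power_mono) auto
  also have "\<dots> = exp (\<theta> * real n)" by (simp add: exp_of_nat_mult[symmetric] mult.commute)
  also have "\<theta> * real n \<le> \<theta> * (real J + ?D)"
    using t n by (intro mult_left_mono) auto
  also have "\<dots> \<le> 1 + ?D"
    using t mult_right_mono[of \<theta> 1 ?D] by (simp add: algebra_simps)
  finally have p: "(1 + \<theta>) ^ n \<le> exp (1 + ?D)" by simp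
  have "(1 + \<theta>) ^ n - 1 \<le> real n * \<theta> * (1 + \<theta>) ^ n"
    using t by (intro power_one_plus_le) auto
  also have "\<dots> \<le> (real J * exp ?D) * \<theta> * exp (1 + ?D)"
  proof (intro mult_mono p)
    show "real n \<le> real J * exp ?D"
      using nJ mult_left_mono[OF D, of "real J"] by simp
  qed (use t in auto)
  also have "\<dots> = exp 1 * (\<theta> * real J) * exp (2 * ?D)"
    by (simp add: exp_add mult_ac flip: exp_double) (simp add: power2_eq_square exp_add[symmetric])
  finally have "(1 + \<theta>) ^ n - 1 \<le> exp 1 * (\<theta> * real J) * exp (2 * ?D)" .
  then have "((1 + \<theta>) ^ n - 1) * ff N k
      \<le> (exp 1 * (\<theta> * real J) * exp (2 * ?D)) * (real J ^ k * fact_ratio J N)"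
    using t one_le_power[of "1 + \<theta>" n] by (intro mult_mono ff_le_fact_ratio J) auto
  then show ?thesis by (simp add: tail_weight_def mult_ac)
qed

text \<open>The growth condition on \<open>Mh\<close> makes the terms beyond \<open>n = j\<close> decay geometrically even
  against \<open>tail_weight\<close>, so that weights of size \<open>Z\<close> up to \<open>n = j\<close> only cost a factor \<open>2 * Z\<close>.\<close>
lemma suminf_tail_weight:
  fixes Mh :: "nat \<Rightarrow> real"
  assumes Mh: "\<And>n. Mh n > 0" "C0 \<ge> 1"
      "\<And>n k. k \<le> n \<Longrightarrow> C0 ^ (n - k) * Mh n / fact (n * m) powr s \<ge> Mh k / fact (k * m) powr s"
    and s: "s \<ge> 1" and j: "j * m \<ge> 1" and x: "x \<ge> 0" "summable (\<lambda>n. x ^ n / Mh n)"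
    and small: "2 * C0 * x * exp (2 * real m) \<le> real (j * m) powr (s * m)"
    and v: "\<And>n. 0 \<le> v n" "\<And>n. v n \<le> Z * tail_weight (j * m) (n * m)"
  shows "summable (\<lambda>n. v n * x ^ n / Mh n) \<and> (\<Sum>n. v n * x ^ n / Mh n) \<le> 2 * Z * (\<Sum>n. x ^ n / Mh n)"
proof -
  let ?J = "j * m"
  let ?y = "real ?J powr (s * m)"
  \<comment> \<open>Below the cutoff the weight is at most \<open>Z\<close>; from \<open>j\<close>
    on, the terms are compared with a geometric sequence of ratio 1/2 that starts at
    \<open>Z * (x ^ j / Mh j)\<close>.\<close>
  let ?u = "\<lambda>n. if n < j then Z * (x ^ n / Mh n) else Z * (x ^ j / Mh j) * (1 / 2) ^ (n - j)"
  have Z: "Z \<ge> 0"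
    using order_trans[OF v(1) v(2), of j] by (simp add: tail_weight_def fact_ratio_def)
  have y: "?y > 0" using j by simp
  have u: "v n * x ^ n / Mh n \<le> ?u n" for n
  proof (cases "n < j")
    case True
    then have "v n \<le> Z"
      using v(2)[of n] by (simp add: tail_weight_def fact_ratio_def)
    then have "v n * (x ^ n / Mh n) \<le> Z * (x ^ n / Mh n)"
      using x Mh(1)[of n] by (intro mult_right_mono) auto
    with True show ?thesis by simp
  next
    case False
    define i where "i = n - j"
    have n: "n = j + i" using False by (simp add: i_def)
    define D where "D = i * m"
    have N: "n * m = ?J + D" by (simp add: n D_def algebra_simps)
    \<comment> \<open>The reciprocal of the \<open>fact_ratio\<close> in \<open>v n\<close>. The
      growth of \<open>Mh\<close> contributes \<open>r powr s \<le> r\<close>, which cancels it, and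
      by \<open>small\<close> what is left is at most \<open>(1 / 2) ^ i\<close>.\<close>
    define r where "r = fact ?J * real ?J ^ D / fact (n * m)"
    have r: "0 < r" "r \<le> 1"
      using j fact_mult_power_le[of ?J D] by (auto simp: r_def N)
    have vn: "v n \<le> Z * exp (2 * D) / r"
    proof -
      have "fact_ratio ?J (n * m) = 1 / r"
        by (auto simp: fact_ratio_def r_def N)
      then show ?thesis using v(2)[of n] by (simp add: tail_weight_def N)
    qed
    have "1 / Mh n \<le> C0 ^ i / Mh j * ((fact ?J / fact (n * m)) powr s)"
      using Mh(3)[of j n] Mh(1)[of j] Mh(1)[of n] False
      by (simp add: powr_divide field_simps i_def)
    also have "(fact ?J / fact (n * m)) powr s = (r / real ?J ^ D) powr s"
      using j by (simp add: r_def)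
    also have "\<dots> = r powr s / (real ?J ^ D) powr s"
      using r by (simp add: powr_divide)
    also have "(real ?J ^ D) powr s = ?y ^ i"
      using j by (simp add: powr_powr D_def powr_realpow[symmetric] powr_power mult_ac)
    also have "r powr s \<le> r"
      using r s powr_mono'[of 1 s r] by simp
    finally have Mn: "1 / Mh n \<le> C0 ^ i / Mh j * (r / ?y ^ i)"
      using Mh(1)[of j] Mh(2) y by (simp add: divide_right_mono mult_left_mono)
    have "v n * x ^ n / Mh n = v n * (x ^ n * (1 / Mh n))" by simp
    also have "\<dots> \<le> (Z * exp (2 * D) / r) * (x ^ n * (C0 ^ i / Mh j * (r / ?y ^ i)))"
      using vn Mn x v(1)[of n] Z r Mh(1)[of n] by (intro mult_mono) auto
    also have "\<dots> = Z * (x ^ j / Mh j) * (C0 * x * exp (2 * real m) / ?y) ^ i"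
      using r by (simp add: n power_add power_mult_distrib power_divide D_def exp_of_nat_mult[symmetric] mult_ac)
    also have "\<dots> \<le> Z * (x ^ j / Mh j) * (1 / 2) ^ i"
      using small y x Mh(1)[of j] Mh(2) Z
      by (intro mult_left_mono power_mono mult_nonneg_nonneg) (auto simp: field_simps)
    finally show ?thesis using False by (simp add: i_def)
  qed
  have "(\<lambda>i. ?u (i + j)) sums (Z * (x ^ j / Mh j) * 2)"
    using sums_mult[OF geometric_sums[of "1 / 2 :: real"], of "Z * (x ^ j / Mh j)"] by simp
  then have su: "?u sums (Z * (x ^ j / Mh j) * 2 + (\<Sum>n<j. ?u n))"
    by (rule sums_iff_shift[of ?u j, THEN iffD1])
  have nonneg: "v n * x ^ n / Mh n \<ge> 0" for n
    using v(1) x Mh(1)[of n] by simp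
  have sm: "summable (\<lambda>n. v n * x ^ n / Mh n)"
    by (rule summable_comparison_test'[OF sums_summable[OF su], of 0]) (simp only: real_norm_def abs_of_nonneg[OF nonneg] u)
  have "(\<Sum>n. v n * x ^ n / Mh n) \<le> (\<Sum>n. ?u n)"
    by (rule suminf_le[OF u sm sums_summable[OF su]])
  also have "\<dots> = Z * (x ^ j / Mh j) * 2 + Z * (\<Sum>n<j. x ^ n / Mh n)"
    using sums_unique[OF su] by (simp add: sum_distrib_left)
  also have "\<dots> \<le> 2 * Z * (\<Sum>n<Suc j. x ^ n / Mh n)"
    using Z x Mh(1) by (auto simp: algebra_simps less_imp_le intro!: mult_nonneg_nonneg sum_nonneg)
  also have "\<dots> \<le> 2 * Z * (\<Sum>n. x ^ n / Mh n)"
    using Z x Mh(1) by (intro mult_left_mono sum_le_suminf) (auto simp: less_imp_le)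
  finally show ?thesis using sm by blast
qed

text \<open>\<open>j * m\<close> is \<open>L * x powr (1 - \<rho>)\<close> rounded up to a multiple
  of \<open>m\<close>. Its power \<open>s * m\<close> dominates \<open>L * x ^ m\<close>, because
  \<open>s * m \<ge> 1\<close> and \<open>(1 - \<rho>) * (s * m) \<ge> m\<close>. Rounding adds at
  most \<open>m\<close>, whence \<open>\<Lambda> = L + m\<close>.\<close>

lemma choose_cutoff:
  fixes C0 K s \<rho> :: real
  assumes m: "m \<ge> 1" and K: "C0 \<ge> 1" "K \<ge> 0" and r: "\<rho> < 1" "s * (1 - \<rho>) \<ge> 1" "s \<ge> 1"
  obtains \<Lambda> where "\<Lambda> \<ge> 1"
    "\<And>x. x \<ge> 1 \<Longrightarrow> \<exists>j. j * m \<ge> 1 \<and> real (j * m) \<le> \<Lambda> * x powr (1 - \<rho>) \<and>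
       2 * C0 * (K * x ^ m) * exp (2 * real m) \<le> real (j * m) powr (s * m)"
proof -
  define L where "L = max 1 (2 * C0 * K * exp (2 * real m))"
  have L: "L \<ge> 1" "2 * C0 * K * exp (2 * real m) \<le> L" by (simp_all add: L_def)
  show thesis
  proof (rule that[of "L + m"])
    show "L + m \<ge> 1" using L by simp
    fix x :: real assume x: "x \<ge> 1"
    define X where "X = x powr (1 - \<rho>)"
    have X: "X \<ge> 1" using x r by (simp add: X_def ge_one_powr_ge_zero)
    define j where "j = nat \<lceil>L * X / m\<rceil>"
    have LX: "L * X \<ge> 1" using L X mult_mono[of 1 L 1 X] by simp
    have j1: "L * X / m \<le> real j" "real j \<le> L * X / m + 1"
      using LX m by (auto simp: j_def intro: real_nat_ceiling_ge)
    have J1: "L * X \<le> real (j * m)"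
      using j1(1) m by (simp add: field_simps)
    have "real (j * m) \<le> L * X + m"
      using mult_right_mono[OF j1(2), of "real m"] m by (simp add: distrib_right)
    also have "\<dots> \<le> (L + m) * X"
      using X mult_left_mono[of 1 X "real m"] by (simp add: algebra_simps)
    finally have J2: "real (j * m) \<le> (L + m) * X" .
    have "2 * C0 * (K * x ^ m) * exp (2 * real m) = (2 * C0 * K * exp (2 * real m)) * x powr m"
      using x by (simp add: powr_realpow mult_ac)
    also have "\<dots> \<le> L powr (s * m) * x powr ((1 - \<rho>) * (s * m))"
    proof (intro mult_mono powr_mono)
      have "real 1 * 1 \<le> s * m" using m r by (intro mult_mono) auto
      then have "L powr 1 \<le> L powr (s * m)" using L by (intro powr_mono) auto
      then show "2 * C0 * K * exp (2 * real m) \<le> L powr (s * m)" using L by simp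
      show "real m \<le> (1 - \<rho>) * (s * m)"
        using mult_right_mono[OF r(2), of "real m"] by (simp add: mult_ac)
    qed (use x K in auto)
    also have "\<dots> = (L * X) powr (s * m)"
      using L X x by (simp add: powr_mult X_def powr_powr)
    also have "\<dots> \<le> real (j * m) powr (s * m)"
      using J1 LX r by (intro powr_mono2) auto
    finally have "2 * C0 * (K * x ^ m) * exp (2 * real m) \<le> real (j * m) powr (s * m)" .
    moreover have "real 1 \<le> real (j * m)"
      using J1 LX by linarith
    then have "j * m \<ge> 1" by (simp only: of_nat_le_iff)
    ultimately show "\<exists>j. j * m \<ge> 1 \<and> real (j * m) \<le> (L + m) * x powr (1 - \<rho>) \<and>
       2 * C0 * (K * x ^ m) * exp (2 * real m) \<le> real (j * m) powr (s * m)"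
      using J2 unfolding X_def by blast
  qed
qed

section \<open>Associated functions and termwise differentiation\<close>

text \<open>By (M.4) the quotients of consecutive \<open>A p / fact p\<close> do not decrease. If
  they never exceeded \<open>L\<close>, then \<open>A p / A (p + 1)\<close> would be at least
  \<open>1 / (L * (p + 1))\<close>, and (M.3)' would make the harmonic series converge. So from some
  \<open>p0\<close> on each step gains a factor \<open>L\<close>.\<close>

lemma fact_le_weight:
  assumes A: "weight_seq A" "M3' A" "M4 A" and L: "L > 0"
  obtains C where "C > 0" "\<And>p. fact p * L ^ p \<le> C * A p"
proof -
  define b where "b p = A p / fact p" for p
  have b: "b p > 0" for p using A(1) by (simp add: b_def weight_seq_def)
  have mono: "b (Suc p) / b p \<le> b (Suc (Suc p)) / b (Suc p)" for p
  proof -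
    have "(b (Suc p))\<^sup>2 \<le> b p * b (Suc (Suc p))"
      using A(3)[unfolded M4_def, rule_format, of "Suc p"] by (simp add: b_def)
    then show ?thesis using b[of p] b[of "Suc p"]
      by (simp add: divide_le_eq pos_le_divide_eq power2_eq_square mult.commute)
  qed
  have "\<exists>p0. b (Suc p0) / b p0 > L"
  proof (rule ccontr)
    assume "\<not> ?thesis"
    then have le: "b (Suc p) \<le> L * b p" for p
      using b[of p] by (simp add: not_less divide_le_eq)
    have "1 / L * inverse (real (Suc p)) \<le> A p / A (p + 1)" for p
    proof -
      have e: "A p = b p * fact p" for p by (simp add: b_def)
      have "1 / L \<le> b p / b (Suc p)"
        using le[of p] b[of p] b[of "Suc p"] L by (simp add: field_simps)
      then have "1 / L * inverse (real (Suc p)) \<le> b p / b (Suc p) * inverse (real (Suc p))"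
        by (rule mult_right_mono) simp
      also have "\<dots> = A p / A (p + 1)"
        unfolding e by (simp del: of_nat_Suc add: divide_inverse inverse_mult_distrib)
      finally show ?thesis .
    qed
    moreover have "0 \<le> 1 / L * inverse (real (Suc p))" for p using L by simp
    ultimately have "summable (\<lambda>p. 1 / L * inverse (real (Suc p)))"
      by (intro summable_comparison_test'[OF A(2)[unfolded M3'_def], of 0])
        (simp only: real_norm_def abs_of_nonneg)
    then have "summable (\<lambda>p. inverse (real (Suc p)))"
      using L by (subst (asm) summable_cmult_iff) auto
    then show False
      using not_summable_harmonic[where 'a = real] by (subst (asm) summable_Suc_iff) simp
  qed
  then obtain p0 where p0: "b (Suc p0) / b p0 > L" by blast
  have ge: "b (Suc p) / b p \<ge> L" if "p \<ge> p0" for p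
    using that
  proof (induction p rule: dec_induct)
    case base then show ?case using p0 by simp
  next
    case (step n) then show ?case using mono[of n] by linarith
  qed
  have tail: "L ^ d * b p0 \<le> b (p0 + d)" for d
  proof (induction d)
    case (Suc d)
    have "L ^ Suc d * b p0 = L * (L ^ d * b p0)" by simp
    also have "\<dots> \<le> L * b (p0 + d)" using Suc L by simp
    also have "\<dots> \<le> b (p0 + Suc d)"
      using ge[of "p0 + d"] b[of "p0 + d"] by (simp add: pos_le_divide_eq)
    finally show ?case .
  qed simp
  define C where "C = (\<Sum>p\<le>p0. L ^ p / b p)"
  have initial: "L ^ p / b p \<le> C" if "p \<le> p0" for p
    unfolding C_def using that L b by (intro member_le_sum) (auto simp: less_imp_le)
  have C: "C > 0"
    using less_le_trans[OF divide_pos_pos[OF zero_less_one b[of 0]], of C] initial[of 0] by simp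
  have "L ^ p \<le> C * b p" for p
  proof (cases "p \<le> p0")
    case True
    then show ?thesis using initial[OF True] b[of p] by (simp add: divide_le_eq)
  next
    case False
    define d where "d = p - p0"
    have p: "p = p0 + d" using False by (simp add: d_def)
    have "L ^ p = L ^ p0 / b p0 * (L ^ d * b p0)"
      using b[of p0] by (simp add: p power_add)
    also have "\<dots> \<le> C * b p"
      unfolding p using initial[of p0] tail[of d] C L b by (intro mult_mono) (auto simp: less_imp_le)
    finally show ?thesis .
  qed
  then have "fact p * L ^ p \<le> C * A p" for p
    using mult_left_mono[of "L ^ p" "C * b p" "fact p"] by (simp add: b_def)
  with C show thesis by (rule that)
qed

lemma fact_add_le: "fact (p + q) \<le> 2 ^ (p + q) * (fact p * fact q :: real)"
proof -
  have "fact p * fact q * ((p + q) choose p) = fact (p + q)"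
    using binomial_fact_lemma[of p "p + q"] by simp
  moreover have "real ((p + q) choose p) \<le> 2 ^ (p + q)"
    using binomial_le_pow2[of "p + q" p] by (metis of_nat_le_iff of_nat_numeral of_nat_power)
  ultimately show ?thesis
    by (metis (no_types) fact_ge_zero mult.commute mult_left_mono mult_nonneg_nonneg of_nat_fact of_nat_mult)
qed

lemma fact_le_weights:
  assumes A: "weight_seq A" "M3' A" "M4 A" and h: "h > 0"
  obtains C where "C > 0" "\<And>p q. fact (p + q) \<le> C * h ^ (p + q) * A p * A q"
proof -
  \<comment> \<open>The 2 offsets the \<open>2 ^ (p + q)\<close> that splitting
    \<open>fact (p + q)\<close> costs.\<close>
  obtain C where C: "C > 0" "\<And>p. fact p * (2 / h) ^ p \<le> C * A p"
    by (rule fact_le_weight[OF A, of "2 / h"]) (use h in auto)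
  have "fact (p + q) \<le> C * C * h ^ (p + q) * A p * A q" for p q
  proof -
    have "fact (p + q) \<le> 2 ^ (p + q) * (fact p * fact q :: real)" by (rule fact_add_le)
    also have "\<dots> = h ^ (p + q) * ((fact p * (2 / h) ^ p) * (fact q * (2 / h) ^ q))"
      using h by (simp add: power_add power_divide)
    also have "\<dots> \<le> h ^ (p + q) * ((C * A p) * (C * A q))"
    proof (rule mult_left_mono)
      have "0 \<le> fact p * (2 / h) ^ p" for p using h by simp
      then show "(fact p * (2 / h) ^ p) * (fact q * (2 / h) ^ q) \<le> (C * A p) * (C * A q)"
        by (intro mult_mono C(2)) (auto intro: order_trans[OF _ C(2)])
    qed (use h in simp)
    finally show ?thesis by (simp add: mult_ac)
  qed
  with C(1) show thesis by (intro that[of "C * C"]) auto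
qed

text \<open>\<open>assocf\<close> is a supremum of reals and is meaningful only for a bounded set.
  That \<open>M\<close> dominates \<open>fact\<close> gives the bound, through the exponential
  series.\<close>

lemma power_le_assocf:
  assumes M: "weight_seq M" and f: "\<And>p. fact p \<le> C * L ^ p * M p" and t: "t \<ge> 0"
  shows "t ^ p / M p \<le> exp (assocf M t)"
    and "0 \<le> assocf M t"
proof -
  have Mp: "M p > 0" for p using M by (simp add: weight_seq_def)
  have "0 < C" using f[of 0] Mp[of 0] M by (simp add: weight_seq_def)
  have "max 0 (ln (t ^ p / M p)) \<le> max 0 (ln (C * exp (\<bar>L\<bar> * t)))" for p
  proof (cases "t ^ p = 0")
    case False
    then have tp: "t ^ p > 0" using zero_le_power[OF t, of p] by linarith
    have "1 / M p \<le> C * L ^ p / fact p"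
      using f[of p] Mp[of p] by (simp add: pos_divide_le_eq pos_le_divide_eq)
    then have "t ^ p / M p \<le> C * (L ^ p * t ^ p / fact p)"
      using mult_left_mono[of "1 / M p" "C * L ^ p / fact p" "t ^ p"] tp by (simp add: mult_ac)
    also have "L ^ p * t ^ p \<le> (\<bar>L\<bar> * t) ^ p"
      unfolding power_mult_distrib using tp by (intro mult_right_mono) (simp_all flip: power_abs)
    then have "C * (L ^ p * t ^ p / fact p) \<le> C * ((\<bar>L\<bar> * t) ^ p / fact p)"
      using \<open>0 < C\<close> by (intro mult_left_mono divide_right_mono) auto
    also have "\<dots> \<le> C * exp (\<bar>L\<bar> * t)"
      using \<open>0 < C\<close> t by (intro mult_left_mono power_div_fact_le_exp) auto
    finally have "ln (t ^ p / M p) \<le> ln (C * exp (\<bar>L\<bar> * t))"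
      using tp Mp[of p] by (intro ln_mono) auto
    then show ?thesis by linarith
  next
    case True
    \<comment> \<open>By convention \<open>ln 0 = 0\<close>, so this entry of the supremum is
      0.\<close>
    then have "t ^ p / M p = 0" by (simp only: div_0)
    then show ?thesis by (metis ln_0 max.cobounded1 max.idem)
  qed
  then have bdd: "bdd_above (range (\<lambda>p. max 0 (ln (t ^ p / M p))))"
    by (meson bdd_aboveI2)
  have le: "max 0 (ln (t ^ p / M p)) \<le> assocf M t" for p
    unfolding assocf_def by (rule cSUP_upper[OF _ bdd]) simp
  from le[of p] show "0 \<le> assocf M t" by simp
  show "t ^ p / M p \<le> exp (assocf M t)"
  proof (cases "t ^ p / M p > 0")
    case True
    then have "t ^ p / M p = exp (ln (t ^ p / M p))" by simp
    also have "\<dots> \<le> exp (assocf M t)" using le[of p] by simp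
    finally show ?thesis .
  qed (smt (verit) exp_gt_zero)
qed

lemma div_fact_powr_le:
  assumes "(y :: real) \<ge> 0" "s \<ge> 1"
  shows "y / fact N powr s \<le> y / fact N"
proof -
  have "(fact N :: real) powr 1 \<le> fact N powr s"
    using assms by (intro powr_mono) auto
  then show ?thesis using assms by (intro divide_left_mono) auto
qed

text \<open>The two quantifier patterns over the scale \<open>\<mu>\<close> of \<open>M(\<mu> t)\<close> in the Beurling and the
  Roumieu case.\<close>
definition scale_quant :: "bool \<Rightarrow> (real \<Rightarrow> bool) \<Rightarrow> bool" where
  "scale_quant beur Q \<longleftrightarrow> (if beur then \<exists>\<mu>>0. Q \<mu> else \<forall>\<mu>>0. Q \<mu>)"

lemma scale_quant_mono: "scale_quant beur Q \<Longrightarrow> (\<And>\<mu>. \<mu> > 0 \<Longrightarrow> Q \<mu> \<Longrightarrow> Q' \<mu>) \<Longrightarrow> scale_quant beur Q'"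
  by (auto simp: scale_quant_def split: if_splits)

text \<open>The constant \<open>L0\<close> in the comparison of \<open>M\<close> with
  \<open>fact p powr s\<close> becomes the scale \<open>\<mu> = 2 * R * L0\<close>, the 2 coming
  from \<open>1 + t \<le> 2 * t\<close> for \<open>t \<ge> 1\<close>; smaller \<open>t\<close> give
  bounded values. In the Roumieu case \<open>L0 = \<mu> / (2 * R)\<close> reaches every
  \<open>\<mu>\<close>.\<close>

lemma growth_le_assocf:
  assumes M: "weight_seq M" and f: "\<And>p. fact p \<le> C * L ^ p * M p"
    and Ms: "if beur then wsubset M (\<lambda>p. fact p powr s) else wprec M (\<lambda>p. fact p powr s)"
    and s: "s \<ge> 1" and R: "R > 0"
  shows "scale_quant beur (\<lambda>\<mu>. \<exists>D\<ge>0. \<forall>t\<ge>0. \<forall>N.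
    (R * (1 + t)) ^ N / fact N powr s \<le> D * exp (assocf M (\<mu> * t)))"
proof -
  have Mp: "M p > 0" for p using M by (simp add: weight_seq_def)
  have *: "\<exists>D\<ge>0. \<forall>t\<ge>0. \<forall>N. (R * (1 + t)) ^ N / fact N powr s \<le> D * exp (assocf M (\<mu> * t))"
    if E: "E > 0" "L0 > 0" "\<And>p. M p \<le> E * L0 ^ p * fact p powr s" and mu: "\<mu> = 2 * R * L0" for E L0 \<mu>
  proof (intro exI conjI allI impI)
    show "E + exp (2 * R) \<ge> 0" using E by (simp add: add_nonneg_nonneg)
    fix t :: real and N assume t: "t \<ge> 0"
    have mt: "\<mu> * t \<ge> 0" using t E R mu by simp
    have "(R * (1 + t)) ^ N / fact N powr s \<le> E * exp (assocf M (\<mu> * t)) \<or>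
      (R * (1 + t)) ^ N / fact N powr s \<le> exp (2 * R)"
    proof (cases "t \<ge> 1")
      case True
      have "(R * (1 + t)) ^ N / fact N powr s \<le> (2 * R * t) ^ N / fact N powr s"
        using True R by (intro divide_right_mono power_mono) (auto simp: algebra_simps)
      also have "\<dots> \<le> (2 * R * t) ^ N * (E * L0 ^ N / M N)"
      proof -
        have "1 / fact N powr s \<le> E * L0 ^ N / M N"
          using E(3)[of N] Mp[of N] by (simp add: field_simps)
        from mult_left_mono[OF this, of "(2 * R * t) ^ N"] t R show ?thesis by simp
      qed
      also have "\<dots> = E * ((\<mu> * t) ^ N / M N)"
        by (simp add: mu power_mult_distrib mult_ac)
      also have "\<dots> \<le> E * exp (assocf M (\<mu> * t))"
        using E by (intro mult_left_mono power_le_assocf[OF M f mt]) auto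
      finally show ?thesis by blast
    next
      case False
      have "(R * (1 + t)) ^ N / fact N powr s \<le> (2 * R) ^ N / fact N powr s"
        using False R t by (intro divide_right_mono power_mono) auto
      also have "\<dots> \<le> (2 * R) ^ N / fact N"
        using R s by (intro div_fact_powr_le) auto
      also have "\<dots> \<le> exp (2 * R)"
        using R by (intro power_div_fact_le_exp) auto
      finally show ?thesis by blast
    qed
    moreover have "exp (2 * R) * 1 \<le> exp (2 * R) * exp (assocf M (\<mu> * t))"
      using power_le_assocf(2)[OF M f mt] by (intro mult_left_mono) auto
    moreover have "0 \<le> E * exp (assocf M (\<mu> * t))" using E(1) by simp
    moreover have "0 < exp (2 * R)" by simp
    ultimately show "(R * (1 + t)) ^ N / fact N powr s \<le> (E + exp (2 * R)) * exp (assocf M (\<mu> * t))"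
      unfolding distrib_right by (elim disjE) linarith+
  qed
  show ?thesis
  proof (cases beur)
    case True
    then obtain E L0 where E: "E > 0" "L0 > 0" "\<And>p. M p \<le> E * L0 ^ p * fact p powr s"
      using Ms by (auto simp: wsubset_def)
    then have "2 * R * L0 > 0" using R by simp
    with *[OF E refl] show ?thesis
      unfolding scale_quant_def if_P[OF True] by (rule_tac x = "2 * R * L0" in exI) (rule conjI)
  next
    case False
    show ?thesis
      unfolding scale_quant_def using False
    proof (clarsimp)
      fix \<mu> :: real assume mu: "\<mu> > 0"
      define L0 where "L0 = \<mu> / (2 * R)"
      have "L0 > 0" using mu R by (simp add: L0_def)
      then obtain E where "E > 0" "\<And>p. M p \<le> E * L0 ^ p * fact p powr s"
        using Ms False by (auto simp: wprec_def)
      from *[OF this(1) \<open>L0 > 0\<close> this(2), of \<mu>] R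
      show "\<exists>D\<ge>0. \<forall>t\<ge>0. \<forall>N. (R * (1 + t)) ^ N / fact N powr s \<le> D * exp (assocf M (\<mu> * t))"
        by (simp add: L0_def)
    qed
  qed
qed

text \<open>An attained infimum lies in the set and is positive; otherwise \<open>\<rho>\<close>
  exceeds a nonnegative one. The exponent 1 shows the set nonempty, so that \<open>Inf\<close> has
  its usual meaning.\<close>

lemma rho_pos: "rho_admissible A M \<rho> \<Longrightarrow> wsubset A M \<Longrightarrow> (\<And>p. M p > 0) \<Longrightarrow> \<rho> > 0"
proof -
  assume r: "rho_admissible A M \<rho>" and AM: "wsubset A M" and M: "\<And>p. M p > 0"
  let ?S = "{r. r > 0 \<and> wsubset A (\<lambda>p. M p powr r)}"
  have eq: "(\<lambda>p. M p powr 1) = M" using M by (simp add: fun_eq_iff abs_of_pos)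
  have "1 \<in> ?S" by (simp only: mem_Collect_eq eq AM zero_less_one simp_thms)
  then have "?S \<noteq> {}" by blast
  then have "rho0 A M \<ge> 0"
    unfolding rho0_def by (rule cInf_greatest) simp
  with r show ?thesis
    by (auto simp: rho_admissible_def split: if_splits)
qed

section \<open>Termwise differentiation of series\<close>

lemma phase_expansion: "(\<Sum>i\<in>UNIV. coord h i *\<^sub>R cvec i) = (h :: 'd::finite phase)"
proof -
  have v: "(\<Sum>j\<in>UNIV. (x $ j) *\<^sub>R axis j 1) = x" for x :: "real^'d"
    by (simp add: vec_eq_iff axis_def if_distrib cong: if_cong)
  have "(\<Sum>i\<in>UNIV. coord h i *\<^sub>R cvec i) = (\<Sum>i\<in>UNIV <+> UNIV. coord h i *\<^sub>R cvec i)" by simp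
  also have "\<dots> = (\<Sum>j\<in>UNIV. (fst h $ j) *\<^sub>R (axis j 1, 0)) + (\<Sum>j\<in>UNIV. (snd h $ j) *\<^sub>R (0, axis j 1))"
    by (subst sum.Plus) (simp_all add: coord_def cvec_def)
  also have "\<dots> = h"
    by (rule prod_eqI) (simp_all add: fst_sum snd_sum v)
  finally show ?thesis .
qed

lemma smooth_has_derivative_pd:
  fixes f :: "'d::finite phase \<Rightarrow> complex"
  assumes "smooth f"
  shows "(f has_derivative (\<lambda>h. \<Sum>i\<in>UNIV. coord h i *\<^sub>R pd i f w)) (at w)"
proof -
  have d: "(f has_derivative frechet_derivative f (at w)) (at w)"
    by (rule smooth_has_derivative) fact
  then have lin: "linear (frechet_derivative f (at w))" by (rule has_derivative_linear)
  have "frechet_derivative f (at w) h = (\<Sum>i\<in>UNIV. coord h i *\<^sub>R pd i f w)" for h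
  proof -
    have "frechet_derivative f (at w) h = frechet_derivative f (at w) (\<Sum>i\<in>UNIV. coord h i *\<^sub>R cvec i)"
      by (simp add: phase_expansion)
    also have "\<dots> = (\<Sum>i\<in>UNIV. coord h i *\<^sub>R pd i f w)"
      by (simp add: linear_sum[OF lin] linear_scale[OF lin] pd_eq[OF d])
    finally show ?thesis .
  qed
  with d show ?thesis by (metis (no_types, lifting) ext)
qed

lemma geometric_bound_suminf:
  fixes f :: "nat \<Rightarrow> 'a::banach"
  assumes "\<And>n. norm (f n) \<le> B * (1 / 2) ^ n"
  shows "summable f" "norm (\<Sum>n. f n) \<le> 2 * B" "norm ((\<Sum>n<k. f n) - (\<Sum>n. f n)) \<le> 2 * B * (1 / 2) ^ k"
proof -
  have g: "(\<lambda>n. B * (1 / 2 :: real) ^ n) sums (2 * B)" for B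
    using sums_mult[OF geometric_sums[of "1 / 2 :: real"], of B] by (simp add: mult.commute)
  have sn: "summable (\<lambda>n. norm (f n))" if "\<And>n. norm (f n) \<le> B * (1 / 2) ^ n" for B and f :: "nat \<Rightarrow> 'a"
    by (rule summable_comparison_test'[OF sums_summable[OF g], of 0]) (use that in simp)
  have nb: "norm (\<Sum>n. f n) \<le> 2 * B" if "\<And>n. norm (f n) \<le> B * (1 / 2) ^ n" for B and f :: "nat \<Rightarrow> 'a"
  proof -
    have "norm (\<Sum>n. f n) \<le> (\<Sum>n. norm (f n))" by (rule summable_norm[OF sn[OF that]])
    also have "\<dots> \<le> (\<Sum>n. B * (1 / 2) ^ n)"
      by (rule suminf_le[OF that sn[OF that] sums_summable[OF g]])
    also have "\<dots> = 2 * B" using sums_unique[OF g] by simp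
    finally show ?thesis .
  qed
  show s: "summable f" by (rule summable_norm_cancel[OF sn[OF assms]])
  show "norm (\<Sum>n. f n) \<le> 2 * B" by (rule nb[OF assms])
  have "norm (f (n + k)) \<le> (B * (1 / 2) ^ k) * (1 / 2) ^ n" for n
    using assms[of "n + k"] by (simp add: power_add mult_ac)
  from nb[of "\<lambda>n. f (n + k)", OF this] suminf_minus_initial_segment[OF s, of k]
  show "norm ((\<Sum>n<k. f n) - (\<Sum>n. f n)) \<le> 2 * B * (1 / 2) ^ k"
    by (simp add: norm_minus_commute)
qed

text \<open>The bounds are uniform on balls and separate for each derivative, which makes the class
  closed under \<open>pd\<close>: a single termwise differentiation then yields those of all
  orders.\<close>

definition geom_bounded :: "(nat \<Rightarrow> 'd::finite phase \<Rightarrow> complex) \<Rightarrow> bool" where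
  "geom_bounded F \<longleftrightarrow> (\<forall>n. smooth (F n)) \<and>
    (\<forall>is r. \<exists>B. \<forall>n w. norm w \<le> r \<longrightarrow> cmod (iter_pd is (F n) w) \<le> B * (1 / 2) ^ n)"

lemma geom_bounded_smooth: "geom_bounded F \<Longrightarrow> smooth (F n)"
  by (simp add: geom_bounded_def)

lemma geom_bounded_pd:
  assumes "geom_bounded F"
  shows "geom_bounded (\<lambda>n. pd i (F n))"
  unfolding geom_bounded_def
proof (intro conjI allI)
  show "smooth (pd i (F n))" for n using assms by (simp add: geom_bounded_smooth smooth_pd)
  show "\<exists>B. \<forall>n w. norm w \<le> r \<longrightarrow> cmod (iter_pd is (pd i (F n)) w) \<le> B * (1 / 2) ^ n" for "is" r
    using assms[unfolded geom_bounded_def, THEN conjunct2, rule_format, of r "is @ [i]"] by simp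
qed

lemma geom_bounded_summable:
  assumes "geom_bounded F"
  shows "summable (\<lambda>n. iter_pd is (F n) w)"
proof -
  obtain B where "\<And>n w'. norm w' \<le> norm w \<Longrightarrow> cmod (iter_pd is (F n) w') \<le> B * (1 / 2) ^ n"
    using assms unfolding geom_bounded_def by meson
  from this[OF order_refl] show ?thesis by (rule geometric_bound_suminf(1))
qed

lemma geom_bounded_has_derivative:
  fixes F :: "nat \<Rightarrow> 'd::finite phase \<Rightarrow> complex"
  assumes F: "geom_bounded F"
  shows "((\<lambda>w. \<Sum>n. F n w) has_derivative (\<lambda>h. \<Sum>i\<in>UNIV. coord h i *\<^sub>R (\<Sum>n. pd i (F n) w))) (at w)"
proof -
  \<comment> \<open>An open set containing \<open>w\<close>, so that a derivative within it is a
    derivative at \<open>w\<close>.\<close>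
  let ?S = "ball (0 :: 'd phase) (norm w + 1)"
  have "\<forall>i. \<exists>B. \<forall>n x. norm x \<le> norm w + 1 \<longrightarrow> cmod (iter_pd [i] (F n) x) \<le> B * (1 / 2) ^ n"
    using F unfolding geom_bounded_def by blast
  then obtain b where b: "\<And>i n x. norm x \<le> norm w + 1 \<Longrightarrow> cmod (pd i (F n) x) \<le> b i * (1 / 2) ^ n"
    by (metis iter_pd_simps(1,2))
  have b0: "b i \<ge> 0" for i
    using order_trans[OF norm_ge_zero b[of 0 i 0]] by simp
  define B where "B = (\<Sum>i\<in>UNIV. 2 * b i)"
  have B: "B \<ge> 0" unfolding B_def using b0 by (intro sum_nonneg) auto
  have tail: "norm ((\<Sum>k<n. \<Sum>i\<in>UNIV. coord h i *\<^sub>R pd i (F k) x) - (\<Sum>i\<in>UNIV. coord h i *\<^sub>R (\<Sum>k. pd i (F k) x)))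
      \<le> B * (1 / 2) ^ n * norm h" if x: "x \<in> ?S" for n x h
  proof -
    have "(\<Sum>k<n. \<Sum>i\<in>UNIV. coord h i *\<^sub>R pd i (F k) x) - (\<Sum>i\<in>UNIV. coord h i *\<^sub>R (\<Sum>k. pd i (F k) x))
        = (\<Sum>i\<in>UNIV. coord h i *\<^sub>R ((\<Sum>k<n. pd i (F k) x) - (\<Sum>k. pd i (F k) x)))"
      by (subst sum.swap) (simp add: scaleR_diff_right scaleR_sum_right sum_subtractf)
    also have "norm \<dots> \<le> (\<Sum>i\<in>UNIV. norm h * (2 * b i * (1 / 2) ^ n))"
    proof (rule sum_norm_le)
      fix i
      have "norm ((\<Sum>k<n. pd i (F k) x) - (\<Sum>k. pd i (F k) x)) \<le> 2 * b i * (1 / 2) ^ n"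
        using x by (intro geometric_bound_suminf(3) b) simp
      then show "norm (coord h i *\<^sub>R ((\<Sum>k<n. pd i (F k) x) - (\<Sum>k. pd i (F k) x))) \<le> norm h * (2 * b i * (1 / 2) ^ n)"
        unfolding norm_scaleR using abs_coord_le[of h i] by (intro mult_mono) auto
    qed
    also have "\<dots> = B * (1 / 2) ^ n * norm h"
      by (simp add: B_def sum_distrib_left sum_distrib_right mult_ac)
    finally show ?thesis .
  qed
  have "\<exists>g. \<forall>x\<in>?S. (\<lambda>n. F n x) sums g x \<and>
      (g has_derivative (\<lambda>h. \<Sum>i\<in>UNIV. coord h i *\<^sub>R (\<Sum>n. pd i (F n) x))) (at x within ?S)"
  proof (rule has_derivative_series[where f' = "\<lambda>n x h. \<Sum>i\<in>UNIV. coord h i *\<^sub>R pd i (F n) x"])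
    show "convex ?S" by (rule convex_ball)
    show "(F n has_derivative (\<lambda>h. \<Sum>i\<in>UNIV. coord h i *\<^sub>R pd i (F n) x)) (at x within ?S)" for n x
      by (rule has_derivative_at_withinI[OF smooth_has_derivative_pd[OF geom_bounded_smooth[OF F]]])
    show "w \<in> ?S" by simp
    show "(\<lambda>n. F n w) sums (\<Sum>n. F n w)"
      using geom_bounded_summable[OF F, of "[]"] by (simp add: summable_sums)
    show "\<forall>\<^sub>F n in sequentially. \<forall>x\<in>?S. \<forall>h. norm ((\<Sum>k<n. \<Sum>i\<in>UNIV. coord h i *\<^sub>R pd i (F k) x)
        - (\<Sum>i\<in>UNIV. coord h i *\<^sub>R (\<Sum>k. pd i (F k) x))) \<le> e * norm h" if "e > 0" for e
    proof -
      have "(\<lambda>n. B * (1 / 2 :: real) ^ n) \<longlonglongrightarrow> B * 0"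
        by (intro tendsto_intros LIMSEQ_power_zero) simp
      then have "\<forall>\<^sub>F n in sequentially. B * (1 / 2) ^ n < e"
        using \<open>e > 0\<close> by (simp add: order_tendsto_iff)
      then show ?thesis
      proof (rule eventually_mono, intro ballI allI)
        fix n x and h :: "'d phase"
        assume n: "B * (1 / 2) ^ n < e" and x: "x \<in> ?S"
        show "norm ((\<Sum>k<n. \<Sum>i\<in>UNIV. coord h i *\<^sub>R pd i (F k) x)
          - (\<Sum>i\<in>UNIV. coord h i *\<^sub>R (\<Sum>k. pd i (F k) x))) \<le> e * norm h"
          by (rule order_trans[OF tail[OF x] mult_right_mono[OF less_imp_le[OF n] norm_ge_zero]])
      qed
    qed
  qed
  then obtain g where g: "\<And>x. x \<in> ?S \<Longrightarrow> (\<lambda>n. F n x) sums g x"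
    "\<And>x. x \<in> ?S \<Longrightarrow> (g has_derivative (\<lambda>h. \<Sum>i\<in>UNIV. coord h i *\<^sub>R (\<Sum>n. pd i (F n) x))) (at x within ?S)"
    by blast
  have w: "w \<in> ?S" by simp
  have "(g has_derivative (\<lambda>h. \<Sum>i\<in>UNIV. coord h i *\<^sub>R (\<Sum>n. pd i (F n) w))) (at w)"
    using g(2)[OF w] at_within_open[OF w open_ball] by simp
  then show ?thesis
    by (rule has_derivative_transform_within_open[OF _ open_ball w]) (metis g(1) sums_unique)
qed

lemma cvec_coord: "coord (cvec j) i = (if i = j then 1 else 0)"
  by (auto simp: coord_def cvec_def axis_def split: sum.split)

lemma geom_bounded_pd_suminf:
  assumes "geom_bounded F"
  shows "pd i (\<lambda>w. \<Sum>n. F n w) = (\<lambda>w. \<Sum>n. pd i (F n) w)"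
proof
  fix w
  have "pd i (\<lambda>w. \<Sum>n. F n w) w = (\<Sum>j\<in>UNIV. coord (cvec i) j *\<^sub>R (\<Sum>n. pd j (F n) w))"
    by (rule pd_eq[OF geom_bounded_has_derivative[OF assms]])
  also have "\<dots> = (\<Sum>j\<in>UNIV. if j = i then (\<Sum>n. pd j (F n) w) else 0)"
    by (intro sum.cong) (auto simp: cvec_coord)
  finally show "pd i (\<lambda>w. \<Sum>n. F n w) w = (\<Sum>n. pd i (F n) w)" by simp
qed

lemma geom_bounded_iter_pd:
  "geom_bounded F \<Longrightarrow> geom_bounded (\<lambda>n. iter_pd is (F n))"
  by (induction "is") (auto intro: geom_bounded_pd)

lemma geom_bounded_iter_pd_suminf:
  "geom_bounded F \<Longrightarrow> iter_pd is (\<lambda>w. \<Sum>n. F n w) = (\<lambda>w. \<Sum>n. iter_pd is (F n) w)"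
proof (induction "is")
  case (Cons i "is")
  then show ?case
    using geom_bounded_pd_suminf[OF geom_bounded_iter_pd, of F i "is"] by simp
qed simp

lemma geom_bounded_smooth_suminf:
  assumes "geom_bounded F"
  shows "smooth (\<lambda>w. \<Sum>n. F n w)"
  unfolding smooth_def geom_bounded_iter_pd_suminf[OF assms]
  using geom_bounded_has_derivative[OF geom_bounded_iter_pd[OF assms]]
  by (blast intro: differentiableI)

section \<open>Membership in the symbol classes\<close>

text \<open>Bounds of analytic type, with a factorial in place of \<open>h\<close> and the weights
  \<open>A\<close>. By \<open>fact_le_weights\<close> they give the step condition for every
  \<open>h > 0\<close> and every \<open>r \<le> 1\<close> at once.\<close>

definition gamma_bound :: "(nat \<Rightarrow> real) \<Rightarrow> real \<Rightarrow> real \<Rightarrow> ('d::finite phase \<Rightarrow> complex) \<Rightarrow> bool" where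
  "gamma_bound M \<mu> D f \<longleftrightarrow> smooth f \<and> (\<forall>is x \<xi>. cmod (iter_pd is f (x, \<xi>))
     \<le> D * (fact (length is) / jbr (x, \<xi>) ^ length is)
       * exp (assocf M (\<mu> * norm \<xi>) + assocf M (\<mu> * norm x)))"

lemma gamma_bound_nonneg: "gamma_bound M \<mu> D f \<Longrightarrow> D \<ge> 0"
proof -
  assume "gamma_bound M \<mu> D f"
  then have "0 \<le> D * (fact (length ([] :: ('a + 'a) list)) / jbr (0 :: real^'a, 0 :: real^'a) ^ length ([] :: ('a + 'a) list))
       * exp (assocf M (\<mu> * norm (0 :: real^'a)) + assocf M (\<mu> * norm (0 :: real^'a)))"
    unfolding gamma_bound_def by (meson norm_ge_zero order_trans)
  then show ?thesis by (simp add: zero_le_mult_iff)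
qed

lemma dmix_DD_norm:
  obtains "is" where "length is = mlen \<alpha> + mlen \<beta>" "\<And>f w. cmod (DD \<alpha> \<beta> f w) = cmod (iter_pd is f w)"
proof -
  obtain "is" where "length is = mlen \<alpha> + mlen \<beta>" "\<And>f. dmix \<alpha> \<beta> f = iter_pd is f"
    by (rule dmix_iter_pd[of \<alpha> \<beta>]) (rule that)
  then show thesis by (intro that) (simp_all add: DD_def norm_mult norm_power)
qed

lemma gvals_le:
  assumes f: "gamma_bound M \<mu> D f" and A: "\<And>p. A p > 0" and h: "h > 0" and r: "r \<le> 1"
    and C: "\<And>p q. fact (p + q) \<le> C * h ^ (p + q) * A p * A q"
    and v: "v \<in> gvals A M r h \<mu> f"
  shows "0 \<le> v \<and> v \<le> D * C"
proof -
  obtain \<alpha> \<beta> x \<xi> where v: "v = cmod (DD \<alpha> \<beta> f (x, \<xi>)) * jbr (x, \<xi>) powr (r * real (mlen \<alpha> + mlen \<beta>))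
        * exp (- assocf M (\<mu> * norm \<xi>) - assocf M (\<mu> * norm x))
        / (h ^ (mlen \<alpha> + mlen \<beta>) * A (mlen \<alpha>) * A (mlen \<beta>))"
    using v unfolding gvals_def by blast
  define k where "k = mlen \<alpha> + mlen \<beta>"
  define E where "E = assocf M (\<mu> * norm \<xi>) + assocf M (\<mu> * norm x)"
  define H where "H = h ^ k * A (mlen \<alpha>) * A (mlen \<beta>)"
  let ?w = "(x, \<xi>)"
  have H: "H > 0" using h A by (simp add: H_def)
  obtain "is" where L: "length is = mlen \<alpha> + mlen \<beta>" "\<And>f w. cmod (DD \<alpha> \<beta> f w) = cmod (iter_pd is f w)"
    by (rule dmix_DD_norm[of \<alpha> \<beta>]) (rule that)
  have "cmod (DD \<alpha> \<beta> f ?w) \<le> D * (fact k / jbr ?w ^ k) * exp E"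
    using f L unfolding gamma_bound_def k_def E_def by metis
  moreover have "jbr ?w powr (r * real k) \<le> jbr ?w ^ k"
  proof -
    have "jbr ?w powr (r * real k) \<le> jbr ?w powr (1 * real k)"
      using r by (intro powr_mono mult_right_mono) auto
    then show ?thesis by (simp add: powr_realpow)
  qed
  ultimately have "cmod (DD \<alpha> \<beta> f ?w) * jbr ?w powr (r * real k) * exp (- E)
      \<le> (D * (fact k / jbr ?w ^ k) * exp E) * jbr ?w ^ k * exp (- E)"
    using gamma_bound_nonneg[OF f] by (intro mult_right_mono mult_mono) auto
  also have "\<dots> = D * fact k"
    by (simp add: exp_minus)
  also have "\<dots> \<le> D * (C * H)"
    using gamma_bound_nonneg[OF f] C[of "mlen \<alpha>" "mlen \<beta>"]
    by (intro mult_left_mono) (simp_all add: k_def H_def mult_ac)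
  finally have "cmod (DD \<alpha> \<beta> f ?w) * jbr ?w powr (r * real k) * exp (- E) / H \<le> D * C"
    using H by (simp add: pos_divide_le_eq mult.assoc)
  moreover have "v = cmod (DD \<alpha> \<beta> f ?w) * jbr ?w powr (r * real k) * exp (- E) / H"
    by (simp add: v k_def E_def H_def algebra_simps)
  ultimately show ?thesis using H by simp
qed

lemma gvals_nonempty: "gvals A M r h \<mu> f \<noteq> {}"
  unfolding gvals_def by blast

lemma gamma_bound_inGstep:
  assumes f: "gamma_bound M \<mu> D f" and A: "\<And>p. A p > 0" and h: "h > 0" and r: "r \<le> 1"
    and C: "\<And>p q. fact (p + q) \<le> C * h ^ (p + q) * A p * A q"
  shows "inGstep A M r h \<mu> f" "0 \<le> gnorm A M r h \<mu> f" "gnorm A M r h \<mu> f \<le> D * C"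
proof -
  note le = gvals_le[OF assms]
  have bdd: "bdd_above (gvals A M r h \<mu> f)"
    using le by (intro bdd_aboveI[of _ "D * C"]) blast
  with f show "inGstep A M r h \<mu> f"
    by (simp add: inGstep_def gamma_bound_def)
  obtain v where v: "v \<in> gvals A M r h \<mu> f" using gvals_nonempty by blast
  show "0 \<le> gnorm A M r h \<mu> f"
    unfolding gnorm_def using cSup_upper[OF v bdd] le[OF v] by linarith
  show "gnorm A M r h \<mu> f \<le> D * C"
    unfolding gnorm_def using le by (intro cSup_least gvals_nonempty) blast
qed

lemma GammaI:
  assumes A: "weight_seq A" "M3' A" "M4 A" and r: "r \<le> 1"
    and f: "scale_quant beur (\<lambda>\<mu>. \<exists>D. gamma_bound M \<mu> D f)"
  shows "f \<in> Gamma beur A M r"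
proof -
  have Ap: "A p > 0" for p using A(1) by (simp add: weight_seq_def)
  have *: "inGstep A M r h \<mu> f" if h: "h > 0" and D: "\<exists>D. gamma_bound M \<mu> D f" for h \<mu>
  proof -
    obtain C where C: "\<And>p q. fact (p + q) \<le> C * h ^ (p + q) * A p * A q"
      using fact_le_weights[OF A h] by metis
    from D obtain D where "gamma_bound M \<mu> D f" by blast
    from gamma_bound_inGstep(1)[OF this Ap h r C] show ?thesis .
  qed
  show ?thesis
  proof (cases beur)
    case True
    with f obtain \<mu> where "\<mu> > 0" "\<exists>D. gamma_bound M \<mu> D f" by (auto simp: scale_quant_def)
    with * True show ?thesis unfolding Gamma_def by auto
  next
    case False
    with f have "\<forall>\<mu>>0. \<exists>D. gamma_bound M \<mu> D f" by (simp add: scale_quant_def)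
    then have "\<forall>\<mu>>0. inGstep A M r 1 \<mu> f" using *[of 1] by simp
    then have "\<exists>h>0. \<forall>\<mu>>0. inGstep A M r h \<mu> f" using zero_less_one by blast
    with False show ?thesis unfolding Gamma_def by simp
  qed
qed

lemma abs_conv_GammaI:
  fixes F :: "nat \<Rightarrow> 'd::finite phase \<Rightarrow> complex"
  assumes A: "weight_seq A" "M3' A" "M4 A" and r: "r \<le> 1"
    and F: "scale_quant beur (\<lambda>\<mu>. \<exists>D. \<forall>n. gamma_bound M \<mu> (D * (1 / 2) ^ n) (F n))"
  shows "abs_conv_Gamma beur A M r F"
proof -
  have Ap: "A p > 0" for p using A(1) by (simp add: weight_seq_def)
  have FG: "F n \<in> Gamma beur A M r" for n
    by (rule GammaI[OF A r scale_quant_mono[OF F]]) blast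
  have *: "summable (\<lambda>n. p (F n))"
    if p: "seminorm_on (Gamma beur A M r) p" and h: "h > 0"
      and D: "\<And>n. gamma_bound M \<mu> (D * (1 / 2) ^ n) (F n)"
      and le: "\<And>f. (\<And>n. f = F n \<Longrightarrow> p f \<le> C * gnorm A M r h \<mu> f)"
    for p :: "('d phase \<Rightarrow> complex) \<Rightarrow> real" and h \<mu> C D
  proof -
    obtain C' where C': "\<And>p q. fact (p + q) \<le> C' * h ^ (p + q) * A p * A q"
      using fact_le_weights[OF A h] by metis
    note g = gamma_bound_inGstep[OF D Ap h r C']
    have bound: "p (F n) \<le> (\<bar>C\<bar> * D * C') * (1 / 2) ^ n" for n
    proof -
      \<comment> \<open>\<open>cont_seminorm\<close> leaves the sign of \<open>C\<close> open, hence
        the absolute value.\<close>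
      have "p (F n) \<le> \<bar>C\<bar> * gnorm A M r h \<mu> (F n)"
        using le[OF refl, of n] mult_right_mono[OF abs_ge_self[of C] g(2)[of n]] by linarith
      also have "\<dots> \<le> \<bar>C\<bar> * (D * (1 / 2) ^ n * C')"
        using g(3) by (intro mult_left_mono) auto
      finally show ?thesis by (simp add: mult_ac)
    qed
    have nonneg: "0 \<le> p (F n)" for n
      using p FG unfolding seminorm_on_def by blast
    have "norm (p (F n)) \<le> (\<bar>C\<bar> * D * C') * (1 / 2) ^ n" for n
      using bound nonneg by simp
    then show ?thesis by (rule geometric_bound_suminf(1))
  qed
  show ?thesis
    unfolding abs_conv_Gamma_def
  proof (intro conjI allI impI FG)
    fix p :: "('d phase \<Rightarrow> complex) \<Rightarrow> real" assume cs: "cont_seminorm beur A M r p"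
    then have p: "seminorm_on (Gamma beur A M r) p" by (simp add: cont_seminorm_def)
    show "summable (\<lambda>n. p (F n))"
    \<comment> \<open>The order of the choices follows the limits: in the Beurling case
      \<open>F\<close> fixes \<open>\<mu>\<close> and the seminorm answers with \<open>h\<close>; in
      the Roumieu case \<open>h = 1\<close> is fixed and the seminorm answers with
      \<open>\<mu>\<close>.\<close>
    proof (cases beur)
      case True
      with F obtain \<mu> D where mu: "\<mu> > 0" and D: "\<And>n. gamma_bound M \<mu> (D * (1 / 2) ^ n) (F n)"
        by (auto simp: scale_quant_def)
      from cs True mu obtain h C where h: "h > 0"
        and le: "\<And>f. \<forall>h'>0. inGstep A M r h' \<mu> f \<Longrightarrow> p f \<le> C * gnorm A M r h \<mu> f"
        unfolding cont_seminorm_def by (simp only: if_True) blast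
      have "inGstep A M r h' \<mu> (F n)" if "h' > 0" for h' n
      proof -
        obtain C' where "\<And>p q. fact (p + q) \<le> C' * h' ^ (p + q) * A p * A q"
          using fact_le_weights[OF A \<open>h' > 0\<close>] by metis
        then show ?thesis by (rule gamma_bound_inGstep(1)[OF D Ap \<open>h' > 0\<close> r])
      qed
      then show ?thesis using le by (intro *[OF p h D]) blast
    next
      case False
      from cs False obtain \<mu> C where mu: "\<mu> > 0"
        and le: "\<And>f. \<forall>m'>0. inGstep A M r 1 m' f \<Longrightarrow> p f \<le> C * gnorm A M r 1 \<mu> f"
        unfolding cont_seminorm_def by (simp only: if_False) (metis zero_less_one)
      from F False mu obtain D where D: "\<And>n. gamma_bound M \<mu> (D * (1 / 2) ^ n) (F n)"
        by (auto simp: scale_quant_def)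
      obtain C' where C': "\<And>p q. fact (p + q) \<le> C' * 1 ^ (p + q) * A p * A q"
        using fact_le_weights[OF A zero_less_one] by metis
      have "inGstep A M r 1 m' (F n)" if "m' > 0" for m' n
      proof -
        obtain D where "\<And>n. gamma_bound M m' (D * (1 / 2) ^ n) (F n)"
          using F False \<open>m' > 0\<close> by (auto simp: scale_quant_def)
        from gamma_bound_inGstep(1)[OF this Ap zero_less_one r C'] show ?thesis .
      qed
      then show ?thesis using le by (intro *[OF p zero_less_one D]) blast
    qed
  qed
qed

text \<open>The last quotient is what \<open>growth_le_assocf\<close> turns into the exponential
  weight, uniformly in \<open>n\<close>, and \<open>(1 / 2) ^ n\<close> gives absolute
  convergence.\<close>

definition dominated ::
  "nat \<Rightarrow> real \<Rightarrow> real \<Rightarrow> real \<Rightarrow> (nat \<Rightarrow> 'd::finite phase \<Rightarrow> complex) \<Rightarrow> bool" where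
  "dominated m s R C F \<longleftrightarrow> (\<forall>n. smooth (F n)) \<and> (\<forall>n is w. cmod (iter_pd is (F n) w)
     \<le> fact (length is) / jbr w ^ length is * (C * (1 / 2) ^ n * (1 + (R * jbr w) ^ (n * m) / fact (n * m) powr s)))"

lemma dominatedD:
  "dominated m s R C F \<Longrightarrow> cmod (iter_pd is (F n) w)
     \<le> fact (length is) / jbr w ^ length is * (C * (1 / 2) ^ n * (1 + (R * jbr w) ^ (n * m) / fact (n * m) powr s))"
  unfolding dominated_def by blast

lemma dominated_geom_bounded:
  assumes F: "dominated m s R C F" and "R \<ge> 0" "s \<ge> 1" "C \<ge> 0"
  shows "geom_bounded F"
  unfolding geom_bounded_def
proof (intro conjI allI exI impI)
  show "smooth (F n)" for n using F by (simp add: dominated_def)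
  fix "is" :: "('a + 'a) list" and r n and w :: "'a phase" assume w: "norm w \<le> r"
  let ?k = "length is"
  have "fact ?k / jbr w ^ ?k \<le> fact ?k / 1"
    by (intro divide_left_mono one_le_power) auto
  moreover have "(R * jbr w) ^ (n * m) / fact (n * m) powr s \<le> exp (R * (1 + r))"
  proof -
    have "(R * jbr w) ^ (n * m) / fact (n * m) powr s \<le> (R * jbr w) ^ (n * m) / fact (n * m)"
      using assms by (intro div_fact_powr_le) auto
    also have "\<dots> \<le> exp (R * jbr w)"
      using assms by (intro power_div_fact_le_exp) auto
    also have "\<dots> \<le> exp (R * (1 + r))"
      using jbr_le[of w] w assms by (simp add: mult_left_mono)
    finally show ?thesis .
  qed
  ultimately have "cmod (iter_pd is (F n) w) \<le> fact ?k / 1 * (C * (1 / 2) ^ n * (1 + exp (R * (1 + r))))"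
    using assms by (intro order_trans[OF dominatedD[OF F]] mult_mono) auto
  then show "cmod (iter_pd is (F n) w) \<le> (fact ?k * C * (1 + exp (R * (1 + r)))) * (1 / 2) ^ n"
    by (simp add: mult_ac)
qed

lemma jbr_pair_le: "jbr (x, \<xi>) \<le> 2 * (1 + max (norm x) (norm \<xi>))"
proof -
  have "jbr (x, \<xi>) \<le> 1 + norm (x, \<xi>)" by (rule jbr_le)
  also have "norm (x, \<xi>) \<le> norm x + norm \<xi>" by (rule norm_Pair_le)
  also have "\<dots> \<le> 2 * max (norm x) (norm \<xi>)" by linarith
  finally show ?thesis by simp
qed

lemma dominated_gamma_bound:
  assumes F: "dominated m s R C F" and R: "R > 0" and s: "s \<ge> 1" and C: "C \<ge> 0"
    and M: "weight_seq M" "\<And>p. fact p \<le> E * L ^ p * M p"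
      "if beur then wsubset M (\<lambda>p. fact p powr s) else wprec M (\<lambda>p. fact p powr s)"
  shows "scale_quant beur (\<lambda>\<mu>. \<exists>D. \<forall>n. gamma_bound M \<mu> (D * (1 / 2) ^ n) (F n))"
proof -
  have "scale_quant beur (\<lambda>\<mu>. \<exists>D\<ge>0. \<forall>t\<ge>0. \<forall>N.
    (2 * R * (1 + t)) ^ N / fact N powr s \<le> D * exp (assocf M (\<mu> * t)))"
    by (rule growth_le_assocf[OF M s]) (use R in simp)
  then show ?thesis
  proof (rule scale_quant_mono)
    fix \<mu> :: real assume mu: "\<mu> > 0" and
      "\<exists>D\<ge>0. \<forall>t\<ge>0. \<forall>N. (2 * R * (1 + t)) ^ N / fact N powr s \<le> D * exp (assocf M (\<mu> * t))"
    then obtain D where D: "D \<ge> 0"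
      "\<And>t N. t \<ge> 0 \<Longrightarrow> (2 * R * (1 + t)) ^ N / fact N powr s \<le> D * exp (assocf M (\<mu> * t))" by blast
    have "gamma_bound M \<mu> (C * (1 + D) * (1 / 2) ^ n) (F n)" for n
      unfolding gamma_bound_def
    proof (intro conjI allI)
      show "smooth (F n)" using F by (simp add: dominated_def)
      fix "is" :: "('a + 'a) list" and x \<xi> :: "real^'a"
      \<comment> \<open>The maximum \<open>?t\<close> is one of the two norms, so its associated
        function is a summand of \<open>?E\<close>, and the scale \<open>\<mu>\<close> is not
        enlarged.\<close>
      let ?E = "assocf M (\<mu> * norm \<xi>) + assocf M (\<mu> * norm x)" and ?t = "max (norm x) (norm \<xi>)"
      have E: "0 \<le> assocf M (\<mu> * norm \<xi>)" "0 \<le> assocf M (\<mu> * norm x)"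
        using mu by (intro power_le_assocf(2)[OF M(1,2)]; simp)+
      have "(R * jbr (x, \<xi>)) ^ (n * m) / fact (n * m) powr s \<le> (2 * R * (1 + ?t)) ^ (n * m) / fact (n * m) powr s"
        using jbr_pair_le[of x \<xi>] R by (intro divide_right_mono power_mono) auto
      also have "\<dots> \<le> D * exp (assocf M (\<mu> * ?t))"
        by (rule D(2)) (simp add: le_max_iff_disj)
      also have "\<dots> \<le> D * exp ?E"
        using D(1) E by (intro mult_left_mono) (auto simp: max_def)
      finally have "1 + (R * jbr (x, \<xi>)) ^ (n * m) / fact (n * m) powr s \<le> exp ?E + D * exp ?E"
        using E by (intro add_mono) auto
      then have "cmod (iter_pd is (F n) (x, \<xi>))
          \<le> fact (length is) / jbr (x, \<xi>) ^ length is * (C * (1 / 2) ^ n * (exp ?E + D * exp ?E))"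
        using C by (intro order_trans[OF dominatedD[OF F]] mult_left_mono) auto
      then show "cmod (iter_pd is (F n) (x, \<xi>))
          \<le> C * (1 + D) * (1 / 2) ^ n * (fact (length is) / jbr (x, \<xi>) ^ length is) * exp ?E"
        by (simp add: algebra_simps)
    qed
    then show "\<exists>D. \<forall>n. gamma_bound M \<mu> (D * (1 / 2) ^ n) (F n)" by blast
  qed
qed

lemma gamma_bound_suminf:
  assumes F: "geom_bounded F" and D: "\<And>n. gamma_bound M \<mu> (D * (1 / 2) ^ n) (F n)"
  shows "gamma_bound M \<mu> (2 * D) (\<lambda>w. \<Sum>n. F n w)"
  unfolding gamma_bound_def
proof (intro conjI allI geom_bounded_smooth_suminf F)
  fix "is" :: "('a + 'a) list" and x \<xi> :: "real^'a"
  let ?E = "(fact (length is) / jbr (x, \<xi>) ^ length is) * exp (assocf M (\<mu> * norm \<xi>) + assocf M (\<mu> * norm x))"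
  have "norm (\<Sum>n. iter_pd is (F n) (x, \<xi>)) \<le> 2 * (D * ?E)"
  proof (rule geometric_bound_suminf(2))
    show "norm (iter_pd is (F n) (x, \<xi>)) \<le> D * ?E * (1 / 2) ^ n" for n
    proof -
      have "norm (iter_pd is (F n) (x, \<xi>)) \<le> D * (1 / 2) ^ n * (fact (length is) / jbr (x, \<xi>) ^ length is)
        * exp (assocf M (\<mu> * norm \<xi>) + assocf M (\<mu> * norm x))"
        using D[of n] unfolding gamma_bound_def by blast
      then show ?thesis by (simp only: mult_ac)
    qed
  qed
  then show "cmod (iter_pd is (\<lambda>w. \<Sum>n. F n w) (x, \<xi>)) \<le> 2 * D * (fact (length is) / jbr (x, \<xi>) ^ length is)
      * exp (assocf M (\<mu> * norm \<xi>) + assocf M (\<mu> * norm x))"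
    unfolding geom_bounded_iter_pd_suminf[OF F] by (simp only: mult.assoc)
qed

text \<open>A constant lower bound is enough because associated functions are nonnegative. As the
  derivative bounds carry only a power of \<open>D\<close>, inserting \<open>1 \<le> fact k\<close>
  and using \<open>fact_le_weights\<close> at \<open>h / D\<close> gives every \<open>h\<close>,
  which serves both cases.\<close>

lemma hypoellipticI:
  fixes f :: "'d::finite phase \<Rightarrow> complex"
  assumes A: "weight_seq A" "M3' A" "M4 A" and M: "weight_seq M" "\<And>p. fact p \<le> E * L ^ p * M p"
    and f: "f \<in> Gamma beur A M \<rho>" and B: "B > 0" and D: "D \<ge> 1"
    and low: "\<And>w. w \<notin> Qset B \<Longrightarrow> cmod (f w) \<ge> 1 / 2"
    and up: "\<And>w is. w \<notin> Qset B \<Longrightarrow>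
      cmod (iter_pd is f w) \<le> D ^ (length is + 1) * cmod (f w) / jbr w powr (\<rho> * real (length is))"
  shows "hypoelliptic beur A M \<rho> f"
proof -
  have low': "\<forall>x \<xi>. (x, \<xi>) \<notin> Qset B \<longrightarrow>
      cmod (f (x, \<xi>)) \<ge> 1 / 2 * exp (- assocf M (m * norm x) - assocf M (m * norm \<xi>))" if "m > 0" for m
  proof (intro allI impI)
    fix x \<xi> :: "real^'d" assume w: "(x, \<xi>) \<notin> Qset B"
    have "0 \<le> assocf M (m * norm \<xi>)" "0 \<le> assocf M (m * norm x)"
      using that by (intro power_le_assocf(2)[OF M]; simp)+
    then have "1 / 2 * exp (- assocf M (m * norm x) - assocf M (m * norm \<xi>)) \<le> 1 / 2" by simp
    with low[OF w] show "cmod (f (x, \<xi>)) \<ge> 1 / 2 * exp (- assocf M (m * norm x) - assocf M (m * norm \<xi>))"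
      by linarith
  qed
  have up': "\<exists>C. \<forall>\<alpha> \<beta> w. w \<notin> Qset B \<longrightarrow>
      cmod (DD \<alpha> \<beta> f w) \<le> C * h ^ (mlen \<alpha> + mlen \<beta>) * A (mlen \<alpha>) * A (mlen \<beta>)
         * cmod (f w) * jbr w powr (- \<rho> * real (mlen \<alpha> + mlen \<beta>))" if h: "h > 0" for h
  proof -
    have "h / D > 0" using h D by simp
    then obtain C where C: "\<And>p q. fact (p + q) \<le> C * (h / D) ^ (p + q) * A p * A q"
      using fact_le_weights[OF A] by metis
    show ?thesis
    proof (intro exI allI impI)
      fix \<alpha> \<beta> :: "'d \<Rightarrow> nat" and w :: "'d phase" assume w: "w \<notin> Qset B"
      let ?k = "mlen \<alpha> + mlen \<beta>"
      obtain "is" where L: "length is = ?k" "\<And>f w. cmod (DD \<alpha> \<beta> f w) = cmod (iter_pd is f w)"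
        by (rule dmix_DD_norm[of \<alpha> \<beta>]) (rule that)
      have "D ^ ?k * 1 \<le> D ^ ?k * (C * (h / D) ^ ?k * A (mlen \<alpha>) * A (mlen \<beta>))"
        using D by (intro mult_left_mono order_trans[OF fact_ge_1 C]) auto
      also have "\<dots> = C * h ^ ?k * A (mlen \<alpha>) * A (mlen \<beta>)"
        using D by (simp add: power_divide)
      finally have k: "D ^ ?k \<le> C * h ^ ?k * A (mlen \<alpha>) * A (mlen \<beta>)" by simp
      have "cmod (DD \<alpha> \<beta> f w) \<le> D ^ (?k + 1) * cmod (f w) / jbr w powr (\<rho> * real ?k)"
        using up[OF w, of "is"] L by metis
      also have "\<dots> = D ^ ?k * (D * cmod (f w) * jbr w powr (- \<rho> * real ?k))"
        by (simp add: powr_minus divide_inverse mult_ac)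
      also have "\<dots> \<le> C * h ^ ?k * A (mlen \<alpha>) * A (mlen \<beta>) * (D * cmod (f w) * jbr w powr (- \<rho> * real ?k))"
        using D by (intro mult_right_mono k) auto
      finally show "cmod (DD \<alpha> \<beta> f w) \<le> (D * C) * h ^ ?k * A (mlen \<alpha>) * A (mlen \<beta>)
         * cmod (f w) * jbr w powr (- \<rho> * real ?k)"
        by (simp only: mult_ac)
    qed
  qed
  define LB where "LB c m \<longleftrightarrow> (\<forall>x \<xi>. (x, \<xi>) \<notin> Qset B \<longrightarrow>
      cmod (f (x, \<xi>)) \<ge> c * exp (- assocf M (m * norm x) - assocf M (m * norm \<xi>)))" for c m
  define UB where "UB h C \<longleftrightarrow> (\<forall>\<alpha> \<beta> w. w \<notin> Qset B \<longrightarrow>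
      cmod (DD \<alpha> \<beta> f w) \<le> C * h ^ (mlen \<alpha> + mlen \<beta>) * A (mlen \<alpha>) * A (mlen \<beta>)
         * cmod (f w) * jbr w powr (- \<rho> * real (mlen \<alpha> + mlen \<beta>)))" for h C
  have LB: "LB (1 / 2) m" if "m > 0" for m
    unfolding LB_def by (rule low'[OF that])
  have UB: "\<exists>C. UB h C" if "h > 0" for h
    unfolding UB_def by (rule up'[OF that])
  have "if beur then (\<exists>c>0. \<exists>m>0. LB c m) \<and> (\<forall>h>0. \<exists>C. UB h C)
      else (\<forall>m>0. \<exists>c>0. LB c m) \<and> (\<exists>h>0. \<exists>C. UB h C)"
  proof (cases beur)
    case True
    have "\<exists>c>0. \<exists>m>0. LB c m"
      by (intro exI[of _ "1 / 2"] exI[of _ 1] conjI LB) simp_all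
    with True UB show ?thesis by simp
  next
    case False
    have "\<exists>h>0. \<exists>C. UB h C"
      by (intro exI[of _ 1] conjI UB) simp_all
    moreover have "\<forall>m>0. \<exists>c>0. LB c m"
      by (intro allI impI exI[of _ "1 / 2"] conjI LB) simp_all
    ultimately show ?thesis using False by simp
  qed
  with f B show ?thesis
    unfolding hypoelliptic_def LB_def UB_def by blast
qed

section \<open>Power series of symbols\<close>

lemma mixed_power_le:
  assumes "0 \<le> x" "0 \<le> (y :: real)" "i + l = N"
  shows "x ^ i * y ^ l \<le> x ^ N + y ^ N"
proof -
  have "x ^ i * y ^ l \<le> max x y ^ i * max x y ^ l"
    using assms by (intro mult_mono power_mono) auto
  also have "\<dots> = max x y ^ N" using assms(3) by (metis power_add)
  also have "\<dots> \<le> x ^ N + y ^ N" using assms by (simp add: max_def)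
  finally show ?thesis .
qed

text \<open>With \<open>4 * Q\<close> in place of \<open>Q\<close> the exponential bound is
  \<open>exp (4 * Q * sqrt N)\<close>, and \<open>4 * Q * sqrt N \<le> 8 * Q\<^sup>2 + N / 2\<close>
  keeps its growth below \<open>2 ^ N\<close>. Undoing the 4 divides by
  \<open>4 ^ N\<close>.\<close>

lemma sqrt_power_div_fact_le:
  assumes "Q \<ge> 0"
  shows "(Q * sqrt (real N)) ^ N / fact N \<le> exp (8 * Q\<^sup>2) * (1 / 2) ^ N"
proof -
  let ?r = "sqrt (real N)"
  have "4 * Q * ?r \<le> 8 * Q\<^sup>2 + (?r)\<^sup>2 / 2"
  proof -
    have "0 \<le> (4 * Q - ?r)\<^sup>2" by simp
    also have "\<dots> = 16 * Q\<^sup>2 - 8 * Q * ?r + ?r\<^sup>2"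
      by (simp add: power2_eq_square algebra_simps)
    finally show ?thesis by linarith
  qed
  then have le: "4 * Q * ?r \<le> 8 * Q\<^sup>2 + real N / 2" by simp
  have e: "exp (1 / 2 :: real) \<le> 2"
    using exp_bound_half[of "1 / 2 :: real"] by simp
  have "(4 * Q * ?r) ^ N / fact N \<le> exp (4 * Q * ?r)"
    using assms by (intro power_div_fact_le_exp) auto
  also have "\<dots> \<le> exp (8 * Q\<^sup>2 + real N / 2)" using le by simp
  also have "\<dots> = exp (8 * Q\<^sup>2) * exp (1 / 2) ^ N"
    by (simp add: exp_add exp_of_nat_mult[symmetric])
  also have "\<dots> \<le> exp (8 * Q\<^sup>2) * 2 ^ N"
    using e by (intro mult_left_mono power_mono) auto
  finally have "(1 / 4) ^ N * ((4 * Q * ?r) ^ N / fact N) \<le> (1 / 4) ^ N * (exp (8 * Q\<^sup>2) * 2 ^ N)"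
    by (rule mult_left_mono) simp
  moreover have "(1 / 4) ^ N * ((4 * Q * ?r) ^ N / fact N) = (Q * ?r) ^ N / fact N"
    by (simp add: power_mult_distrib power_divide)
  moreover have "(1 / 4 :: real) ^ N * (exp (8 * Q\<^sup>2) * 2 ^ N) = exp (8 * Q\<^sup>2) * (1 / 2) ^ N"
    by (simp add: power_divide flip: power_mult_distrib)
      (simp add: field_simps flip: power_mult_distrib)
  ultimately show ?thesis by simp
qed

lemma iter_pd_divide:
  assumes "smooth f"
  shows "iter_pd is (\<lambda>w. f w / z) = (\<lambda>w. iter_pd is f w / z)"
  using iter_pd_cmult[OF assms, of "is" "inverse z"] by (simp add: divide_inverse mult.commute)

lemma smooth_divide: "smooth f \<Longrightarrow> smooth (\<lambda>w. f w / z)"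
  using smooth_cmult[of f "inverse z"] by (simp add: divide_inverse mult.commute)

lemma iter_pd_diff:
  assumes "smooth f" "smooth g"
  shows "iter_pd is (\<lambda>w. f w - g w) = (\<lambda>w. iter_pd is f w - iter_pd is g w)"
  using iter_pd_add[OF assms(1) smooth_cmult[OF assms(2), of "-1"], of "is"]
  by (simp add: iter_pd_cmult[OF assms(2), of _ "-1", simplified])

lemma smooth_diff: "smooth f \<Longrightarrow> smooth g \<Longrightarrow> smooth (\<lambda>w. f w - g w)"
  using smooth_add[of f "\<lambda>w. -1 * g w"] smooth_cmult[of g "-1"] by simp

lemma maj_spow_all:
  fixes a :: "'d::finite phase \<Rightarrow> complex"
  assumes a: "smooth a" "maj w c m b a" and c: "c \<ge> 0"
  shows "maj w c (n * m - 2 * j)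
    (b ^ n * (c\<^sup>2 * sharp_const TYPE('d) m) ^ j * spow_coef (n * m) j) (spow a n j)"
proof (cases n)
  case 0
  show ?thesis
  proof (cases "j = 0")
    case True
    then show ?thesis
      using maj_const[OF c, of w 1] by (simp add: 0 single_def spow_coef_def)
  next
    case False
    then show ?thesis
      using sharp_const_ge_1[of "TYPE('d)" m] c by (simp add: 0 single_def spow_coef_def maj_zero)
  qed
next
  case (Suc n')
  show ?thesis unfolding Suc by (rule maj_spow[OF assms])
qed

lemma spoly_sum_all:
  fixes a :: "'d::finite phase \<Rightarrow> complex"
  assumes "smooth a" "\<And>w. \<exists>c\<ge>0. \<exists>b. maj w c m b a"
  shows "spoly a n = (\<lambda>w. \<Sum>j\<le>n * m. spow a n j w)"
  unfolding spoly_sum[OF assms]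
  by (simp add: fun_eq_iff sum.atMost_shift spow_0 sum.atLeast1_atMost_eq)

section \<open>Series with coefficients \<open>1 / Mh n\<close>\<close>

locale series_weights =
  fixes Mh :: "nat \<Rightarrow> real" and C0 s :: real and m :: nat
  assumes Mh_pos: "\<And>n. Mh n > 0" and Mh_0: "Mh 0 = 1" and C0: "C0 \<ge> 1"
    and Mh_growth: "\<And>n k. k \<le> n \<Longrightarrow> C0 ^ (n - k) * Mh n / fact (n * m) powr s \<ge> Mh k / fact (k * m) powr s"
    and s: "s \<ge> 1" and m: "m \<ge> 1"
begin

lemma inverse_Mh_le: "1 / Mh n \<le> C0 ^ n / fact (n * m) powr s"
  using Mh_growth[of 0 n] Mh_pos[of n] by (simp add: Mh_0 field_simps)

lemma n_le: "n \<le> n * m"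
  using m by simp

text \<open>In \<open>4 * K * C0\<close> one factor 2 pays for the \<open>2 ^ (n * m)\<close> of
  \<open>ff_le_fact\<close>; the other leaves \<open>(1 / 2) ^ n\<close>, because
  \<open>n \<le> n * m\<close>.\<close>

lemma dominated_power:
  fixes f :: "'d::finite phase \<Rightarrow> complex"
  assumes f: "smooth f" "\<And>w. maj w (1 / jbr w) m (K * jbr w ^ m) f" and K: "K \<ge> 1"
  shows "dominated m s (4 * K * C0) 1 (\<lambda>n w. f w ^ n / complex_of_real (Mh n))"
  unfolding dominated_def
proof (intro conjI allI)
  show "smooth (\<lambda>w. f w ^ n / complex_of_real (Mh n))" for n
    by (intro smooth_divide smooth_power f)
  fix n and "is" :: "('d + 'd) list" and w :: "'d phase"
  let ?k = "length is" and ?N = "n * m" and ?F = "fact (n * m) powr s :: real"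
  have mj: "maj w (1 / jbr w) ?N ((K * jbr w ^ m) ^ n) (\<lambda>w. f w ^ n)"
    by (rule maj_power[OF f]) simp
  have "cmod (iter_pd is (\<lambda>w. f w ^ n / complex_of_real (Mh n)) w)
      = cmod (iter_pd is (\<lambda>w. f w ^ n) w) * (1 / Mh n)"
    using Mh_pos[of n] by (simp add: iter_pd_divide smooth_power f norm_divide)
  also have "\<dots> \<le> ((K * jbr w ^ m) ^ n * (1 / jbr w) ^ ?k * ff ?N ?k) * (C0 ^ n / ?F)"
    using Mh_pos[of n] K by (intro mult_mono majD[OF mj] inverse_Mh_le) auto
  also have "\<dots> \<le> ((K * jbr w ^ m) ^ n * (1 / jbr w) ^ ?k * (fact ?k * 2 ^ ?N)) * (C0 ^ n / ?F)"
    using K C0 by (intro mult_right_mono mult_left_mono ff_le_fact) auto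
  also have "\<dots> = fact ?k / jbr w ^ ?k * ((K ^ n * C0 ^ n * 2 ^ ?N) * (jbr w ^ ?N / ?F))"
    by (simp add: power_mult_distrib power_divide power_mult[symmetric] mult_ac)
  also have "\<dots> \<le> fact ?k / jbr w ^ ?k * (((K ^ ?N * C0 ^ ?N * 2 ^ ?N) * ((1 / 2) ^ n * 2 ^ ?N)) * (jbr w ^ ?N / ?F))"
  proof (intro mult_left_mono mult_right_mono)
    have "(2 :: real) ^ n \<le> 2 ^ ?N" by (intro power_increasing n_le) simp
    then have 1: "1 \<le> (1 / 2 :: real) ^ n * 2 ^ ?N" by (simp add: power_divide)
    have 2: "K ^ n * C0 ^ n * 2 ^ ?N \<le> K ^ ?N * C0 ^ ?N * 2 ^ ?N"
      using K C0 by (intro mult_right_mono mult_mono power_increasing n_le) auto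
    show "K ^ n * C0 ^ n * 2 ^ ?N \<le> (K ^ ?N * C0 ^ ?N * 2 ^ ?N) * ((1 / 2) ^ n * 2 ^ ?N)"
      using mult_mono[OF 2 1] K C0 by simp
  qed auto
  also have "(K ^ ?N * C0 ^ ?N * 2 ^ ?N) * ((1 / 2) ^ n * 2 ^ ?N) = (1 / 2) ^ n * (4 * K * C0) ^ ?N"
  proof -
    have "(4 :: real) ^ ?N = 2 ^ ?N * 2 ^ ?N" by (simp flip: power_mult_distrib)
    then show ?thesis by (simp add: power_mult_distrib mult_ac)
  qed
  also have "(1 / 2) ^ n * (4 * K * C0) ^ ?N * (jbr w ^ ?N / ?F) = (1 / 2) ^ n * ((4 * K * C0 * jbr w) ^ ?N / ?F)"
    by (simp add: power_mult_distrib)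
  also have "fact ?k / jbr w ^ ?k * ((1 / 2) ^ n * ((4 * K * C0 * jbr w) ^ ?N / ?F))
      \<le> fact ?k / jbr w ^ ?k * (1 * (1 / 2) ^ n * (1 + (4 * K * C0 * jbr w) ^ ?N / ?F))"
    unfolding mult_1_left by (rule mult_left_mono, rule mult_left_mono) simp_all
  finally show "cmod (iter_pd is (\<lambda>w. f w ^ n / complex_of_real (Mh n)) w)
      \<le> fact ?k / jbr w ^ ?k * (1 * (1 / 2) ^ n * (1 + (4 * K * C0 * jbr w) ^ ?N / ?F))" .
qed

text \<open>Up to geometric factors the \<open>j\<close>-th term of a sharp power is
  \<open>jbr w ^ (N - 2 * j) * N ^ j\<close>, with \<open>N = n * m\<close>, hence at most
  \<open>jbr w ^ N + sqrt N ^ N\<close>. The second part is free of \<open>w\<close> and still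
  beaten by \<open>fact N\<close>; it accounts for the \<open>1 +\<close> in
  \<open>dominated\<close>.\<close>

lemma dominated_spoly:
  fixes f :: "'d::finite phase \<Rightarrow> complex"
  assumes f: "smooth f" "\<And>w. maj w (1 / jbr w) m (K * jbr w ^ m) f" and K: "K \<ge> 1"
  shows "\<exists>R>0. \<exists>C\<ge>0. dominated m s R C (\<lambda>n w. spoly f n w / complex_of_real (Mh n))"
proof -
  let ?t = "sharp_const TYPE('d) m"
  \<comment> \<open>The 8 collects three factors 2: from the binomial coefficient, from
    \<open>ff_le_fact\<close> and from the number \<open>N + 1\<close> of terms.\<close>
  define Q where "Q = 8 * ?t * K * C0"
  have t: "?t \<ge> 1" by (rule sharp_const_ge_1)
  have Q: "Q > 0" using t K C0 by (simp add: Q_def)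
  have ex: "\<exists>c\<ge>0. \<exists>b. maj w c m b f" for w
  proof (intro exI conjI)
    show "maj w (1 / jbr w) m (K * jbr w ^ m) f" by (rule f)
  qed simp
  note sum = spoly_sum_all[OF f(1) ex]
  have sm: "smooth (spoly f n)" for n
    unfolding sum by (intro smooth_sum smooth_spow f)
  have bound: "cmod (iter_pd is (spoly f n) w) \<le> fact (length is) / jbr w ^ length is
      * ((8 * ?t * K) ^ (n * m) * (jbr w ^ (n * m) + sqrt (real (n * m)) ^ (n * m)))" for n "is" w
  proof -
    let ?k = "length is" and ?N = "n * m"
    let ?S = "jbr w ^ ?N + sqrt (real ?N) ^ ?N"
    let ?X = "fact ?k / jbr w ^ ?k * (K ^ ?N * ?t ^ ?N * (2 ^ ?N * 2 ^ ?N) * ?S)"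
    have S: "?S \<ge> 0" by simp
    have term_le: "cmod (iter_pd is (spow f n j) w) \<le> ?X" if j: "j \<le> ?N" for j
    proof -
      let ?b = "(K * jbr w ^ m) ^ n * ((1 / jbr w)\<^sup>2 * ?t) ^ j * spow_coef ?N j"
      have "maj w (1 / jbr w) (?N - 2 * j) ?b (spow f n j)"
        by (rule maj_spow_all[OF f]) simp
      then have "cmod (iter_pd is (spow f n j) w) \<le> ?b * (1 / jbr w) ^ ?k * ff (?N - 2 * j) ?k"
        by (rule majD)
      also have "\<dots> \<le> ?X"
      proof (cases "2 * j \<le> ?N")
        case True
        have "ff (?N - 2 * j) ?k \<le> fact ?k * 2 ^ (?N - 2 * j)" by (rule ff_le_fact)
        also have "\<dots> \<le> fact ?k * 2 ^ ?N" by (intro mult_left_mono power_increasing) auto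
        finally have f1: "ff (?N - 2 * j) ?k \<le> fact ?k * 2 ^ ?N" .
        have f2: "real (?N choose j) \<le> 2 ^ ?N"
          using binomial_le_pow2[of ?N j] by (metis of_nat_le_iff of_nat_numeral of_nat_power)
        have f3: "jbr w ^ (?N - 2 * j) * sqrt (real ?N) ^ (2 * j) \<le> ?S"
          using True by (intro mixed_power_le) auto
        have "(jbr w ^ m) ^ n = jbr w ^ (?N - 2 * j) * jbr w ^ (2 * j)"
          using True by (simp add: power_mult[symmetric] mult.commute flip: power_add)
        moreover have "real ?N ^ j = sqrt (real ?N) ^ (2 * j)"
          by (simp add: power_mult)
        ultimately have "?b * (1 / jbr w) ^ ?k * ff (?N - 2 * j) ?k
            = (K ^ n * ?t ^ j) * (real (?N choose j) * ff (?N - 2 * j) ?k)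
              * (jbr w ^ (?N - 2 * j) * sqrt (real ?N) ^ (2 * j)) * (1 / jbr w) ^ ?k"
          using True by (simp add: spow_coef_def power_mult_distrib power_divide power_mult[symmetric] mult_ac)
        also have "\<dots> \<le> (K ^ ?N * ?t ^ ?N) * (2 ^ ?N * (fact ?k * 2 ^ ?N)) * ?S * (1 / jbr w) ^ ?k"
          using K t S by (intro mult_right_mono mult_mono f1 f2 f3 power_increasing n_le j mult_nonneg_nonneg) auto
        also have "\<dots> = ?X" by (simp add: power_divide mult_ac)
        finally show ?thesis .
      next
        case False
        then have "?b = 0" by (simp add: spow_coef_def)
        then show ?thesis using K t S by simp
      qed
      finally show ?thesis .
    qed
    have "cmod (iter_pd is (spoly f n) w) \<le> (\<Sum>j\<le>?N. ?X)"
      unfolding sum iter_pd_sum[OF smooth_spow[OF f(1)]]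
      by (rule sum_norm_le) (rule term_le, simp)
    also have "\<dots> = real (?N + 1) * ?X" by simp
    also have "\<dots> \<le> 2 ^ ?N * ?X"
    proof (rule mult_right_mono)
      have "?N + 1 \<le> 2 ^ ?N" by (metis Suc_eq_plus1 Suc_leI less_exp)
      then show "real (?N + 1) \<le> 2 ^ ?N" by (metis of_nat_le_iff of_nat_numeral of_nat_power)
    qed (use K t S in auto)
    also have "\<dots> = fact ?k / jbr w ^ ?k * ((2 ^ ?N * (2 ^ ?N * 2 ^ ?N) * ?t ^ ?N * K ^ ?N) * ?S)"
      by (simp only: mult_ac)
    also have "2 ^ ?N * (2 ^ ?N * 2 ^ ?N) = (8 :: real) ^ ?N"
      by (simp flip: power_mult_distrib)
    also have "8 ^ ?N * ?t ^ ?N * K ^ ?N = (8 * ?t * K) ^ ?N"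
      by (simp only: power_mult_distrib)
    finally show ?thesis .
  qed
  have "dominated m s (2 * Q) (exp (8 * Q\<^sup>2)) (\<lambda>n w. spoly f n w / complex_of_real (Mh n))"
    unfolding dominated_def
  proof (intro conjI allI)
    show "smooth (\<lambda>w. spoly f n w / complex_of_real (Mh n))" for n
      by (intro smooth_divide sm)
    fix n and "is" :: "('d + 'd) list" and w :: "'d phase"
    let ?k = "length is" and ?N = "n * m" and ?F = "fact (n * m) powr s :: real"
    let ?r = "sqrt (real ?N)"
    have "cmod (iter_pd is (\<lambda>w. spoly f n w / complex_of_real (Mh n)) w)
      = cmod (iter_pd is (spoly f n) w) * (1 / Mh n)"
      using Mh_pos[of n] by (simp add: iter_pd_divide sm norm_divide)
    also have "\<dots> \<le> (fact ?k / jbr w ^ ?k * ((8 * ?t * K) ^ ?N * (jbr w ^ ?N + ?r ^ ?N))) * (C0 ^ ?N / ?F)"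
    proof (intro mult_mono bound)
      have "1 / Mh n \<le> C0 ^ n / ?F" by (rule inverse_Mh_le)
      also have "\<dots> \<le> C0 ^ ?N / ?F"
        using C0 by (intro divide_right_mono power_increasing n_le) auto
      finally show "1 / Mh n \<le> C0 ^ ?N / ?F" .
    qed (use Mh_pos[of n] t K in auto)
    also have "\<dots> = fact ?k / jbr w ^ ?k * ((Q * jbr w) ^ ?N / ?F + (Q * ?r) ^ ?N / ?F)"
      by (simp add: Q_def power_mult_distrib add_divide_distrib distrib_left mult_ac)
    also have "\<dots> \<le> fact ?k / jbr w ^ ?k * (exp (8 * Q\<^sup>2) * (1 / 2) ^ n * (1 + (2 * Q * jbr w) ^ ?N / ?F))"
    proof (rule mult_left_mono)
      have half: "(1 / 2 :: real) ^ ?N \<le> (1 / 2) ^ n"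
        by (intro power_decreasing n_le) auto
      have "(Q * jbr w) ^ ?N / ?F = (1 / 2) ^ ?N * ((2 * Q * jbr w) ^ ?N / ?F)"
        by (simp add: power_mult_distrib power_divide)
      also have "\<dots> \<le> (exp (8 * Q\<^sup>2) * (1 / 2) ^ n) * ((2 * Q * jbr w) ^ ?N / ?F)"
      proof (rule mult_right_mono)
        have "1 * (1 / 2 :: real) ^ ?N \<le> exp (8 * Q\<^sup>2) * (1 / 2) ^ n"
          using half by (intro mult_mono) auto
        then show "(1 / 2 :: real) ^ ?N \<le> exp (8 * Q\<^sup>2) * (1 / 2) ^ n" by simp
      qed (use Q in auto)
      finally have 1: "(Q * jbr w) ^ ?N / ?F \<le> (exp (8 * Q\<^sup>2) * (1 / 2) ^ n) * ((2 * Q * jbr w) ^ ?N / ?F)" .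
      have "(Q * ?r) ^ ?N / ?F \<le> (Q * ?r) ^ ?N / fact ?N"
        using Q s by (intro div_fact_powr_le) auto
      also have "\<dots> \<le> exp (8 * Q\<^sup>2) * (1 / 2) ^ ?N"
        using Q by (intro sqrt_power_div_fact_le) auto
      also have "\<dots> \<le> exp (8 * Q\<^sup>2) * (1 / 2) ^ n"
        using half by (intro mult_left_mono) auto
      finally show "(Q * jbr w) ^ ?N / ?F + (Q * ?r) ^ ?N / ?F
          \<le> exp (8 * Q\<^sup>2) * (1 / 2) ^ n * (1 + (2 * Q * jbr w) ^ ?N / ?F)"
        using 1 unfolding distrib_left by linarith
    qed auto
    finally show "cmod (iter_pd is (\<lambda>w. spoly f n w / complex_of_real (Mh n)) w)
      \<le> fact ?k / jbr w ^ ?k * (exp (8 * Q\<^sup>2) * (1 / 2) ^ n * (1 + (2 * Q * jbr w) ^ ?N / ?F))" .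
  qed
  then show ?thesis using Q by (intro exI[of _ "2 * Q"] exI[of _ "exp (8 * Q\<^sup>2)"] conjI) auto
qed

lemma summable_power_series: "summable (\<lambda>n. (x :: real) ^ n / Mh n)"
proof (rule summable_comparison_test'[of "\<lambda>n. inverse (fact n) * (C0 * \<bar>x\<bar>) ^ n" 0])
  show "summable (\<lambda>n. inverse (fact n) * (C0 * \<bar>x\<bar>) ^ n)"
    by (rule summable_exp)
  fix n
  have "1 / Mh n \<le> C0 ^ n / fact (n * m) powr s" by (rule inverse_Mh_le)
  also have "\<dots> \<le> C0 ^ n / fact (n * m)"
    using C0 s by (intro div_fact_powr_le) auto
  also have "\<dots> \<le> C0 ^ n / fact n"
    using C0 by (intro divide_left_mono fact_mono n_le) auto
  finally have "\<bar>x\<bar> ^ n * (1 / Mh n) \<le> \<bar>x\<bar> ^ n * (C0 ^ n / fact n)"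
    by (rule mult_left_mono) simp
  moreover have "norm (x ^ n / Mh n) = \<bar>x\<bar> ^ n * (1 / Mh n)"
    using Mh_pos[of n] by (simp add: power_abs)
  moreover have "\<bar>x\<bar> ^ n * (C0 ^ n / fact n) = inverse (fact n) * (C0 * \<bar>x\<bar>) ^ n"
    by (simp add: power_mult_distrib divide_inverse)
  ultimately show "norm (x ^ n / Mh n) \<le> inverse (fact n) * (C0 * \<bar>x\<bar>) ^ n"
    by simp
qed

lemma continuous_power_series: "continuous_on UNIV (\<lambda>x :: real. \<Sum>n. x ^ n / Mh n)"
proof (rule continuous_at_imp_continuous_on, intro ballI)
  fix x :: real
  have "summable (\<lambda>n. 1 / Mh n * (\<bar>x\<bar> + 1) ^ n)"
    using summable_power_series[of "\<bar>x\<bar> + 1"] by simp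
  then have "isCont (\<lambda>x. \<Sum>n. 1 / Mh n * x ^ n) x"
    by (rule isCont_powser) simp
  then show "isCont (\<lambda>x. \<Sum>n. x ^ n / Mh n) x" by simp
qed

lemma power_series_ge_1:
  assumes "x \<ge> 0"
  shows "(\<Sum>n. x ^ n / Mh n) \<ge> 1"
proof -
  have "(\<Sum>n\<in>{0}. x ^ n / Mh n) \<le> (\<Sum>n. x ^ n / Mh n)"
    using assms Mh_pos by (intro sum_le_suminf summable_power_series) (auto simp: less_imp_le)
  then show ?thesis by (simp add: Mh_0)
qed

text \<open>The common form of the three estimates in \<open>relative_estimates_at\<close>, which
  differ only in \<open>H\<close>, \<open>v\<close> and \<open>Z\<close>.\<close>

lemma suminf_iter_pd_le:
  assumes H: "\<And>n. cmod (iter_pd is (H n) w) \<le> x ^ n * (c ^ length is * v n)"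
    and v: "\<And>n. 0 \<le> v n" "\<And>n. v n \<le> Z * tail_weight (j * m) (n * m)"
    and j: "j * m \<ge> 1" and x: "x \<ge> 0" and c: "c \<ge> 0"
    and small: "2 * C0 * x * exp (2 * real m) \<le> real (j * m) powr (s * m)"
  shows "cmod (\<Sum>n. iter_pd is (H n) w / complex_of_real (Mh n)) \<le> c ^ length is * (2 * Z * (\<Sum>n. x ^ n / Mh n))"
proof -
  have t: "summable (\<lambda>n. v n * x ^ n / Mh n)" "(\<Sum>n. v n * x ^ n / Mh n) \<le> 2 * Z * (\<Sum>n. x ^ n / Mh n)"
    using suminf_tail_weight[OF Mh_pos C0 Mh_growth s j x summable_power_series small v] by simp_all
  have le: "norm (iter_pd is (H n) w / complex_of_real (Mh n)) \<le> c ^ length is * (v n * x ^ n / Mh n)" for n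
    using divide_right_mono[OF H[of n], of "Mh n"] Mh_pos[of n] by (simp add: norm_divide mult_ac)
  have sm: "summable (\<lambda>n. c ^ length is * (v n * x ^ n / Mh n))"
    by (rule summable_mult[OF t(1)])
  have sn: "summable (\<lambda>n. norm (iter_pd is (H n) w / complex_of_real (Mh n)))"
    by (rule summable_comparison_test'[OF sm, of 0]) (use le in simp)
  have "cmod (\<Sum>n. iter_pd is (H n) w / complex_of_real (Mh n))
      \<le> (\<Sum>n. norm (iter_pd is (H n) w / complex_of_real (Mh n)))"
    by (rule summable_norm[OF sn])
  also have "\<dots> \<le> (\<Sum>n. c ^ length is * (v n * x ^ n / Mh n))"
    by (rule suminf_le[OF le sn sm])
  also have "\<dots> = c ^ length is * (\<Sum>n. v n * x ^ n / Mh n)"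
    by (rule suminf_mult[OF t(1)])
  also have "\<dots> \<le> c ^ length is * (2 * Z * (\<Sum>n. x ^ n / Mh n))"
    using c by (intro mult_left_mono t(2)) auto
  finally show ?thesis .
qed

end

text \<open>Telescoping: \<open>g ^ Suc n - f ^ Suc n\<close> is
  \<open>g * (g ^ n - f ^ n) + (g - f) * f ^ n\<close>, and \<open>g\<close> itself has the
  coefficient \<open>(1 + \<theta>) * b\<close>.\<close>

lemma maj_power_diff:
  assumes f: "smooth f" "maj w c m b f" and g: "smooth g" "maj w c m (\<theta> * b) (\<lambda>w. g w - f w)"
    and c: "c \<ge> 0" and t: "\<theta> \<ge> 0"
  shows "maj w c (n * m) (b ^ n * ((1 + \<theta>) ^ n - 1)) (\<lambda>w. g w ^ n - f w ^ n)"
proof (induction n)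
  case 0
  show ?case using c by (simp add: maj_zero)
next
  case (Suc n)
  have b: "b \<ge> 0" by (rule maj_nonneg[OF f(2)])
  have "maj w c m (b + \<theta> * b) (\<lambda>w. f w + (g w - f w))"
    by (intro maj_add f g smooth_diff)
  then have gm: "maj w c m (b + \<theta> * b) g" by simp
  have "maj w c (m + n * m) ((b + \<theta> * b) * (b ^ n * ((1 + \<theta>) ^ n - 1)) + \<theta> * b * b ^ n)
      (\<lambda>w. g w * (g w ^ n - f w ^ n) + (g w - f w) * f w ^ n)"
    by (intro maj_add maj_mult Suc gm g c f maj_power smooth_mult smooth_diff smooth_power)
  moreover have "(\<lambda>w. g w * (g w ^ n - f w ^ n) + (g w - f w) * f w ^ n) = (\<lambda>w. g w ^ Suc n - f w ^ Suc n)"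
    by (simp add: fun_eq_iff algebra_simps)
  moreover have "(b + \<theta> * b) * (b ^ n * ((1 + \<theta>) ^ n - 1)) + \<theta> * b * b ^ n = b ^ Suc n * ((1 + \<theta>) ^ Suc n - 1)"
    by (simp add: algebra_simps)
  ultimately show ?case by simp
qed

lemma dominated_ultrapoly:
  assumes F: "dominated m s R C F" and R: "R > 0" and s: "s \<ge> 1" and C: "C \<ge> 0"
    and M: "weight_seq M" "\<And>p. fact p \<le> E * L ^ p * M p"
      "if beur then wsubset M (\<lambda>p. fact p powr s) else wprec M (\<lambda>p. fact p powr s)"
  shows "scale_quant beur (\<lambda>\<mu>. \<exists>D. \<forall>n w. cmod (F n w) \<le> D * exp (assocf M (\<mu> * norm w)) * (1 / 2) ^ n)"
proof -
  have "scale_quant beur (\<lambda>\<mu>. \<exists>D\<ge>0. \<forall>t\<ge>0. \<forall>N.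
    (R * (1 + t)) ^ N / fact N powr s \<le> D * exp (assocf M (\<mu> * t)))"
    by (rule growth_le_assocf[OF M s R])
  then show ?thesis
  proof (rule scale_quant_mono)
    fix \<mu> :: real assume mu: "\<mu> > 0" and
      "\<exists>D\<ge>0. \<forall>t\<ge>0. \<forall>N. (R * (1 + t)) ^ N / fact N powr s \<le> D * exp (assocf M (\<mu> * t))"
    then obtain D where D: "D \<ge> 0"
      "\<And>t N. t \<ge> 0 \<Longrightarrow> (R * (1 + t)) ^ N / fact N powr s \<le> D * exp (assocf M (\<mu> * t))" by blast
    have "cmod (F n w) \<le> C * (1 + D) * exp (assocf M (\<mu> * norm w)) * (1 / 2) ^ n" for n w
    proof -
      let ?e = "exp (assocf M (\<mu> * norm w))"
      have e: "?e \<ge> 1"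
        using power_le_assocf(2)[OF M(1,2), of "\<mu> * norm w"] mu by simp
      have "(R * jbr w) ^ (n * m) / fact (n * m) powr s \<le> (R * (1 + norm w)) ^ (n * m) / fact (n * m) powr s"
        using jbr_le[of w] R by (intro divide_right_mono power_mono) auto
      also have "\<dots> \<le> D * ?e" by (rule D(2)) simp
      finally have "1 + (R * jbr w) ^ (n * m) / fact (n * m) powr s \<le> ?e + D * ?e"
        using e by linarith
      then have "C * (1 / 2) ^ n * (1 + (R * jbr w) ^ (n * m) / fact (n * m) powr s)
          \<le> C * (1 / 2) ^ n * (?e + D * ?e)"
        using C by (intro mult_left_mono) auto
      moreover have "cmod (F n w) \<le> C * (1 / 2) ^ n * (1 + (R * jbr w) ^ (n * m) / fact (n * m) powr s)"
        using dominatedD[OF F, of "[]" n w] by simp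
      ultimately show ?thesis by (simp add: algebra_simps)
    qed
    then show "\<exists>D. \<forall>n w. cmod (F n w) \<le> D * exp (assocf M (\<mu> * norm w)) * (1 / 2) ^ n" by blast
  qed
qed

lemma smooth_continuous: "smooth f \<Longrightarrow> continuous_on UNIV f"
  by (intro continuous_at_imp_continuous_on ballI differentiable_imp_continuous_within smooth_differentiable)

lemma suminf_diff_iter_pd:
  assumes F: "geom_bounded (\<lambda>n w. f n w / z n)" and G: "geom_bounded (\<lambda>n w. g n w / z n)"
    and f: "\<And>n. smooth (f n)" and g: "\<And>n. smooth (g n)"
  shows "iter_pd is (\<lambda>w. (\<Sum>n. f n w / z n) - (\<Sum>n. g n w / z n)) w
    = (\<Sum>n. iter_pd is (\<lambda>w. f n w - g n w) w / z n)"
proof -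
  have "iter_pd is (\<lambda>w. (\<Sum>n. f n w / z n) - (\<Sum>n. g n w / z n)) w
      = (\<Sum>n. iter_pd is (\<lambda>w. f n w / z n) w) - (\<Sum>n. iter_pd is (\<lambda>w. g n w / z n) w)"
    by (simp add: iter_pd_diff geom_bounded_smooth_suminf F G geom_bounded_iter_pd_suminf)
  also have "\<dots> = (\<Sum>n. iter_pd is (\<lambda>w. f n w / z n) w - iter_pd is (\<lambda>w. g n w / z n) w)"
    by (rule suminf_diff[OF geom_bounded_summable[OF F] geom_bounded_summable[OF G]])
  also have "\<dots> = (\<Sum>n. iter_pd is (\<lambda>w. f n w - g n w) w / z n)"
    by (simp add: iter_pd_divide iter_pd_diff f g diff_divide_distrib)
  finally show ?thesis .
qed

lemma jbr_fst_le: "jbr (fst w) \<le> jbr w" and jbr_snd_le: "jbr (snd w) \<le> jbr w"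
  for w :: "'a::real_normed_vector \<times> 'b::real_normed_vector"
  unfolding jbr_def using norm_fst_le[of "fst w" "snd w"] norm_snd_le[of "snd w" "fst w"]
  by (simp_all add: power_mono)

lemma jbr_ge_if_notin_Qset:
  assumes "w \<notin> Qset B"
  shows "B \<le> jbr w"
  using assms jbr_fst_le[of w] jbr_snd_le[of w] by (cases w) (auto simp: Qset_def not_less)

lemma Qset_mono: "B \<le> B' \<Longrightarrow> Qset B \<subseteq> Qset B'"
  by (auto simp: Qset_def)

context series_weights
begin

lemma iter_pd_suminf_divide:
  assumes "geom_bounded (\<lambda>n w. f n w / complex_of_real (Mh n))" "\<And>n. smooth (f n)"
  shows "iter_pd is (\<lambda>w. \<Sum>n. f n w / complex_of_real (Mh n)) w
    = (\<Sum>n. iter_pd is (f n) w / complex_of_real (Mh n))"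
  using assms by (simp add: geom_bounded_iter_pd_suminf iter_pd_divide)

lemma geom_bounded_power:
  assumes f: "smooth f" "\<And>w. maj w (1 / jbr w) m (K * jbr w ^ m) f" and K: "K \<ge> 1"
  shows "geom_bounded (\<lambda>n w. f w ^ n / complex_of_real (Mh n))"
  by (rule dominated_geom_bounded[OF dominated_power[OF assms]]) (use K C0 s in auto)

lemma geom_bounded_spoly:
  assumes f: "smooth f" "\<And>w. maj w (1 / jbr w) m (K * jbr w ^ m) f" and K: "K \<ge> 1"
  shows "geom_bounded (\<lambda>n w. spoly f n w / complex_of_real (Mh n))"
proof -
  obtain R C where R: "R > 0" and C: "C \<ge> 0"
    and d: "dominated m s R C (\<lambda>n w. spoly f n w / complex_of_real (Mh n))"
    using dominated_spoly[OF assms] by blast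
  show ?thesis by (rule dominated_geom_bounded[OF d less_imp_le[OF R] s C])
qed

text \<open>At a fixed point \<open>w\<close>, with \<open>c\<close> of order \<open>1 / \<langle>w\<rangle>\<close> and \<open>j * m\<close> of order \<open>\<langle>w\<rangle> powr (1 - \<rho>)\<close>,
  so that \<open>y\<close> is of order \<open>\<langle>w\<rangle> powr - \<rho>\<close>.\<close>
lemma relative_estimates_at:
  fixes f g :: "'d::finite phase \<Rightarrow> complex"
  assumes f: "smooth f" "\<And>w. maj w (1 / jbr w) m (K * jbr w ^ m) f"
    and g: "smooth g" "\<And>w. maj w (1 / jbr w) m (K * jbr w ^ m) g" and K: "K \<ge> 1"
    and rel: "maj w c m x f" "maj w c m (c * x) (\<lambda>w. g w - f w)"
    and c: "c \<ge> 0" and j: "j * m \<ge> 1"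
    and small: "2 * C0 * x * exp (2 * real m) \<le> real (j * m) powr (s * m)"
    and cJ: "c * real (j * m) \<le> 1" "sharp_const TYPE('d) m * (c * real (j * m))\<^sup>2 \<le> 1 / 2"
  defines "y \<equiv> c * real (j * m)"
    and "P \<equiv> (\<Sum>n. x ^ n / Mh n)"
    and "U \<equiv> (\<lambda>w. \<Sum>n. f w ^ n / complex_of_real (Mh n))"
    and "U' \<equiv> (\<lambda>w. \<Sum>n. g w ^ n / complex_of_real (Mh n))"
    and "V \<equiv> (\<lambda>w. \<Sum>n. spoly f n w / complex_of_real (Mh n))"
  shows "cmod (iter_pd is U w) \<le> 2 * y ^ length is * P"
    and "cmod (iter_pd is (\<lambda>w. U w - V w) w)
      \<le> 4 * exp 1 * sharp_const TYPE('d) m * y\<^sup>2 * y ^ length is * P"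
    and "cmod (iter_pd is (\<lambda>w. U' w - U w) w) \<le> 2 * exp 1 * y * y ^ length is * P"
proof -
  let ?t = "sharp_const TYPE('d) m" and ?J = "j * m" and ?k = "length is"
  have x: "x \<ge> 0" by (rule maj_nonneg[OF rel(1)])
  have y: "y \<ge> 0" using c by (simp add: y_def)
  have t: "?t \<ge> 1" by (rule sharp_const_ge_1)
  have ex: "\<exists>c\<ge>0. \<exists>b. maj w c m b f" for w
  proof (intro exI conjI)
    show "maj w (1 / jbr w) m (K * jbr w ^ m) f" by (rule f)
  qed simp
  note sum = spoly_sum[OF f(1) ex]
  have sm: "smooth (\<lambda>w. f w ^ n)" "smooth (\<lambda>w. g w ^ n)" "smooth (spoly f n)" for n
    unfolding sum by (intro smooth_power smooth_add smooth_sum smooth_spow f g)+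
  note gb = geom_bounded_power[OF f K] geom_bounded_power[OF g K] geom_bounded_spoly[OF f K]
  note est = suminf_iter_pd_le[OF _ _ _ j x c small, folded P_def]
  show "cmod (iter_pd is U w) \<le> 2 * y ^ ?k * P"
  proof -
    have "cmod (iter_pd is U w) \<le> c ^ ?k * (2 * real ?J ^ ?k * P)"
      unfolding U_def iter_pd_suminf_divide[OF gb(1) sm(1)]
    proof (rule est)
      show "cmod (iter_pd is (\<lambda>w. f w ^ n) w) \<le> x ^ n * (c ^ ?k * ff (n * m) ?k)" for n
        using majD[OF maj_power[OF f(1) rel(1) c]] by (simp only: mult.assoc)
      show "ff (n * m) ?k \<le> real ?J ^ ?k * tail_weight ?J (n * m)" for n
        by (rule ff_le_tail_weight[OF j])
    qed simp
    then show ?thesis by (simp only: y_def power_mult_distrib mult_ac)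
  qed
  show "cmod (iter_pd is (\<lambda>w. U w - V w) w) \<le> 4 * exp 1 * ?t * y\<^sup>2 * y ^ ?k * P"
  proof -
    let ?e = "c\<^sup>2 * ?t"
    have e: "?e * (real ?J)\<^sup>2 = ?t * y\<^sup>2"
      by (simp only: y_def power_mult_distrib mult_ac)
    have e0: "0 \<le> ?e" using t by simp
    have "cmod (iter_pd is (\<lambda>w. U w - V w) w) \<le> c ^ ?k * (2 * (2 * exp 1 * (?e * (real ?J)\<^sup>2) * real ?J ^ ?k) * P)"
      unfolding U_def V_def suminf_diff_iter_pd[OF gb(1) gb(3) sm(1,3)]
    proof (rule est)
      fix n
      have m: "maj w c (n * m - 2 * i) (x ^ n * ?e ^ i * spow_coef (n * m) i) (spow f n i)" for i
        by (rule maj_spow_all[OF f(1) rel(1) c])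
      have "iter_pd is (\<lambda>w. f w ^ n - spoly f n w) w = - (\<Sum>i=1..n * m. iter_pd is (spow f n i) w)"
        unfolding iter_pd_diff[OF sm(1,3)] unfolding sum
        by (simp add: iter_pd_add sm smooth_sum smooth_spow f iter_pd_sum)
      then have "cmod (iter_pd is (\<lambda>w. f w ^ n - spoly f n w) w)
          \<le> (\<Sum>i=1..n * m. x ^ n * ?e ^ i * spow_coef (n * m) i * c ^ ?k * ff (n * m - 2 * i) ?k)"
        unfolding norm_minus_cancel by (simp only: norm_minus_cancel) (rule sum_norm_le, rule majD[OF m])
      also have "\<dots> = x ^ n * (c ^ ?k * (\<Sum>i=1..n * m. ?e ^ i * (spow_coef (n * m) i * ff (n * m - 2 * i) ?k)))"
        unfolding sum_distrib_left by (intro sum.cong refl) (simp only: mult_ac)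
      finally show "cmod (iter_pd is (\<lambda>w. f w ^ n - spoly f n w) w)
        \<le> x ^ n * (c ^ ?k * (\<Sum>i=1..n * m. ?e ^ i * (spow_coef (n * m) i * ff (n * m - 2 * i) ?k)))" .
      show "0 \<le> (\<Sum>i=1..n * m. ?e ^ i * (spow_coef (n * m) i * ff (n * m - 2 * i) ?k))"
        by (intro sum_nonneg mult_nonneg_nonneg zero_le_power e0) auto
      show "(\<Sum>i=1..n * m. ?e ^ i * (spow_coef (n * m) i * ff (n * m - 2 * i) ?k))
        \<le> 2 * exp 1 * (?e * (real ?J)\<^sup>2) * real ?J ^ ?k * tail_weight ?J (n * m)"
        by (rule sum_spow_coef_le[OF j e0]) (use cJ(2) in \<open>simp only: e y_def\<close>)
    qed
    also have "\<dots> = 4 * exp 1 * ?t * y\<^sup>2 * y ^ ?k * P"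
      unfolding e by (simp add: y_def power_mult_distrib mult_ac)
    finally show ?thesis .
  qed
  show "cmod (iter_pd is (\<lambda>w. U' w - U w) w) \<le> 2 * exp 1 * y * y ^ ?k * P"
  proof -
    \<comment> \<open>The two lemmas on perturbed powers are applied with
      \<open>\<theta> = c\<close>, which has to be at most 1.\<close>
    have "c * 1 \<le> c * real ?J" using j c by (intro mult_left_mono) (simp_all del: of_nat_mult)
    then have c1: "c \<le> 1" using cJ(1) by linarith
    have "cmod (iter_pd is (\<lambda>w. U' w - U w) w) \<le> c ^ ?k * (2 * (exp 1 * (c * real ?J) * real ?J ^ ?k) * P)"
      unfolding U_def U'_def suminf_diff_iter_pd[OF gb(2) gb(1) sm(2,1)]
    proof (rule est)
      fix n
      have "maj w c (n * m) (x ^ n * ((1 + c) ^ n - 1)) (\<lambda>w. g w ^ n - f w ^ n)"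
        by (rule maj_power_diff[OF f(1) rel(1) g(1) rel(2) c c])
      from majD[OF this] show "cmod (iter_pd is (\<lambda>w. g w ^ n - f w ^ n) w)
          \<le> x ^ n * (c ^ ?k * (((1 + c) ^ n - 1) * ff (n * m) ?k))"
        by (simp only: mult_ac)
      show "0 \<le> ((1 + c) ^ n - 1) * ff (n * m) ?k"
        using c one_le_power[of "1 + c" n] by simp
      show "((1 + c) ^ n - 1) * ff (n * m) ?k \<le> exp 1 * (c * real ?J) * real ?J ^ ?k * tail_weight ?J (n * m)"
        by (rule perturb_le_tail_weight[OF j c c1 cJ(1) n_le])
    qed
    then show ?thesis by (simp add: y_def power_mult_distrib mult_ac)
  qed
qed

lemma relative_estimates:
  fixes a a' :: "'d::finite phase \<Rightarrow> real" and f g U U' V :: "'d phase \<Rightarrow> complex" and P :: "real \<Rightarrow> real"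
  assumes f_def: "f = (\<lambda>w. complex_of_real (a w))" and g_def: "g = (\<lambda>w. complex_of_real (a' w))"
    and P_def: "P = (\<lambda>t. \<Sum>n. t ^ n / Mh n)"
    and U_def: "U = (\<lambda>w. \<Sum>n. f w ^ n / complex_of_real (Mh n))"
    and U'_def: "U' = (\<lambda>w. \<Sum>n. g w ^ n / complex_of_real (Mh n))"
    and V_def: "V = (\<lambda>w. \<Sum>n. spoly f n w / complex_of_real (Mh n))"
    and f: "smooth f" "\<And>w. maj w (1 / jbr w) m (K * jbr w ^ m) f"
    and g: "smooth g" "\<And>w. maj w (1 / jbr w) m (K * jbr w ^ m) g" and K: "K \<ge> 1"
    and fg: "\<And>w. maj w (1 / jbr w) m (K * jbr w ^ m / jbr w) (\<lambda>w. g w - f w)"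
    and low: "\<kappa> > 0" "\<And>w. w \<notin> Qset B0 \<Longrightarrow> a w \<ge> \<kappa> * jbr w ^ m"
    and \<rho>: "0 < \<rho>" "\<rho> < 1" "s * (1 - \<rho>) \<ge> 1"
  obtains E B where "E \<ge> 1" "B \<ge> 1"
    "\<And>w. w \<notin> Qset B \<Longrightarrow> a w > 0 \<and> a' w > 0 \<and> E * jbr w powr (- \<rho>) \<le> 1 / 2"
    "\<And>w is. w \<notin> Qset B \<Longrightarrow>
      cmod (iter_pd is U w) \<le> E ^ (length is + 1) * (jbr w powr (- \<rho>)) ^ length is * P (a w)"
    "\<And>w is. w \<notin> Qset B \<Longrightarrow>
      cmod (iter_pd is (\<lambda>w. U w - V w) w) \<le> E ^ (length is + 1) * (jbr w powr (- \<rho>)) ^ (length is + 2) * P (a w)"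
    "\<And>w is. w \<notin> Qset B \<Longrightarrow>
      cmod (iter_pd is (\<lambda>w. U' w - U w) w) \<le> E ^ (length is + 1) * (jbr w powr (- \<rho>)) ^ (length is + 1) * P (a w)"
proof -
  let ?t = "sharp_const TYPE('d) m"
  obtain \<Lambda> where \<Lambda>: "\<Lambda> \<ge> 1"
    "\<And>x. x \<ge> 1 \<Longrightarrow> \<exists>j. j * m \<ge> 1 \<and> real (j * m) \<le> \<Lambda> * x powr (1 - \<rho>) \<and>
       2 * C0 * (K * x ^ m) * exp (2 * real m) \<le> real (j * m) powr (s * m)"
    by (rule choose_cutoff[OF m C0 _ \<rho>(2,3) s, of K]) (use K in auto)
  \<comment> \<open>\<open>C\<close> turns the upper bound \<open>K * jbr w ^ m\<close> into
    \<open>C * a w\<close>; \<open>W\<close> is the constant in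
    \<open>c * (j * m) \<le> W * jbr w powr (- \<rho>)\<close>; \<open>E\<close> covers the factors
    of all three estimates; \<open>B\<close> makes \<open>E * jbr w powr (- \<rho>)\<close> at most
    1/2.\<close>
  define C where "C = max 1 (K / \<kappa>)"
  define W where "W = C * \<Lambda>"
  define E where "E = 4 * exp 1 * ?t * W\<^sup>2"
  define B where "B = max (max 1 B0) ((2 * E) powr (1 / \<rho>))"
  have t: "?t \<ge> 1" by (rule sharp_const_ge_1)
  have C: "C \<ge> 1" "K \<le> C * \<kappa>"
    using low(1) by (simp_all add: C_def max_def field_simps)
  have W: "W \<ge> 1" using C(1) \<Lambda>(1) mult_mono[of 1 C 1 \<Lambda>] by (simp add: W_def)
  have W2: "W \<le> W\<^sup>2" using W by (simp add: power2_eq_square)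
  have e1: "(2 :: real) \<le> exp 1" using exp_ge_add_one_self[of 1] by simp
  have tW: "W\<^sup>2 \<le> ?t * W\<^sup>2" using mult_right_mono[OF t, of "W\<^sup>2"] by simp
  have E0: "4 * exp 1 * W\<^sup>2 \<le> E"
    using mult_left_mono[OF tW, of "4 * exp 1"] by (simp add: E_def mult_ac)
  have eW: "exp 1 * W \<le> exp 1 * W\<^sup>2" using W2 by simp
  have W1: "2 * W \<le> exp 1 * W" using W e1 by (intro mult_right_mono) auto
  have "E \<ge> 2 * exp 1 * W" using E0 eW W1 W by linarith
  moreover have "E \<ge> W" using E0 eW W1 W by linarith
  moreover have "E \<ge> 2" using E0 eW W1 W by linarith
  ultimately have E: "E \<ge> 2 * exp 1 * W" "E \<ge> W" "E \<ge> 2" by simp_all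
  have core: "a w > 0 \<and> a' w > 0 \<and> E * jbr w powr (- \<rho>) \<le> 1 / 2 \<and>
      cmod (iter_pd is U w) \<le> E ^ (length is + 1) * (jbr w powr (- \<rho>)) ^ length is * P (a w) \<and>
      cmod (iter_pd is (\<lambda>w. U w - V w) w) \<le> E ^ (length is + 1) * (jbr w powr (- \<rho>)) ^ (length is + 2) * P (a w) \<and>
      cmod (iter_pd is (\<lambda>w. U' w - U w) w) \<le> E ^ (length is + 1) * (jbr w powr (- \<rho>)) ^ (length is + 1) * P (a w)"
    if w: "w \<notin> Qset B" for w "is"
  proof -
    define z where "z = jbr w powr (- \<rho>)"
    define c where "c = C / jbr w"
    have jB: "jbr w \<ge> B" by (rule jbr_ge_if_notin_Qset[OF w])
    have "B0 \<le> B" by (simp add: B_def)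
    then have "w \<notin> Qset B0" using w Qset_mono by blast
    then have low': "a w \<ge> \<kappa> * jbr w ^ m" by (rule low(2))
    have ap: "a w > 0" using less_le_trans[OF mult_pos_pos[OF low(1) zero_less_power[OF jbr_pos]] low'] .
    have "2 * E = ((2 * E) powr (1 / \<rho>)) powr \<rho>"
      using E(3) \<rho>(1) by (simp add: powr_powr)
    also have "\<dots> \<le> jbr w powr \<rho>"
      using jB \<rho>(1) by (intro powr_mono2) (auto simp: B_def)
    finally have Ez: "E * z \<le> 1 / 2"
      by (simp add: z_def powr_minus field_simps)
    have z0: "z > 0" by (simp add: z_def)
    have z1: "z \<le> 1" using Ez mult_right_mono[OF E(3) less_imp_le[OF z0]] by linarith
    have c0: "c \<ge> 0" using C by (simp add: c_def)
    have KC: "K * jbr w ^ m \<le> C * a w"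
    proof -
      have "K * jbr w ^ m \<le> (C * \<kappa>) * jbr w ^ m" using C(2) by (intro mult_right_mono) auto
      also have "\<dots> \<le> C * a w"
        using mult_left_mono[OF low', of C] C(1) by (simp add: mult.assoc)
      finally show ?thesis .
    qed
    \<comment> \<open>At order 0 no constant may stand before \<open>a w\<close>, since the
      \<open>n\<close>-th power is summed. From order 1 on, \<open>C \<le> C ^ k\<close> moves the
      constant into \<open>c = C / jbr w\<close>.\<close>
    have rel1: "maj w c m (a w) f"
      unfolding maj_def
    proof
      fix js :: "('d + 'd) list"
      show "cmod (iter_pd js f w) \<le> a w * c ^ length js * ff m (length js)"
      proof (cases "js = []")
        case True
        then show ?thesis using ap by (simp add: f_def)
      next
        case False
        have "C * 1 \<le> C ^ length js"
          using False C(1) by (cases js) (auto intro!: mult_left_mono one_le_power)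
        then have "C * a w \<le> C ^ length js * a w" using ap by (intro mult_right_mono) auto
        with KC have "K * jbr w ^ m \<le> C ^ length js * a w" by linarith
        then have "K * jbr w ^ m * ((1 / jbr w) ^ length js * ff m (length js))
            \<le> C ^ length js * a w * ((1 / jbr w) ^ length js * ff m (length js))"
          by (intro mult_right_mono mult_nonneg_nonneg) auto
        also have "\<dots> = a w * c ^ length js * ff m (length js)"
          by (simp add: c_def power_divide)
        finally show ?thesis
          using majD[OF f(2)[of w], of js] by (simp only: mult.assoc)
      qed
    qed
    have "K * jbr w ^ m / jbr w \<le> C * a w / jbr w"
      using KC by (intro divide_right_mono) auto
    then have "K * jbr w ^ m / jbr w \<le> c * a w" by (simp add: c_def)
    moreover have "1 / jbr w \<le> c" using C(1) by (simp add: c_def divide_right_mono)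
    ultimately have rel2: "maj w c m (c * a w) (\<lambda>w. g w - f w)"
      by (intro maj_mono[OF fg]) auto
    obtain j where j: "j * m \<ge> 1" "real (j * m) \<le> \<Lambda> * jbr w powr (1 - \<rho>)"
       "2 * C0 * (K * jbr w ^ m) * exp (2 * real m) \<le> real (j * m) powr (s * m)"
      using \<Lambda>(2)[of "jbr w"] by auto
    define y where "y = c * real (j * m)"
    have "y \<le> c * (\<Lambda> * jbr w powr (1 - \<rho>))"
      unfolding y_def using j(2) c0 by (rule mult_left_mono)
    also have "\<dots> = W * (jbr w powr (1 - \<rho>) / jbr w powr 1)"
      by (simp add: c_def W_def)
    also have "\<dots> = W * z"
      unfolding z_def powr_diff[symmetric] by simp
    finally have yW: "y \<le> W * z" .
    have y0: "y \<ge> 0" using c0 by (simp add: y_def)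
    have Wz: "W * z \<le> 1 / 2" using mult_right_mono[OF E(2) less_imp_le[OF z0]] Ez by linarith
    have y1: "y \<le> 1" using yW Wz by linarith
    have ty: "?t * y\<^sup>2 \<le> ?t * W\<^sup>2 * z\<^sup>2"
      using mult_left_mono[OF power_mono[OF yW y0, of 2], of ?t] t by (simp add: power_mult_distrib mult_ac)
    have ty1: "?t * y\<^sup>2 \<le> 1 / 2"
    proof -
      have "?t * W\<^sup>2 * z\<^sup>2 \<le> E * z\<^sup>2"
        using mult_right_mono[of 1 "4 * exp 1 :: real" "?t * W\<^sup>2"] e1 t
        by (intro mult_right_mono) (auto simp: E_def mult_ac)
      also have "\<dots> = (E * z) * z" by (simp add: power2_eq_square)
      also have "\<dots> \<le> (1 / 2) * 1" using Ez z0 z1 by (intro mult_mono) auto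
      finally show ?thesis using ty by linarith
    qed
    have small: "2 * C0 * a w * exp (2 * real m) \<le> real (j * m) powr (s * m)"
    proof -
      have "a w \<le> K * jbr w ^ m"
        using majD[OF f(2)[of w], of "[]"] ap by (simp add: f_def)
      then have "2 * C0 * a w * exp (2 * real m) \<le> 2 * C0 * (K * jbr w ^ m) * exp (2 * real m)"
        using C0 by (intro mult_right_mono mult_left_mono) auto
      with j(3) show ?thesis by linarith
    qed
    have Pa: "P (a w) = (\<Sum>n. a w ^ n / Mh n)" by (simp add: P_def)
    note est = relative_estimates_at[OF f g K rel1 rel2 c0 j(1) small, folded y_def, OF y1 ty1,
        of "is", folded Pa]
    let ?k = "length is"
    have P0: "P (a w) \<ge> 0"
      using power_series_ge_1[of "a w"] ap by (simp add: P_def)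
    have yk: "y ^ ?k \<le> E ^ ?k * z ^ ?k"
    proof -
      have "y \<le> E * z" using yW mult_right_mono[OF E(2) less_imp_le[OF z0]] by linarith
      then show ?thesis using power_mono[OF _ y0, of "E * z" ?k] by (simp add: power_mult_distrib)
    qed
    have gen: "X * y ^ ?k * P (a w) \<le> E ^ (?k + 1) * z ^ (?k + i) * P (a w)"
      if "0 \<le> X" "X \<le> E * z ^ i" for X i
    proof -
      have "X * y ^ ?k \<le> (E * z ^ i) * (E ^ ?k * z ^ ?k)"
        using that yk y0 E z0 by (intro mult_mono) auto
      also have "\<dots> = E ^ (?k + 1) * z ^ (?k + i)" by (simp add: power_add mult_ac)
      finally show ?thesis using P0 by (rule mult_right_mono)
    qed
    have "cmod (iter_pd is U w) \<le> E ^ (?k + 1) * z ^ (?k + 0) * P (a w)"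
      unfolding U_def by (rule order_trans[OF est(1) gen]) (use E(3) in simp_all)
    moreover have "cmod (iter_pd is (\<lambda>w. U w - V w) w) \<le> E ^ (?k + 1) * z ^ (?k + 2) * P (a w)"
    proof -
      have "4 * exp 1 * ?t * y\<^sup>2 \<le> E * z ^ 2"
        using mult_left_mono[OF ty, of "4 * exp 1"] by (simp add: E_def mult_ac)
      moreover have "0 \<le> 4 * exp 1 * ?t * y\<^sup>2" using t by simp
      ultimately show ?thesis
        unfolding U_def V_def by (intro order_trans[OF est(2) gen])
    qed
    moreover have "cmod (iter_pd is (\<lambda>w. U' w - U w) w) \<le> E ^ (?k + 1) * z ^ (?k + 1) * P (a w)"
    proof -
      have "2 * exp 1 * y \<le> 2 * exp 1 * (W * z)" using yW by (intro mult_left_mono) auto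
      also have "\<dots> \<le> E * z ^ 1" using mult_right_mono[OF E(1) less_imp_le[OF z0]] by (simp only: mult.assoc power_one_right)
      finally have "2 * exp 1 * y \<le> E * z ^ 1" .
      moreover have "0 \<le> 2 * exp 1 * y" using y0 by simp
      ultimately show ?thesis
        unfolding U_def U'_def by (intro order_trans[OF est(3) gen])
    qed
    \<comment> \<open>The relative error of \<open>a'\<close> is at most \<open>c\<close>, and
      \<open>c \<le> c * (j * m) \<le> 1 / 2\<close>.\<close>
    moreover have "a' w > 0"
    proof -
      have "1 * 1 \<le> real (j * m)" using j(1) by (simp del: of_nat_mult)
      then have "c * 1 \<le> y" unfolding y_def using c0 by (intro mult_left_mono) auto
      then have "c \<le> 1 / 2" using yW Wz by linarith
      then have "c * a w \<le> 1 / 2 * a w" using ap by (intro mult_right_mono) auto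
      moreover have "\<bar>a' w - a w\<bar> \<le> c * a w"
        using majD[OF rel2, of "[]"] by (simp add: f_def g_def flip: of_real_diff)
      ultimately show ?thesis using ap by linarith
    qed
    ultimately show ?thesis using ap Ez by (simp add: z_def)
  qed
  show thesis
    by (rule that[of E B]) (use core E in \<open>auto simp: B_def\<close>)
qed

end

section \<open>Elliptic Shubin polynomials\<close>

lemma coord_scaleR: "coord (t *\<^sub>R w) i = t * coord w i"
  by (simp add: coord_def split: sum.split)

lemma monom_scaleR: "Defs.monom \<gamma> (t *\<^sub>R w) = t ^ mlen \<gamma> * Defs.monom \<gamma> w"
  by (simp add: Defs.monom_def coord_scaleR power_mult_distrib prod.distrib mlen_def power_sum)

lemma principal_scaleR: "principal m c (t *\<^sub>R w) = t ^ m * principal m c w"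
  by (simp add: principal_def monom_scaleR sum_distrib_left mult_ac)

lemma smooth_of_real_continuous:
  assumes "smooth (\<lambda>w. complex_of_real (a w))"
  shows "continuous_on UNIV a"
  using continuous_on_Re[OF smooth_continuous[OF assms]] by simp

lemma finite_mlen_eq [simp]: "finite {\<gamma> :: 'i::finite \<Rightarrow> nat. mlen \<gamma> = m}"
  by (rule finite_subset[OF _ finite_mlen_le[of m]]) auto

lemma finite_mlen_less [simp]: "finite {\<gamma> :: 'i::finite \<Rightarrow> nat. mlen \<gamma> < m}"
  by (rule finite_subset[OF _ finite_mlen_le[of m]]) auto

lemma polyval_minus_principal:
  "principal m c w - polyval m c w = (\<Sum>\<gamma>\<in>{\<gamma>. mlen \<gamma> < m}. - c \<gamma> * Defs.monom \<gamma> w)"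
proof -
  have "polyval m c w = (\<Sum>\<gamma>\<in>{\<gamma>. mlen \<gamma> = m} \<union> {\<gamma>. mlen \<gamma> < m}. c \<gamma> * Defs.monom \<gamma> w)"
    unfolding polyval_def by (rule sum.cong) auto
  also have "\<dots> = principal m c w + (\<Sum>\<gamma>\<in>{\<gamma>. mlen \<gamma> < m}. c \<gamma> * Defs.monom \<gamma> w)"
    unfolding principal_def by (rule sum.union_disjoint) auto
  finally show ?thesis by (simp add: sum_negf)
qed

text \<open>Homogeneity reduces the bound to the unit sphere, where compactness gives a positive
  minimum.\<close>

lemma elliptic_lower_bound:
  fixes c :: "('d::finite + 'd \<Rightarrow> nat) \<Rightarrow> real"
  assumes "elliptic_shubin m c" "m \<ge> 1"
  obtains \<kappa> where "\<kappa> > 0" "\<And>w. \<kappa> * norm w ^ m \<le> \<bar>principal m c w\<bar>"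
proof -
  let ?S = "sphere (0 :: 'd phase) 1"
  have "smooth (\<lambda>w. complex_of_real (principal m c w))"
    unfolding principal_def by (rule poly_smooth)
  then have "continuous_on UNIV (principal m c)" by (rule smooth_of_real_continuous)
  then have cont: "continuous_on ?S (\<lambda>w. \<bar>principal m c w\<bar>)"
    by (intro continuous_intros) (rule continuous_on_subset, auto)
  have "cvec (Inl undefined) \<in> ?S" by (simp add: cvec_def norm_Pair)
  then have "?S \<noteq> {}" by blast
  from continuous_attains_inf[OF compact_sphere this cont]
  obtain w0 where w0: "w0 \<in> ?S" "\<And>w. w \<in> ?S \<Longrightarrow> \<bar>principal m c w0\<bar> \<le> \<bar>principal m c w\<bar>" by blast
  have "w0 \<noteq> 0" using w0(1) by auto
  then have "principal m c w0 \<noteq> 0"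
    using assms(1) unfolding elliptic_shubin_def by blast
  then have pos: "\<bar>principal m c w0\<bar> > 0" by simp
  have "\<bar>principal m c w0\<bar> * norm w ^ m \<le> \<bar>principal m c w\<bar>" for w
  proof (cases "w = 0")
    case True
    then show ?thesis using assms(2) by (simp add: zero_power)
  next
    case False
    let ?u = "w /\<^sub>R norm w"
    have "w = norm w *\<^sub>R ?u" using False by simp
    then have "\<bar>principal m c w\<bar> = norm w ^ m * \<bar>principal m c ?u\<bar>"
      by (metis abs_mult abs_norm_cancel power_abs principal_scaleR)
    moreover have "\<bar>principal m c w0\<bar> \<le> \<bar>principal m c ?u\<bar>"
      using False by (intro w0(2)) simp
    ultimately show ?thesis by (simp add: mult.commute mult_left_mono)
  qed
  with pos show thesis by (rule that)
qed

text \<open>Far out \<open>norm w \<ge> jbr w / 2\<close>, which costs \<open>2 ^ m\<close>, and the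
  lower-order part, smaller by \<open>1 / jbr w\<close>, takes at most half of what remains.
  Positivity of the polynomial then decides the sign.\<close>

lemma polyval_lower_bound:
  fixes c :: "('d::finite + 'd \<Rightarrow> nat) \<Rightarrow> real"
  assumes ell: "elliptic_shubin m c" and m: "m \<ge> 1"
    and pos: "\<And>w. w \<notin> Qset B1 \<Longrightarrow> polyval m c w > 0"
    and diff: "\<And>w. \<bar>principal m c w - polyval m c w\<bar> \<le> K * jbr w ^ m / jbr w"
  obtains \<kappa> B0 where "\<kappa> > 0" "\<And>w. w \<notin> Qset B0 \<Longrightarrow> polyval m c w \<ge> \<kappa> * jbr w ^ m"
proof -
  obtain \<kappa>0 where k0: "\<kappa>0 > 0" "\<And>w. \<kappa>0 * norm w ^ m \<le> \<bar>principal m c w\<bar>"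
    using elliptic_lower_bound[OF ell m] by metis
  define \<kappa> where "\<kappa> = \<kappa>0 / 2 ^ m / 2"
  have k: "\<kappa> > 0" using k0(1) by (simp add: \<kappa>_def)
  define B0 where "B0 = max B1 (max 2 (K / \<kappa>))"
  show thesis
  proof (rule that[of \<kappa> B0])
    show "\<kappa> > 0" by (rule k)
    fix w :: "'d phase" assume w: "w \<notin> Qset B0"
    have "B1 \<le> B0" by (simp add: B0_def)
    then have "w \<notin> Qset B1" using w Qset_mono by blast
    then have p: "polyval m c w > 0" by (rule pos)
    have jB: "B0 \<le> jbr w" by (rule jbr_ge_if_notin_Qset[OF w])
    then have j: "2 \<le> jbr w" "K / \<kappa> \<le> jbr w" by (simp_all add: B0_def)
    have "jbr w / 2 \<le> norm w" using jbr_le[of w] j(1) by simp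
    then have "(jbr w / 2) ^ m \<le> norm w ^ m" by (intro power_mono) auto
    then have "\<kappa>0 * (jbr w / 2) ^ m \<le> \<bar>principal m c w\<bar>"
      using k0 by (meson mult_left_mono less_imp_le order_trans)
    then have "2 * \<kappa> * jbr w ^ m \<le> \<bar>principal m c w\<bar>"
      by (simp add: \<kappa>_def power_divide)
    moreover have "K * jbr w ^ m / jbr w \<le> \<kappa> * jbr w ^ m"
    proof -
      have "K \<le> \<kappa> * jbr w" using j(2) k by (simp add: pos_divide_le_eq mult.commute)
      then have "K * jbr w ^ m \<le> \<kappa> * jbr w * jbr w ^ m" by (intro mult_right_mono) auto
      then show ?thesis by (simp add: pos_divide_le_eq mult_ac)
    qed
    ultimately show "polyval m c w \<ge> \<kappa> * jbr w ^ m"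
      using diff[of w] p by linarith
  qed
qed

lemma (in series_weights) continuous_ultrapoly_series:
  fixes a :: "'d::finite phase \<Rightarrow> real"
  assumes a: "smooth (\<lambda>w. complex_of_real (a w))"
      "\<And>w. maj w (1 / jbr w) m (K * jbr w ^ m) (\<lambda>w. complex_of_real (a w))" and K: "K \<ge> 1"
    and M: "weight_seq M" "\<And>p. fact p \<le> E * L ^ p * M p"
      "if beur then wsubset M (\<lambda>p. fact p powr s) else wprec M (\<lambda>p. fact p powr s)"
  shows "continuous_on UNIV (\<lambda>w. \<Sum>n. \<bar>a w\<bar> ^ n / Mh n) \<and>
    ultrapoly_growth beur M (\<lambda>w. \<Sum>n. \<bar>a w\<bar> ^ n / Mh n)"
proof
  let ?f = "\<lambda>w. \<Sum>n. \<bar>a w\<bar> ^ n / Mh n"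
  have "continuous_on UNIV (\<lambda>w. \<bar>a w\<bar>)"
    by (intro continuous_intros smooth_of_real_continuous a)
  then show cont: "continuous_on UNIV ?f"
    by (rule continuous_on_compose2[OF continuous_power_series]) simp
  have "scale_quant beur (\<lambda>\<mu>. \<exists>D. \<forall>n w. cmod (complex_of_real (a w) ^ n / complex_of_real (Mh n))
      \<le> D * exp (assocf M (\<mu> * norm w)) * (1 / 2) ^ n)"
    by (rule dominated_ultrapoly[OF dominated_power[OF a K] _ s _ M]) (use K C0 in auto)
  then have "scale_quant beur (\<lambda>\<mu>. \<exists>D. \<forall>w. \<bar>?f w\<bar> \<le> D * exp (assocf M (\<mu> * norm w)))"
  proof (rule scale_quant_mono)
    fix \<mu> :: real
    assume "\<exists>D. \<forall>n w. cmod (complex_of_real (a w) ^ n / complex_of_real (Mh n))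
      \<le> D * exp (assocf M (\<mu> * norm w)) * (1 / 2) ^ n"
    then obtain D where D: "\<And>n w. cmod (complex_of_real (a w) ^ n / complex_of_real (Mh n))
      \<le> D * exp (assocf M (\<mu> * norm w)) * (1 / 2) ^ n" by blast
    have "\<bar>?f w\<bar> \<le> 2 * D * exp (assocf M (\<mu> * norm w))" for w
    proof -
      have "norm (\<bar>a w\<bar> ^ n / Mh n) \<le> D * exp (assocf M (\<mu> * norm w)) * (1 / 2) ^ n" for n
        using D[of w n] by (simp add: norm_divide norm_power power_abs)
      from geometric_bound_suminf(2)[OF this] show ?thesis by simp
    qed
    then show "\<exists>D. \<forall>w. \<bar>?f w\<bar> \<le> D * exp (assocf M (\<mu> * norm w))" by blast
  qed
  moreover have "?f \<in> borel_measurable borel"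
    by (rule borel_measurable_continuous_onI[OF cont])
  ultimately show "ultrapoly_growth beur M ?f"
    unfolding ultrapoly_growth_def scale_quant_def by simp
qed

lemma Dw_norm:
  obtains "is" where "length is = mlen \<gamma>" "\<And>f w. Dw \<gamma> f w = (- \<i>) ^ mlen \<gamma> * iter_pd is f w"
    "\<And>f w. cmod (Dw \<gamma> f w) = cmod (iter_pd is f w)"
proof -
  obtain "is" where L: "length is = mlen \<gamma>" "\<And>f. dpow \<gamma> f = iter_pd is f"
    by (rule dpow_iter_pd[of \<gamma>]) (rule that)
  show thesis
    by (rule that[of "is"]) (simp_all add: L Dw_def norm_mult norm_power)
qed

lemma smooth_spoly:
  fixes a :: "'d::finite phase \<Rightarrow> complex"
  assumes "smooth a" "\<And>w. \<exists>c\<ge>0. \<exists>b. maj w c m b a"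
  shows "smooth (spoly a n)"
  unfolding spoly_sum[OF assms] by (intro smooth_add smooth_power smooth_sum smooth_spow assms)

lemma powr_minus_power: "x > 0 \<Longrightarrow> (x powr (- \<rho>)) ^ k = 1 / x powr (\<rho> * real k)"
  by (simp add: powr_minus powr_powr power_inverse divide_inverse flip: powr_realpow)

lemma suminf_GammaI:
  assumes A: "weight_seq A" "M3' A" "M4 A" and r: "r \<le> 1" and F: "geom_bounded F"
    and D: "scale_quant beur (\<lambda>\<mu>. \<exists>D. \<forall>n. gamma_bound M \<mu> (D * (1 / 2) ^ n) (F n))"
  shows "(\<lambda>w. \<Sum>n. F n w) \<in> Gamma beur A M r"
proof (rule GammaI[OF A r scale_quant_mono[OF D]])
  fix \<mu> assume "\<exists>D. \<forall>n. gamma_bound M \<mu> (D * (1 / 2) ^ n) (F n)"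
  then show "\<exists>D. gamma_bound M \<mu> D (\<lambda>w. \<Sum>n. F n w)"
    using gamma_bound_suminf[OF F] by blast
qed

theorem theorem3p6:
  fixes beur :: bool and A M :: "nat \<Rightarrow> real" and \<rho> s :: real
    and m :: nat and c :: "('d::finite + 'd \<Rightarrow> nat) \<Rightarrow> real"
    and B1 C0 :: real and Mh :: "nat \<Rightarrow> real"
  defines "a \<equiv> polyval m c" and "a' \<equiv> principal m c"
    and "P \<equiv> (\<lambda>t::real. \<Sum>n. t ^ n / Mh n)"
  assumes wA: "weight_seq A" "A 1 = 1" "M1 A" "M2 A" "M3' A" "M4 A"
    and wM: "weight_seq M" "M 1 = 1" "M1 M" "M2 M" "M3 M"
    and AM: "wsubset A M"
    and rho: "rho_admissible A M \<rho>" "\<rho> < 1"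
    and deg: "m \<ge> 2" "\<forall>\<gamma>. mlen \<gamma> > m \<longrightarrow> c \<gamma> = 0"
    and ell: "elliptic_shubin m c"
    and B1: "B1 \<ge> 1" "\<forall>w. w \<notin> Qset B1 \<longrightarrow> a w > 0"
    and s: "s > 1 / (1 - \<rho>)"
      "if beur then wsubset M (\<lambda>p. fact p powr s) else wprec M (\<lambda>p. fact p powr s)"
    and Mh: "\<forall>n. Mh n > 0" "Mh 0 = 1" "C0 \<ge> 1"
      "\<forall>n k. k \<le> n \<longrightarrow> C0 ^ (n - k) * Mh n / fact (n * m) powr s \<ge> Mh k / fact (k * m) powr s"
  shows
    \<comment> \<open>(i)\<close>
    "continuous_on UNIV (\<lambda>w. P \<bar>a w\<bar>) \<and> ultrapoly_growth beur M (\<lambda>w. P \<bar>a w\<bar>) \<and>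
     continuous_on UNIV (\<lambda>w. P \<bar>a' w\<bar>) \<and> ultrapoly_growth beur M (\<lambda>w. P \<bar>a' w\<bar>)
     \<comment> \<open>(ii)\<close>
     \<and> abs_conv_Gamma beur A M 1 (\<lambda>n w. spoly (\<lambda>w. complex_of_real (a w)) n w / complex_of_real (Mh n))
     \<and> abs_conv_Gamma beur A M 1 (\<lambda>n w. complex_of_real (a w ^ n / Mh n))
     \<and> abs_conv_Gamma beur A M 1 (\<lambda>n w. complex_of_real (a' w ^ n / Mh n))
     \<comment> \<open>(iii)\<close>
     \<and> (\<exists>C>1. \<exists>B>0. \<forall>w \<gamma>. w \<notin> Qset B \<longrightarrow>
          cmod (\<Sum>n. Dw \<gamma> (spoly (\<lambda>w. complex_of_real (a w)) n) w / complex_of_real (Mh n))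
            \<le> C ^ (mlen \<gamma> + 1) * P (a w) / jbr w powr (\<rho> * real (mlen \<gamma>))
        \<and> cmod (Dw \<gamma> (\<lambda>w. complex_of_real (P (a w))) w)
            \<le> C ^ (mlen \<gamma> + 1) * P (a w) / jbr w powr (\<rho> * real (mlen \<gamma>))
        \<and> cmod (Dw \<gamma> (\<lambda>w. complex_of_real (P (a w))
                 - (\<Sum>n. spoly (\<lambda>w. complex_of_real (a w)) n w / complex_of_real (Mh n))) w)
            \<le> C ^ (mlen \<gamma> + 1) * P (a w) / jbr w powr (\<rho> * real (mlen \<gamma> + 2)))
     \<and> hypoelliptic beur A M \<rho> (\<lambda>w. \<Sum>n. spoly (\<lambda>w. complex_of_real (a w)) n w / complex_of_real (Mh n))
     \<and> hypoelliptic beur A M \<rho> (\<lambda>w. complex_of_real (P (a w)))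
     \<comment> \<open>(iv)\<close>
     \<and> (\<exists>C>1. \<exists>B>0. \<forall>w \<gamma>. w \<notin> Qset B \<longrightarrow>
          cmod (Dw \<gamma> (\<lambda>w. complex_of_real (P (a' w))) w)
            \<le> C ^ (mlen \<gamma> + 1) * P (a' w) / jbr w powr (\<rho> * real (mlen \<gamma>))
        \<and> cmod (Dw \<gamma> (\<lambda>w. complex_of_real (P (a' w))
                 - (\<Sum>n. spoly (\<lambda>w. complex_of_real (a w)) n w / complex_of_real (Mh n))) w)
            \<le> C ^ (mlen \<gamma> + 1) * P (a' w) / jbr w powr (\<rho> * real (mlen \<gamma> + 1)))
     \<and> hypoelliptic beur A M \<rho> (\<lambda>w. complex_of_real (P (a' w)))"
proof -
  define f where "f = (\<lambda>w. complex_of_real (a w))"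
  define g where "g = (\<lambda>w. complex_of_real (a' w))"
  define K where "K = 1 + (\<Sum>\<gamma>\<in>{\<gamma>. mlen \<gamma> \<le> m}. \<bar>c \<gamma>\<bar>)"
  have m: "m \<ge> 1" using deg(1) by simp
  have Mp: "M p > 0" for p using wM(1) by (simp add: weight_seq_def)
  have \<rho>0: "\<rho> > 0" by (rule rho_pos[OF rho(1) AM Mp])
  have s\<rho>: "s * (1 - \<rho>) \<ge> 1" using s(1) rho(2) by (simp add: pos_divide_less_eq less_imp_le)
  have "1 / (1 - \<rho>) > 0" using rho(2) by simp
  then have "s > 0" using s(1) by linarith
  then have "s * (1 - \<rho>) \<le> s * 1" using \<rho>0 by (intro mult_left_mono) auto
  then have s1: "s \<ge> 1" using s\<rho> by linarith
  note Ms = s(2)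
  interpret series_weights Mh C0 s m
    using Mh m s1 by unfold_locales blast+
  obtain C1 where C1: "C1 > 0" "\<And>p. fact p * 1 ^ p \<le> C1 * A p"
    using fact_le_weight[OF wA(1,5,6) zero_less_one] by metis
  obtain C2 L where C2: "\<And>p. A p \<le> C2 * L ^ p * M p"
    using AM unfolding wsubset_def by blast
  \<comment> \<open>(M.3)' and (M.4) bound \<open>fact\<close> by \<open>A\<close>, and
    \<open>A\<close> is dominated by \<open>M\<close>; this makes \<open>assocf M\<close>
    finite.\<close>
  have FM: "fact p \<le> C1 * C2 * L ^ p * M p" for p
    using C1(2)[of p] mult_left_mono[OF C2[of p] less_imp_le[OF C1(1)]] by (simp add: mult_ac)
  note Mfacts = wM(1) FM Ms
  have K: "K \<ge> 1" by (simp add: K_def sum_nonneg)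
  have sf: "smooth f" and sg: "smooth g"
    unfolding f_def g_def a_def a'_def polyval_def principal_def by (rule poly_smooth)+
  have mf: "maj w (1 / jbr w) m (K * jbr w ^ m) f" for w
    unfolding f_def a_def polyval_def
    by (rule maj_mono[OF poly_maj[where p = m]]) (auto simp: K_def intro!: mult_right_mono)
  have mg: "maj w (1 / jbr w) m (K * jbr w ^ m) g" for w
    unfolding g_def a'_def principal_def
  proof (rule maj_mono[OF poly_maj[where p = m]])
    have "(\<Sum>\<gamma>\<in>{\<gamma>. mlen \<gamma> = m}. \<bar>c \<gamma>\<bar>) \<le> (\<Sum>\<gamma>\<in>{\<gamma>. mlen \<gamma> \<le> m}. \<bar>c \<gamma>\<bar>)"
      by (rule sum_mono2) auto
    then show "(\<Sum>\<gamma>\<in>{\<gamma>. mlen \<gamma> = m}. \<bar>c \<gamma>\<bar>) * jbr w ^ m \<le> K * jbr w ^ m"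
      unfolding K_def by (intro mult_right_mono) auto
  qed auto
  have fg: "maj w (1 / jbr w) m (K * jbr w ^ m / jbr w) (\<lambda>w. g w - f w)" for w
    unfolding f_def g_def a_def a'_def of_real_diff[symmetric] polyval_minus_principal
  proof (rule maj_mono[OF poly_maj[where p = "m - 1"]])
    have "(\<Sum>\<gamma>\<in>{\<gamma>. mlen \<gamma> < m}. \<bar>- c \<gamma>\<bar>) \<le> (\<Sum>\<gamma>\<in>{\<gamma>. mlen \<gamma> \<le> m}. \<bar>c \<gamma>\<bar>)"
      unfolding abs_minus_cancel by (rule sum_mono2) auto
    then have "(\<Sum>\<gamma>\<in>{\<gamma>. mlen \<gamma> < m}. \<bar>- c \<gamma>\<bar>) * jbr w ^ (m - 1) \<le> K * jbr w ^ (m - 1)"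
      unfolding K_def by (intro mult_right_mono) auto
    also have "\<dots> = K * jbr w ^ m / jbr w"
      using m by (simp add: power_eq_if)
    finally show "(\<Sum>\<gamma>\<in>{\<gamma>. mlen \<gamma> < m}. \<bar>- c \<gamma>\<bar>) * jbr w ^ (m - 1) \<le> K * jbr w ^ m / jbr w" .
  qed auto
  have "\<bar>a' w - a w\<bar> \<le> K * jbr w ^ m / jbr w" for w
    using majD[OF fg[of w], of "[]"] by (simp add: f_def g_def flip: of_real_diff)
  then obtain \<kappa> B0 where \<kappa>: "\<kappa> > 0" "\<And>w. w \<notin> Qset B0 \<Longrightarrow> a w \<ge> \<kappa> * jbr w ^ m"
    using polyval_lower_bound[OF ell m, of B1 K] B1(2) unfolding a_def a'_def by metis
  define U where "U = (\<lambda>w. \<Sum>n. f w ^ n / complex_of_real (Mh n))"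
  define U' where "U' = (\<lambda>w. \<Sum>n. g w ^ n / complex_of_real (Mh n))"
  define V where "V = (\<lambda>w. \<Sum>n. spoly f n w / complex_of_real (Mh n))"
  have P_eq: "P = (\<lambda>t. \<Sum>n. t ^ n / Mh n)" by (simp add: P_def)
  obtain E B where E: "E \<ge> 1" "B \<ge> 1"
    and pos: "\<And>w. w \<notin> Qset B \<Longrightarrow> a w > 0 \<and> a' w > 0 \<and> E * jbr w powr (- \<rho>) \<le> 1 / 2"
    and estU: "\<And>w is. w \<notin> Qset B \<Longrightarrow>
      cmod (iter_pd is U w) \<le> E ^ (length is + 1) * (jbr w powr (- \<rho>)) ^ length is * P (a w)"
    and estV: "\<And>w is. w \<notin> Qset B \<Longrightarrow>
      cmod (iter_pd is (\<lambda>w. U w - V w) w) \<le> E ^ (length is + 1) * (jbr w powr (- \<rho>)) ^ (length is + 2) * P (a w)"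
    and estU': "\<And>w is. w \<notin> Qset B \<Longrightarrow>
      cmod (iter_pd is (\<lambda>w. U' w - U w) w) \<le> E ^ (length is + 1) * (jbr w powr (- \<rho>)) ^ (length is + 1) * P (a w)"
    by (rule relative_estimates[OF f_def g_def P_eq U_def U'_def V_def sf mf sg mg K fg \<kappa> \<rho>0 rho(2) s\<rho>]) (assumption, rule that)
  have PU: "complex_of_real (P (a w)) = U w" and PU': "complex_of_real (P (a' w)) = U' w" for w
    unfolding P_def U_def U'_def f_def g_def suminf_of_real[OF summable_power_series] by simp_all
  have ex: "\<exists>c\<ge>0. \<exists>b. maj w c m b f" for w
  proof (intro exI conjI)
    show "maj w (1 / jbr w) m (K * jbr w ^ m) f" by (rule mf)
  qed simp
  have ss: "smooth (spoly f n)" for n by (rule smooth_spoly[OF sf ex])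
  obtain R C where R: "R > 0" "C \<ge> 0"
    and dV: "dominated m s R C (\<lambda>n w. spoly f n w / complex_of_real (Mh n))"
    using dominated_spoly[OF sf mf K] by blast
  have R': "4 * K * C0 > 0" using K C0 by simp
  note dU = dominated_power[OF sf mf K] and dU' = dominated_power[OF sg mg K]
  note gb = geom_bounded_power[OF sf mf K] geom_bounded_power[OF sg mg K] geom_bounded_spoly[OF sf mf K]
  note gamU = dominated_gamma_bound[OF dU R' s1 zero_le_one Mfacts]
    and gamU' = dominated_gamma_bound[OF dU' R' s1 zero_le_one Mfacts]
    and gamV = dominated_gamma_bound[OF dV R(1) s1 R(2) Mfacts]
  have smU: "smooth U" "smooth U'" "smooth V"
    unfolding U_def U'_def V_def by (intro geom_bounded_smooth_suminf gb)+
  have memU: "U \<in> Gamma beur A M \<rho>" and memU': "U' \<in> Gamma beur A M \<rho>" and memV: "V \<in> Gamma beur A M \<rho>"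
    unfolding U_def U'_def V_def
    by (rule suminf_GammaI[OF wA(1,5,6) less_imp_le[OF rho(2)]], rule gb, rule gamU gamU' gamV)+
  have P1: "P t \<ge> 1" if "t \<ge> 0" for t
    unfolding P_def by (rule power_series_ge_1[OF that])

  \<comment> \<open>Since \<open>E * jbr w powr (- \<rho>) \<le> 1 / 2\<close>, both
    \<open>U'\<close> and \<open>V\<close> differ from \<open>U\<close> by at most half of
    \<open>P (a w)\<close>, so bounds relative to \<open>P (a w)\<close> carry over to them. In
    \<open>U' - V\<close> the passage from \<open>a\<close> to \<open>a'\<close> gains one extra
    power and the sharp corrections two, whence the exponent in (iv).\<close>
  have bounds: "P (a w) \<le> 2 * P (a' w) \<and> P (a w) \<le> 2 * cmod (V w)
      \<and> cmod (iter_pd is V w) \<le> 2 * E ^ (length is + 1) * (jbr w powr (- \<rho>)) ^ length is * P (a w)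
      \<and> cmod (iter_pd is U' w) \<le> 2 * E ^ (length is + 1) * (jbr w powr (- \<rho>)) ^ length is * P (a w)
      \<and> cmod (iter_pd is (\<lambda>w. U' w - V w) w)
          \<le> 2 * E ^ (length is + 1) * (jbr w powr (- \<rho>)) ^ (length is + 1) * P (a w)"
    if w: "w \<notin> Qset B" for w "is"
  proof -
    define z where "z = jbr w powr (- \<rho>)"
    let ?k = "length is"
    let ?X = "E ^ (?k + 1)"
    have ap: "a w > 0" "a' w > 0" and Ez: "E * z \<le> 1 / 2" using pos[OF w] by (auto simp: z_def)
    have z0: "0 \<le> z" by (simp add: z_def)
    have z1: "z \<le> 1" using mult_right_mono[OF E(1) z0] Ez by linarith
    have Pa: "P (a w) \<ge> 1" "P (a' w) \<ge> 1" using P1 ap by (simp_all add: less_imp_le)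
    have X: "?X \<ge> 0" using E(1) by simp
    have mono: "?X * z ^ i * P (a w) \<le> ?X * z ^ l * P (a w)" if "l \<le> i" for i l
      using X Pa z0 z1 that by (intro mult_right_mono mult_left_mono power_decreasing) auto
    note est = estU[OF w, of "is", folded z_def] estV[OF w, of "is", folded z_def] estU'[OF w, of "is", folded z_def]
    have half: "E * z ^ i * P (a w) \<le> 1 / 2 * P (a w)" if "i \<ge> 1" for i
    proof -
      have "E * z ^ i \<le> E * z ^ 1"
        using E(1) z0 z1 that by (intro mult_left_mono power_decreasing) auto
      then show ?thesis using Ez Pa by (intro mult_right_mono) auto
    qed
    have U: "cmod (U w) = P (a w)" "cmod (U' w) = P (a' w)"
      using Pa by (simp_all flip: PU PU')
    have "cmod (U w - V w) \<le> E * z ^ 2 * P (a w)"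
      using estV[OF w, of "[]", folded z_def] by (simp add: power2_eq_square)
    then have 2: "P (a w) \<le> 2 * cmod (V w)"
      using half[of 2] U(1) norm_triangle_ineq2[of "U w" "V w"] by simp
    have "cmod (U' w - U w) \<le> E * z ^ 1 * P (a w)"
      using estU'[OF w, of "[]", folded z_def] by simp
    then have 1: "P (a w) \<le> 2 * P (a' w)"
      using half[of 1] U norm_triangle_ineq2[of "U w" "U' w"] by (simp add: norm_minus_commute)
    have "iter_pd is V w = iter_pd is U w - iter_pd is (\<lambda>w. U w - V w) w"
      by (simp add: iter_pd_diff smU)
    then have 3: "cmod (iter_pd is V w) \<le> 2 * ?X * z ^ ?k * P (a w)"
      using est(1,2) mono[of ?k "?k + 2"] norm_triangle_ineq4[of "iter_pd is U w" "iter_pd is (\<lambda>w. U w - V w) w"]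
      by simp
    have "iter_pd is U' w = iter_pd is U w + iter_pd is (\<lambda>w. U' w - U w) w"
      by (simp add: iter_pd_diff smU)
    then have 4: "cmod (iter_pd is U' w) \<le> 2 * ?X * z ^ ?k * P (a w)"
      using est(1,3) mono[of ?k "?k + 1"] norm_triangle_ineq[of "iter_pd is U w" "iter_pd is (\<lambda>w. U' w - U w) w"]
      by simp
    have "iter_pd is (\<lambda>w. U' w - V w) w = iter_pd is (\<lambda>w. U' w - U w) w + iter_pd is (\<lambda>w. U w - V w) w"
      by (simp add: iter_pd_diff smU)
    then have "cmod (iter_pd is (\<lambda>w. U' w - V w) w) \<le> 2 * ?X * z ^ (?k + 1) * P (a w)"
      using est(2,3) mono[of "?k + 1" "?k + 2"]
        norm_triangle_ineq[of "iter_pd is (\<lambda>w. U' w - U w) w" "iter_pd is (\<lambda>w. U w - V w) w"]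
      by simp
    with 1 2 3 4 show ?thesis unfolding z_def by blast
  qed
  \<comment> \<open>One 2 comes from the estimates and one from \<open>P (a w) \<le> 2 * Q\<close>;
    \<open>4 \<le> 4 ^ (k + 1)\<close> moves both into the base.\<close>
  have conv: "X \<le> (4 * E) ^ (k + 1) * Q / jbr w powr (\<rho> * real i)"
    if "w \<notin> Qset B" "X \<le> 2 * E ^ (k + 1) * (jbr w powr (- \<rho>)) ^ i * P (a w)" "P (a w) \<le> 2 * Q"
    for X Q and w :: "'d phase" and k i
  proof -
    have Q: "Q \<ge> 0" using that(3) P1[of "a w"] pos[OF that(1)] by simp
    have "2 * E ^ (k + 1) * (jbr w powr (- \<rho>)) ^ i * P (a w) \<le> 2 * E ^ (k + 1) * (jbr w powr (- \<rho>)) ^ i * (2 * Q)"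
      using that(3) E(1) by (intro mult_left_mono) auto
    also have "\<dots> = 4 ^ 1 * (E ^ (k + 1) * (jbr w powr (- \<rho>)) ^ i * Q)" by simp
    also have "\<dots> \<le> 4 ^ (k + 1) * (E ^ (k + 1) * (jbr w powr (- \<rho>)) ^ i * Q)"
      using Q E(1) by (intro mult_right_mono power_increasing) auto
    also have "\<dots> = (4 * E) ^ (k + 1) * Q / jbr w powr (\<rho> * real i)"
      unfolding powr_minus_power[OF jbr_pos] power_mult_distrib by simp
    finally show ?thesis using that(2) by linarith
  qed
  have estU2: "cmod (iter_pd is U w) \<le> 2 * E ^ (length is + 1) * (jbr w powr (- \<rho>)) ^ length is * P (a w)"
    "cmod (iter_pd is (\<lambda>w. U w - V w) w) \<le> 2 * E ^ (length is + 1) * (jbr w powr (- \<rho>)) ^ (length is + 2) * P (a w)"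
    if w: "w \<notin> Qset B" for w "is"
  proof -
    have "E ^ (length is + 1) * (jbr w powr (- \<rho>)) ^ i * P (a w) \<ge> 0" for i
      using E(1) P1[of "a w"] pos[OF w] by (intro mult_nonneg_nonneg) auto
    from this[of "length is"] this[of "length is + 2"] estU[OF w, of "is"] estV[OF w, of "is"]
    show "cmod (iter_pd is U w) \<le> 2 * E ^ (length is + 1) * (jbr w powr (- \<rho>)) ^ length is * P (a w)"
      "cmod (iter_pd is (\<lambda>w. U w - V w) w) \<le> 2 * E ^ (length is + 1) * (jbr w powr (- \<rho>)) ^ (length is + 2) * P (a w)"
      by linarith+
  qed
  have Pself: "P (a w) \<le> 2 * P (a w)" if "w \<notin> Qset B" for w
    using P1[of "a w"] pos[OF that] by simp
  have B0: "B > 0" and E4: "4 * E \<ge> 1" "4 * E > 1" using E by linarith+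

  have i: "continuous_on UNIV (\<lambda>w. P \<bar>a w\<bar>) \<and> ultrapoly_growth beur M (\<lambda>w. P \<bar>a w\<bar>)"
    unfolding P_def by (rule continuous_ultrapoly_series[OF _ _ K Mfacts]) (use sf mf in \<open>simp_all add: f_def\<close>)
  have i': "continuous_on UNIV (\<lambda>w. P \<bar>a' w\<bar>) \<and> ultrapoly_growth beur M (\<lambda>w. P \<bar>a' w\<bar>)"
    unfolding P_def by (rule continuous_ultrapoly_series[OF _ _ K Mfacts]) (use sg mg in \<open>simp_all add: g_def\<close>)
  have ii: "abs_conv_Gamma beur A M 1 (\<lambda>n w. spoly f n w / complex_of_real (Mh n))"
    "abs_conv_Gamma beur A M 1 (\<lambda>n w. f w ^ n / complex_of_real (Mh n))"
    "abs_conv_Gamma beur A M 1 (\<lambda>n w. g w ^ n / complex_of_real (Mh n))"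
    by (rule abs_conv_GammaI[OF wA(1,5,6) order_refl gamV] abs_conv_GammaI[OF wA(1,5,6) order_refl gamU]
        abs_conv_GammaI[OF wA(1,5,6) order_refl gamU'])+
  have iii: "cmod (\<Sum>n. Dw \<gamma> (spoly f n) w / complex_of_real (Mh n))
            \<le> (4 * E) ^ (mlen \<gamma> + 1) * P (a w) / jbr w powr (\<rho> * real (mlen \<gamma>))
        \<and> cmod (Dw \<gamma> U w) \<le> (4 * E) ^ (mlen \<gamma> + 1) * P (a w) / jbr w powr (\<rho> * real (mlen \<gamma>))
        \<and> cmod (Dw \<gamma> (\<lambda>w. U w - V w) w)
            \<le> (4 * E) ^ (mlen \<gamma> + 1) * P (a w) / jbr w powr (\<rho> * real (mlen \<gamma> + 2))"
    if w: "w \<notin> Qset B" for w \<gamma>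
  proof -
    obtain "is" where L: "length is = mlen \<gamma>" "\<And>f w. Dw \<gamma> f w = (- \<i>) ^ mlen \<gamma> * iter_pd is f w"
      "\<And>f w. cmod (Dw \<gamma> f w) = cmod (iter_pd is f w)"
      by (rule Dw_norm[of \<gamma>]) (rule that)
    have sm: "summable (\<lambda>n. iter_pd is (spoly f n) w / complex_of_real (Mh n))"
      using geom_bounded_summable[OF gb(3), of "is" w] by (simp add: iter_pd_divide ss)
    \<comment> \<open>Termwise differentiation identifies the sum of derivatives with the derivative
      of \<open>V\<close>.\<close>
    have "(\<Sum>n. Dw \<gamma> (spoly f n) w / complex_of_real (Mh n))
        = (- \<i>) ^ mlen \<gamma> * (\<Sum>n. iter_pd is (spoly f n) w / complex_of_real (Mh n))"
      unfolding L(2) times_divide_eq_right[symmetric] by (rule suminf_mult[OF sm])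
    also have "\<dots> = (- \<i>) ^ mlen \<gamma> * iter_pd is V w"
      unfolding V_def iter_pd_suminf_divide[OF gb(3) ss] ..
    finally have eq: "cmod (\<Sum>n. Dw \<gamma> (spoly f n) w / complex_of_real (Mh n)) = cmod (iter_pd is V w)"
      by (simp add: norm_mult norm_power)
    show ?thesis
      unfolding eq L(3) L(1)[symmetric]
      by (intro conjI conv[OF w _ Pself[OF w]] estU2[OF w]
          bounds[OF w, THEN conjunct2, THEN conjunct2, THEN conjunct1])
  qed
  have iv: "cmod (Dw \<gamma> U' w) \<le> (4 * E) ^ (mlen \<gamma> + 1) * P (a' w) / jbr w powr (\<rho> * real (mlen \<gamma>))
        \<and> cmod (Dw \<gamma> (\<lambda>w. U' w - V w) w)
            \<le> (4 * E) ^ (mlen \<gamma> + 1) * P (a' w) / jbr w powr (\<rho> * real (mlen \<gamma> + 1))"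
    if w: "w \<notin> Qset B" for w \<gamma>
  proof -
    obtain "is" where L: "length is = mlen \<gamma>" "\<And>f w. cmod (Dw \<gamma> f w) = cmod (iter_pd is f w)"
      by (rule Dw_norm[of \<gamma>]) (rule that)
    show ?thesis
      unfolding L(2) L(1)[symmetric]
      using conv[OF w, of _ "length is" _ "P (a' w)"] bounds[OF w, of "is"] by blast
  qed
  note hypo = hypoellipticI[OF wA(1,5,6) wM(1) FM _ B0 E4(1)]
  have hV: "hypoelliptic beur A M \<rho> V"
  proof (rule hypo[OF memV])
    \<comment> \<open>The term \<open>n = 0\<close> gives \<open>P (a w) \<ge> 1\<close>, and
      \<open>P (a w) \<le> 2 * cmod (V w)\<close>.\<close>
    show "1 / 2 \<le> cmod (V w)" if w: "w \<notin> Qset B" for w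
      using bounds[OF w] P1[of "a w"] pos[OF w] by force
    show "cmod (iter_pd is V w) \<le> (4 * E) ^ (length is + 1) * cmod (V w) / jbr w powr (\<rho> * real (length is))"
      if w: "w \<notin> Qset B" for w "is"
      using conv[OF w, of _ "length is" _ "cmod (V w)"] bounds[OF w, of "is"] by blast
  qed
  have hU: "hypoelliptic beur A M \<rho> U"
  proof (rule hypo[OF memU])
    fix w :: "'d phase" assume w: "w \<notin> Qset B"
    have Pc: "cmod (U w) = P (a w)" using P1[of "a w"] pos[OF w] by (simp flip: PU)
    show "1 / 2 \<le> cmod (U w)" using P1[of "a w"] pos[OF w] by (simp add: Pc)
    show "cmod (iter_pd is U w) \<le> (4 * E) ^ (length is + 1) * cmod (U w) / jbr w powr (\<rho> * real (length is))" for "is"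
      unfolding Pc by (rule conv[OF w estU2(1)[OF w] Pself[OF w]])
  qed
  have hU': "hypoelliptic beur A M \<rho> U'"
  proof (rule hypo[OF memU'])
    fix w :: "'d phase" assume w: "w \<notin> Qset B"
    have Pc: "cmod (U' w) = P (a' w)" using P1[of "a' w"] pos[OF w] by (simp flip: PU')
    show "1 / 2 \<le> cmod (U' w)" using P1[of "a' w"] pos[OF w] by (simp add: Pc)
    show "cmod (iter_pd is U' w) \<le> (4 * E) ^ (length is + 1) * cmod (U' w) / jbr w powr (\<rho> * real (length is))" for "is"
      unfolding Pc using conv[OF w, of _ "length is" _ "P (a' w)"] bounds[OF w, of "is"] by blast
  qed
  have iii': "\<exists>C>1. \<exists>B>0. \<forall>w \<gamma>. w \<notin> Qset B \<longrightarrow>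
      cmod (\<Sum>n. Dw \<gamma> (spoly f n) w / complex_of_real (Mh n))
            \<le> C ^ (mlen \<gamma> + 1) * P (a w) / jbr w powr (\<rho> * real (mlen \<gamma>))
        \<and> cmod (Dw \<gamma> U w) \<le> C ^ (mlen \<gamma> + 1) * P (a w) / jbr w powr (\<rho> * real (mlen \<gamma>))
        \<and> cmod (Dw \<gamma> (\<lambda>w. U w - V w) w)
            \<le> C ^ (mlen \<gamma> + 1) * P (a w) / jbr w powr (\<rho> * real (mlen \<gamma> + 2))"
    using E4(2) B0 iii by blast
  have iv': "\<exists>C>1. \<exists>B>0. \<forall>w \<gamma>. w \<notin> Qset B \<longrightarrow>
      cmod (Dw \<gamma> U' w) \<le> C ^ (mlen \<gamma> + 1) * P (a' w) / jbr w powr (\<rho> * real (mlen \<gamma>))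
        \<and> cmod (Dw \<gamma> (\<lambda>w. U' w - V w) w)
            \<le> C ^ (mlen \<gamma> + 1) * P (a' w) / jbr w powr (\<rho> * real (mlen \<gamma> + 1))"
    using E4(2) B0 iv by blast
  have pw: "complex_of_real (a w ^ n / Mh n) = f w ^ n / complex_of_real (Mh n)"
    "complex_of_real (a' w ^ n / Mh n) = g w ^ n / complex_of_real (Mh n)" for w n
    by (simp_all add: f_def g_def)
  show ?thesis
    using i i' ii iii' iv' hU hU' hV
    unfolding pw PU PU' f_def[symmetric] V_def by blast
qed

end
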